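(* Let $\mathsf{T}$ be a rooted plane tree. The following are equivalent: (I) $\mathrm{MN}(\mathsf{T})$ is semidistributive; (II) $\mathrm{MN}(\mathsf{T})$ is meet-semidistributive; (III) $\mathrm{MN}(\mathsf{T})$ is join-semidistributive; (IV) $\mathsf{T}$ does not contain the tree $\mathsf{Y}$, where $\mathsf{Y}$ is the rooted plane tree with vertices $0,1,2,3,4$ in which the root $0$ has children $1$ and $4$ (in that left-to-right order) and vertex $1$ has children $2$ and $3$ (in that order); (V) every vertex of $\mathsf{T}$ that is not in the rightmost branch of $\mathsf{T}$ is covered by at most $1$ element of $\mathsf{T}$.
   Context: A rooted plane tree is a rooted tree in which the children of each vertex are linearly ordered from left to right. For a rooted plane tree $\mathsf{T}$ with $n+1$ vertices and vertex set $\mathsf{V}$, view $\mathsf{V}$ as a poset $(\mathsf{V},\leq_\mathsf{T})$ in which the root is the unique minimum and each non-root vertex covers exactly its parent (so "$v$ is covered by $w$" means $w$ is a child of $v$). Identify $\mathsf{V}$ with $\{0,\ldots,n\}$ so that $0,1,\ldots,n$ is the preorder traversal (root first, then subtrees of the root, recursively in preorder, left to right). A tube is a set of vertices inducing a connected subgraph; its root is its $\leq_\mathsf{T}$-minimum. A nesting is a collection $\mathcal N$ of tubes with $\mathsf{V}\in\mathcal N$, each tube of size $\geq 2$, any two tubes nested or disjoint; a maximal nesting has exactly $n$ tubes; $\mathrm{MN}(\mathsf{T})$ is the set of maximal nestings. For $\mathcal N,\mathcal N'\in\mathrm{MN}(\mathsf{T})$ with $\tau\in\mathcal N\setminus\mathcal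 N'$, $\tau'\in\mathcal N'\setminus\mathcal N$ and $\mathcal N\setminus\{\tau\}=\mathcal N'\setminus\{\tau'\}$, declare $\mathcal N\lessdot\mathcal N'$ if some (equivalently every) element of $\tau\setminus\tau'$ is less than some (equivalently every) element of $\tau'\setminus\tau$ in $\mathbb Z$; $\mathrm{MN}(\mathsf{T})$ is ordered by the reflexive–transitive closure of these relations (it is a lattice). A tree $\mathsf{T}$ contains $\mathsf{T}'$ if $\mathsf{T}'$ can be obtained from $\mathsf{T}$ by contracting edges (as rooted plane trees). The rightmost branch of $\mathsf{T}$ is defined recursively: if $\mathsf{T}$ has one vertex it is $\{$root$\}$; otherwise it is $\{$root$\}$ union the rightmost branch of the subtree rooted at the rightmost child of the root. A lattice $L$ is meet-semidistributive if $x\wedge y=x\wedge z$ implies $x\wedge y=x\wedge(y\vee z)$ for all $x,y,z$; join-semidistributive if $x\vee y=x\vee z$ implies $x\vee y=x\vee(y\wedge z)$; semidistributive if both.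
   Formalization: The order on MN(T) is read as: some element of τ∖τ′ is less than every element of τ′∖τ (their minima are compared), since "some" and "every" are not equivalent, e.g. τ={0,1,3}, τ′={1,2} for root 0 with children 1, 3 and 2 a child of 1. *)

theory Defs
  imports "HOL-Algebra.Lattice"
begin

section \<open>Semidistributive lattices\<close>

locale meet_semidistributive_lattice = lattice +
  assumes meet_semidistrib:
    "\<lbrakk>x \<in> carrier L; y \<in> carrier L; z \<in> carrier L; x \<sqinter> y = x \<sqinter> z\<rbrakk>
      \<Longrightarrow> x \<sqinter> y = x \<sqinter> (y \<squnion> z)"

locale join_semidistributive_lattice = lattice +
  assumes join_semidistrib:
    "\<lbrakk>x \<in> carrier L; y \<in> carrier L; z \<in> carrier L; x \<squnion> y = x \<squnion> z\<rbrakk>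
      \<Longrightarrow> x \<squnion> y = x \<squnion> (y \<sqinter> z)"

locale semidistributive_lattice =
  meet_semidistributive_lattice + join_semidistributive_lattice


section \<open>Rooted plane trees\<close>

datatype plane_tree = Node "plane_tree list"

fun num_vertices :: "plane_tree \<Rightarrow> nat" where
  "num_vertices (Node ts) = Suc (\<Sum>t\<leftarrow>ts. num_vertices t)"

text \<open>
  The vertices are identified with their positions in the preorder traversal.
\<close>

definition vertices :: "plane_tree \<Rightarrow> nat set" where
  "vertices T = {..<num_vertices T}"

text \<open>
  The (parent, child) pairs of a tree whose preorder labels start at \<open>k\<close>, and of a list of
  consecutive subtrees of a vertex \<open>p\<close> whose preorder labels start at \<open>k\<close>.
\<close>

fun child_pairs_from :: "nat \<Rightarrow> plane_tree \<Rightarrow> (nat \<times> nat) set"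
  and child_pairs_forest :: "nat \<Rightarrow> nat \<Rightarrow> plane_tree list \<Rightarrow> (nat \<times> nat) set" where
  "child_pairs_from k (Node ts) = child_pairs_forest k (Suc k) ts"
| "child_pairs_forest p k [] = {}"
| "child_pairs_forest p k (t # ts) =
     insert (p, k) (child_pairs_from k t \<union> child_pairs_forest p (k + num_vertices t) ts)"

text \<open>
  \<open>(v, w) \<in> child_pairs T\<close> says that \<open>w\<close> is a child of \<open>v\<close>, i.e. that \<open>v\<close> is covered by \<open>w\<close>
  in the tree poset.
\<close>

definition child_pairs :: "plane_tree \<Rightarrow> (nat \<times> nat) set" where
  "child_pairs T = child_pairs_from 0 T"

text \<open>Rightmost branch of a tree whose preorder labels start at \<open>k\<close>.\<close>

function rightmost_branch_from :: "nat \<Rightarrow> plane_tree \<Rightarrow> nat set" where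
  "rightmost_branch_from k (Node ts) =
     (if ts = [] then {k}
      else insert k (rightmost_branch_from
             (Suc k + (\<Sum>t\<leftarrow>butlast ts. num_vertices t)) (last ts)))"
  by pat_completeness auto
termination
  by (relation "measure (\<lambda>(k, T). size T)")
     (auto simp: less_Suc_eq_le intro!: size_list_estimation' [OF last_in_set])

definition rightmost_branch :: "plane_tree \<Rightarrow> nat set" where
  "rightmost_branch T = rightmost_branch_from 0 T"

text \<open>
  Contracting the edge between a vertex and one of its children puts the children of the child,
  in their order, in the place of the child.
\<close>

inductive contract_edge :: "plane_tree \<Rightarrow> plane_tree \<Rightarrow> bool" where
  at_root: "contract_edge (Node (us @ Node vs # ws)) (Node (us @ vs @ ws))"
| in_subtree: "contract_edge t t' \<Longrightarrow> contract_edge (Node (us @ t # ws)) (Node (us @ t' # ws))"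

definition contains_tree :: "plane_tree \<Rightarrow> plane_tree \<Rightarrow> bool" where
  "contains_tree T T' \<longleftrightarrow> contract_edge\<^sup>*\<^sup>* T T'"

definition Y_tree :: plane_tree where
  "Y_tree = Node [Node [Node [], Node []], Node []]"

lemma vertices_Y_tree: "vertices Y_tree = {0, 1, 2, 3, 4}"
  by (auto simp: vertices_def Y_tree_def)

lemma child_pairs_Y_tree: "child_pairs Y_tree = {(0, 1), (0, 4), (1, 2), (1, 3)}"
  by (auto simp: child_pairs_def Y_tree_def)


section \<open>Maximal nestings\<close>

definition tube :: "plane_tree \<Rightarrow> nat set \<Rightarrow> bool" where
  "tube T X \<longleftrightarrow> X \<noteq> {} \<and> X \<subseteq> vertices T \<and>
     (\<forall>x\<in>X. \<forall>y\<in>X. (x, y) \<in> (Restr (child_pairs T \<union> (child_pairs T)\<inverse>) X)\<^sup>*)"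

definition nesting :: "plane_tree \<Rightarrow> nat set set \<Rightarrow> bool" where
  "nesting T N \<longleftrightarrow>
     vertices T \<in> N \<and>
     (\<forall>X\<in>N. tube T X \<and> 2 \<le> card X) \<and>
     (\<forall>X\<in>N. \<forall>Y\<in>N. X \<subseteq> Y \<or> Y \<subseteq> X \<or> X \<inter> Y = {})"

definition maximal_nesting :: "plane_tree \<Rightarrow> nat set set \<Rightarrow> bool" where
  "maximal_nesting T N \<longleftrightarrow> nesting T N \<and> (\<forall>N'. nesting T N' \<and> N \<subseteq> N' \<longrightarrow> N' = N)"

text \<open>
  A move exchanges a single tube \<open>X\<close> for another tube \<open>X'\<close>. The quantifiers on \<open>a\<close> and \<open>b\<close>
  matter: for the root 0 with children 1 and 3, where 1 has the child 2, the tubes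
  \<open>X = {0, 1, 3}\<close> and \<open>X' = {1, 2}\<close> are exchanged by a move and have \<open>X - X' = {0, 3}\<close> and
  \<open>X' - X = {2}\<close>, so neither difference lies entirely below the other. The form chosen here compares the
  minima, which are the roots (tree minima) of the two differences, and hence
  orients every exchange in exactly one direction.
\<close>

definition nesting_move :: "plane_tree \<Rightarrow> (nat set set \<times> nat set set) set" where
  "nesting_move T =
     {(N, N'). maximal_nesting T N \<and> maximal_nesting T N' \<and>
        (\<exists>X\<in>N - N'. \<exists>X'\<in>N' - N. N - {X} = N' - {X'} \<and>
           (\<exists>a\<in>X - X'. \<forall>b\<in>X' - X. a < b))}"

definition MN :: "plane_tree \<Rightarrow> nat set set gorder" where
  "MN T = \<lparr>carrier = {N. maximal_nesting T N}, eq = (=),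
           le = (\<lambda>N N'. (N, N') \<in> (nesting_move T)\<^sup>*)\<rparr>"

end

(* A maximal nesting records, for every path of edges, which edge is split off first; this gives a
   relation "k lies above i" on the edges, labelled by their lower endpoints.  A move exchanges an
   edge e with a smaller edge f directly below it, so moving up shrinks the set of inversions (pairs
   i < k with k above i), and conversely the order turns out to be reverse inclusion of inversion
   sets.  The largest inversion set inside a transitive relation is found by a greedy choice of the
   topmost edges.  Hence joins are greedy interiors of intersections, meets are transitive closures
   of unions, and the order is a lattice for every tree.

   If vertices off the rightmost branch have at most one child, then for each move from N to N' the
   nestings below N' but not below N (dually, above N but not above N') are closed under meets
   (joins), which yields both semidistributive laws.  Otherwise there are edges a < b < c < d with b
   and c the child edges of a and d to the right of them, and rankings of the edges that differ only
   in the order of these four violate both laws.  On the side of trees, the condition is the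
   recursive notion of a comb, which is preserved by contraction and fails for Y. *)

theory Submission
  imports Defs
begin

section \<open>Edges of a tree in preorder\<close>

text \<open>Two extreme shapes guide the set-up. For a corolla, the edges on the path between i and
  k are only i and k, so a search relation is a linear order and its inversions are those of a
  permutation; for a path it is a binary search tree. Inversion sets of permutations are
  co-transitive: if i < j < k and (i, k) is an inversion, then so is (i, j) or (j, k). The obstacle
  is that this fails for trees, since an edge above both i and k may cut them off from j.
  \<open>search_cotrans\<close> saves a weak form in which j is replaced by an ancestor h of j.
  Hence the main arguments choose extremal edges (topmost, least, last), so that the detour through
  h contradicts the choice. A failure of a semidistributive law is always reduced to one move. If x
  meet y is strictly below x meet (y join z), some move from N = x meet y to N' stays below the
  second element; then y and z are above N and not above N', while their join is above N'. For the
  other law the last move into x join y is taken. Joins and meets come from different constructions,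
  so the two closure statements get separate proofs, \<open>common_descent\<close> and
  \<open>common_ascent\<close>.\<close>

locale preorder_tree =
  fixes n :: nat and par :: "nat \<Rightarrow> nat"
  assumes par_less: "\<lbrakk>1 \<le> k; k \<le> n\<rbrakk> \<Longrightarrow> par k < k"
    and par_nested: "\<lbrakk>1 \<le> k; k \<le> n; par k < j; j < k\<rbrakk> \<Longrightarrow> par k \<le> par j"
begin

inductive anc :: "nat \<Rightarrow> nat \<Rightarrow> bool" where
  anc_refl [simp, intro]: "anc a a"
| anc_step: "\<lbrakk>anc a (par k); 1 \<le> k; k \<le> n\<rbrakk> \<Longrightarrow> anc a k"

text \<open>The edge between \<open>k\<close> and its parent is labelled by \<open>k\<close>.\<close>

definition E :: "nat set" where "E = {1..n}"

lemma finite_E [simp]: "finite E"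
  by (simp add: E_def)

lemma anc_par: "k \<in> E \<Longrightarrow> anc a k \<longleftrightarrow> a = k \<or> anc a (par k)"
  by (auto simp: E_def intro: anc_step elim: anc.cases)

lemma anc_le: "anc a b \<Longrightarrow> a \<le> b"
  by (induction rule: anc.induct) (use par_less in force)+

lemma par_less': "k \<in> E \<Longrightarrow> par k < k"
  using par_less by (auto simp: E_def)

lemma anc_par_iff: "k \<in> E \<Longrightarrow> anc a (par k) \<longleftrightarrow> anc a k \<and> a \<noteq> k"
  using anc_par[of k a] anc_le[of k "par k"] par_less'[of k] by auto

lemma anc_trans: "anc b c \<Longrightarrow> anc a b \<Longrightarrow> anc a c"
  by (induction rule: anc.induct) (auto intro: anc_step)

lemma anc_antisym: "anc a b \<Longrightarrow> anc b a \<Longrightarrow> a = b"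
  by (meson anc_le antisym)

lemma anc_linear: "anc a c \<Longrightarrow> anc b c \<Longrightarrow> anc a b \<or> anc b a"
proof (induction arbitrary: b rule: anc.induct)
  case (anc_step a k)
  from anc_step.prems anc_step.hyps anc_step.IH show ?case
    by (cases rule: anc.cases) (auto intro: anc.anc_step)
qed auto

lemma anc_zero: "b \<le> n \<Longrightarrow> anc 0 b"
proof (induction b rule: less_induct)
  case (less b)
  show ?case
  proof (cases "b = 0")
    case False
    then have "par b < b" using less.prems by (intro par_less) auto
    with less False show ?thesis by (auto intro!: anc_step[of 0 b])
  qed auto
qed

lemma child_towards:
  assumes "anc a b" "a \<noteq> b"
  obtains c where "c \<in> E" "par c = a" "anc c b"
proof -
  have "\<exists>c\<in>E. par c = a \<and> anc c b"
    using assms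
  proof (induction rule: anc.induct)
    case (anc_step a k)
    show ?case
    proof (cases "a = par k")
      case False
      then obtain c where "c \<in> E" "par c = a" "anc c (par k)" using anc_step.IH by blast
      then show ?thesis using anc_step.hyps anc.anc_step by blast
    qed (use anc_step.hyps in \<open>auto simp: E_def\<close>)
  qed simp
  with that show ?thesis by blast
qed

text \<open>Here \<open>par_nested\<close> enters: if \<open>b\<close> lies strictly between
  \<open>par c\<close> and \<open>c\<close>, then \<open>par b\<close> is at least
  \<open>par c\<close>, hence at least \<open>a\<close>, and the induction can climb from
  \<open>b\<close>; otherwise it climbs from \<open>c\<close>.\<close>

lemma anc_interval: "anc a c \<Longrightarrow> a \<le> b \<Longrightarrow> b \<le> c \<Longrightarrow> c \<le> n \<Longrightarrow> anc a b"
proof (induction "b + c" arbitrary: b c rule: less_induct)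
  case less
  show ?case
  proof (cases "a = b \<or> b = c")
    case False
    then have c: "c \<in> E" and b: "b \<in> E" using less.prems by (auto simp: E_def)
    have pc: "anc a (par c)" using c False less.prems by (auto simp: anc_par)
    have pc_less: "par c < c" "par b < b" using c b by (auto intro: par_less')
    show ?thesis
    proof (cases "b \<le> par c")
      case True
      then show ?thesis using less.hyps[of b "par c"] less.prems pc pc_less by auto
    next
      case nle: False
      then have "par c \<le> par b" using False less.prems c by (intro par_nested) (auto simp: E_def)
      then have "a \<le> par b" using anc_le[OF pc] by simp
      then have "anc a (par b)" using less.hyps[of "par b" c] less.prems pc_less by auto
      then show ?thesis using b by (simp add: anc_par)
    qed
  qed (use less.prems in auto)
qed

text \<open>For edges, \<open>sep h i k\<close> holds if removing \<open>h\<close> separates the vertices \<open>i\<close> and \<open>k\<close>, and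
  \<open>btw h i k\<close> if \<open>h\<close> lies on the shortest path containing the edges \<open>i\<close> and \<open>k\<close>.\<close>

definition sep :: "nat \<Rightarrow> nat \<Rightarrow> nat \<Rightarrow> bool" where
  "sep h u v \<longleftrightarrow> anc h u \<noteq> anc h v"

definition btw :: "nat \<Rightarrow> nat \<Rightarrow> nat \<Rightarrow> bool" where
  "btw h i k \<longleftrightarrow> h = i \<or> h = k \<or> sep h i k"

lemma sep_commute: "sep h u v \<longleftrightarrow> sep h v u"
  by (auto simp: sep_def)

lemma btw_commute: "btw h i k \<longleftrightarrow> btw h k i"
  by (auto simp: btw_def sep_def)

lemma btw_ends [simp, intro]: "btw i i k" "btw k i k"
  by (auto simp: btw_def)

lemma btw_split: "btw h i k \<Longrightarrow> btw h i j \<or> btw h j k"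
  by (auto simp: btw_def sep_def)

text \<open>Paths in a tree are convex: going from a member of a path to one of its ends never
  leaves the path.\<close>

lemma btw_shrink: "btw t i k \<Longrightarrow> btw h t k \<Longrightarrow> btw h i k"
proof (rule ccontr)
  assume t: "btw t i k" and h: "btw h t k" and n: "\<not> btw h i k"
  from n have hn: "h \<noteq> i" "h \<noteq> k" and eq: "anc h i \<longleftrightarrow> anc h k" by (auto simp: btw_def sep_def)
  have "h \<noteq> t" using t n by blast
  with h hn have ne: "anc h t \<noteq> anc h k" by (auto simp: btw_def sep_def)
  with eq have st: "anc t i \<noteq> anc t k" using t by (auto simp: btw_def sep_def)
  show False
  proof (cases "anc h k")
    case True
    then have "anc t h" using anc_linear[of t k h] anc_linear[of t i h] st eq ne by blast
    with True eq st show False using anc_trans by blast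
  next
    case False
    with ne eq st show False using anc_trans by blast
  qed
qed

lemma btw_shrink2: "btw t i k \<Longrightarrow> btw s i k \<Longrightarrow> btw h t s \<Longrightarrow> btw h i k"
  using btw_split[of h t s k] btw_shrink[of t i k h] btw_shrink[of s i k h] btw_commute[of h k s]
  by blast

text \<open>A separating edge is an ancestor of one of the two ends, so its label cannot exceed the
  larger end. For this reason exchanging \<open>e\<close> with a smaller \<open>f\<close> creates no
  inversions.\<close>

lemma btw_less: "btw h i k \<Longrightarrow> i < k \<Longrightarrow> h \<noteq> k \<Longrightarrow> h < k"
  unfolding btw_def sep_def using anc_le[of h i] anc_le[of h k] by auto

lemma btw_in_E: "btw h i k \<Longrightarrow> i \<in> E \<Longrightarrow> k \<in> E \<Longrightarrow> h \<in> E"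
proof -
  assume h: "btw h i k" and i: "i \<in> E" and k: "k \<in> E"
  have "h \<noteq> 0" using h i k anc_zero[of i] anc_zero[of k] unfolding btw_def sep_def E_def
    by (metis atLeastAtMost_iff not_one_le_zero)
  moreover have "h \<le> n" using h i k anc_le[of h i] anc_le[of h k] by (auto simp: btw_def sep_def E_def)
  ultimately show ?thesis by (simp add: E_def)
qed

lemma sep_par: "i \<in> E \<Longrightarrow> sep h (par i) v \<Longrightarrow> h = i \<or> sep h i v"
  by (auto simp: sep_def anc_par_iff)

text \<open>Both endpoints of an edge lie on the same side of every other edge, so it does not
  matter which endpoints represent two edges.\<close>

lemma sep_endpoints:
  "\<lbrakk>i \<in> E; j \<in> E; u = i \<or> u = par i; v = j \<or> v = par j; sep h u v\<rbrakk> \<Longrightarrow> btw h i j"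
  unfolding btw_def
  using sep_par[of i h j] sep_par[of i h "par j"] sep_par[of j h i] sep_commute[of h i] by auto

text \<open>The relation of a maximal nesting: \<open>(k, i) \<in> R\<close> if every tube containing the edge \<open>k\<close> contains
  the edge \<open>i\<close>, so that \<open>k\<close> is the first edge to be split off on the path between them.\<close>

definition search :: "(nat \<times> nat) set \<Rightarrow> bool" where
  "search R \<longleftrightarrow> R \<subseteq> E \<times> E \<and> irrefl R \<and> trans R \<and>
     (\<forall>k i h. (k, i) \<in> R \<longrightarrow> btw h k i \<longrightarrow> h \<noteq> k \<longrightarrow> (k, h) \<in> R) \<and>
     (\<forall>i\<in>E. \<forall>k\<in>E. \<exists>t. btw t i k \<and> (\<forall>h. btw h i k \<longrightarrow> h \<noteq> t \<longrightarrow> (t, h) \<in> R))"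

definition inversions :: "(nat \<times> nat) set \<Rightarrow> (nat \<times> nat) set" where
  "inversions R = {(i, k). i < k \<and> (k, i) \<in> R}"

lemma inversions_iff [simp]: "(i, k) \<in> inversions R \<longleftrightarrow> i < k \<and> (k, i) \<in> R"
  by (simp add: inversions_def)

section \<open>Forest structure and weak co-transitivity of a search relation\<close>

context
  fixes R assumes R: "search R"
begin

lemma search_E: "(k, i) \<in> R \<Longrightarrow> k \<in> E \<and> i \<in> E"
  using R by (auto simp: search_def)

lemma search_irrefl: "(k, k) \<notin> R"
  using R by (auto simp: search_def irrefl_def)

lemma search_trans: "(k, j) \<in> R \<Longrightarrow> (j, i) \<in> R \<Longrightarrow> (k, i) \<in> R"
  using R by (auto simp: search_def elim: transE)

lemma search_asym: "(k, i) \<in> R \<Longrightarrow> (i, k) \<notin> R"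
  using search_trans search_irrefl by blast

lemma search_btw: "(k, i) \<in> R \<Longrightarrow> btw h k i \<Longrightarrow> h \<noteq> k \<Longrightarrow> (k, h) \<in> R"
  using R by (auto simp: search_def)

lemma search_top:
  assumes "i \<in> E" "k \<in> E"
  shows "\<exists>t. btw t i k \<and> (\<forall>h. btw h i k \<longrightarrow> h \<noteq> t \<longrightarrow> (t, h) \<in> R)"
  using R assms unfolding search_def by simp

text \<open>The top of the path from \<open>a\<close> to \<open>b\<close> lies on the path from
  \<open>a\<close> to \<open>c\<close> or on that from \<open>b\<close> to \<open>c\<close>, where
  \<open>a\<close> or \<open>b\<close> is already on top; so it is \<open>a\<close> or
  \<open>b\<close>.\<close>

lemma search_forest:
  assumes "(a, c) \<in> R" "(b, c) \<in> R"
  shows "a = b \<or> (a, b) \<in> R \<or> (b, a) \<in> R"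
proof -
  have "a \<in> E" "b \<in> E" using assms search_E by auto
  then obtain t where t: "btw t a b" "\<And>h. btw h a b \<Longrightarrow> h \<noteq> t \<Longrightarrow> (t, h) \<in> R"
    using search_top by meson
  from t(1) have "btw t a c \<or> btw t b c" using btw_split btw_commute by blast
  then have "t = a \<or> t = b"
    using assms t search_btw[of a c t] search_btw[of b c t] search_asym[of a t] search_asym[of b t]
    by blast
  with t show ?thesis using btw_ends by blast
qed

lemma search_incomparable:
  assumes "i \<in> E" "k \<in> E" "i \<noteq> k" "(i, k) \<notin> R" "(k, i) \<notin> R"
  obtains h where "h \<noteq> i" "h \<noteq> k" "sep h i k" "(h, i) \<in> R" "(h, k) \<in> R"
proof -
  obtain t where t: "btw t i k" "\<And>h. btw h i k \<Longrightarrow> h \<noteq> t \<Longrightarrow> (t, h) \<in> R"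
    using search_top[OF assms(1,2)] by blast
  have "t \<noteq> i" "t \<noteq> k" using t(2)[of k] t(2)[of i] assms by auto
  with t that show ?thesis unfolding btw_def by metis
qed

text \<open>A weak form of the co-transitivity of inversion sets of permutations.\<close>

lemma search_cotrans:
  assumes ki: "(k, i) \<in> R" and "i < j" "j < k" and kj: "(k, j) \<notin> R"
  obtains h where "anc h j" "\<not> anc h i" "\<not> anc h k" "i < h" "(h, k) \<in> R" "(h, i) \<in> R"
proof -
  have E: "i \<in> E" "k \<in> E" "j \<in> E"
    using search_E[OF ki] assms by (auto simp: E_def)
  obtain h where h: "(h, k) \<in> R" "h = j \<or> sep h j k"
  proof (cases "(j, k) \<in> R")
    case False
    with E kj \<open>j < k\<close> obtain h where "sep h j k" "(h, k) \<in> R"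
      using search_incomparable[of j k] by blast
    with that show ?thesis by blast
  qed (use that in blast)
  have hi: "(h, i) \<in> R" using h(1) ki search_trans by blast
  \<comment> \<open>\<open>k\<close> is above every other edge on its path to \<open>i\<close>,
    whereas \<open>h\<close> is above \<open>k\<close>. So \<open>h\<close> is off this path and has
    \<open>i\<close> and \<open>k\<close> on the same side; if both were descendants of
    \<open>h\<close>, the interval property would put \<open>j\<close> there as well.\<close>
  have "\<not> btw h k i"
    using search_btw[OF ki, of h] search_asym[OF h(1)] h(1) search_irrefl[of k] by blast
  then have eq: "anc h i \<longleftrightarrow> anc h k" by (auto simp: btw_def sep_def)
  have nk: "\<not> anc h k"
  proof
    assume "anc h k"
    moreover then have "h \<le> i" using eq anc_le by simp
    ultimately have "anc h j" using anc_interval[of h k j] E assms by (auto simp: E_def)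
    with h(2) \<open>anc h k\<close> \<open>i < j\<close> \<open>h \<le> i\<close> show False by (auto simp: sep_def)
  qed
  with h(2) have "anc h j" by (auto simp: sep_def)
  moreover have "i < h"
    using anc_interval[of h j i] calculation eq nk E assms(2,3) by (fastforce simp: E_def not_less)
  ultimately show ?thesis using that eq nk h(1) hi by blast
qed

end

end

section \<open>Search relations and their inversions\<close>

text \<open>Removing the picked element again and again lists \<open>A\<close>. With \<sigma> the
  position in this list, the sets of elements of rank at least \<open>\<sigma> t\<close> are exactly
  the stages of the removal.\<close>

lemma exists_rank:
  assumes "finite A" "\<And>Q. Q \<noteq> {} \<Longrightarrow> Q \<subseteq> A \<Longrightarrow> pick Q \<in> Q"
  shows "\<exists>\<sigma>::'a \<Rightarrow> nat. inj_on \<sigma> A \<and> (\<forall>t\<in>A. pick {x \<in> A. \<sigma> t \<le> \<sigma> x} = t)"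
  using assms
proof (induction "card A" arbitrary: A)
  case 0
  then show ?case by simp
next
  case (Suc m)
  let ?p = "pick A"
  have "A \<noteq> {}" using Suc.hyps(2) by auto
  then have p: "?p \<in> A" using Suc.prems(2)[of A] by auto
  have "\<exists>\<sigma>::'a \<Rightarrow> nat. inj_on \<sigma> (A - {?p}) \<and>
          (\<forall>t\<in>A - {?p}. pick {x \<in> A - {?p}. \<sigma> t \<le> \<sigma> x} = t)"
    using Suc p by (intro Suc.hyps(1)) auto
  then obtain \<sigma> :: "'a \<Rightarrow> nat" where \<sigma>: "inj_on \<sigma> (A - {?p})"
      "\<And>t. t \<in> A - {?p} \<Longrightarrow> pick {x \<in> A - {?p}. \<sigma> t \<le> \<sigma> x} = t" by blast
  define \<rho> where "\<rho> x = (if x = ?p then 0 else Suc (\<sigma> x))" for x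
  have "inj_on \<rho> A" using \<sigma>(1) by (auto simp: inj_on_def \<rho>_def)
  moreover have "pick {x \<in> A. \<rho> t \<le> \<rho> x} = t" if "t \<in> A" for t
  proof (cases "t = ?p")
    case True
    then have "{x \<in> A. \<rho> t \<le> \<rho> x} = A" by (auto simp: \<rho>_def)
    with True show ?thesis by simp
  next
    case False
    then have "{x \<in> A. \<rho> t \<le> \<rho> x} = {x \<in> A - {?p}. \<sigma> t \<le> \<sigma> x}" by (auto simp: \<rho>_def)
    with False \<sigma>(2) that show ?thesis by simp
  qed
  ultimately show ?case by blast
qed

context preorder_tree
begin

text \<open>The level in the forest of \<open>R\<close>, a numerical height by which topmost and
  lowest edges with a given property are chosen as extrema.\<close>

definition depth :: "(nat \<times> nat) set \<Rightarrow> nat \<Rightarrow> nat" where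
  "depth R x = card {a. (a, x) \<in> R}"

lemma depth_less:
  assumes "search R" "(k, i) \<in> R" shows "depth R k < depth R i"
  unfolding depth_def
proof (rule psubset_card_mono)
  show "finite {a. (a, i) \<in> R}"
    by (rule finite_subset[of _ E]) (use search_E[OF assms(1)] in auto)
  show "{a. (a, k) \<in> R} \<subset> {a. (a, i) \<in> R}"
    using search_trans[OF assms(1)] search_irrefl[OF assms(1)] assms(2) by blast
qed

text \<open>The analogue of a Cartesian tree: on each path the edge of least rank is split off
  first.\<close>

definition of_rank :: "(nat \<Rightarrow> nat) \<Rightarrow> (nat \<times> nat) set" where
  "of_rank \<sigma> = {(k, i). k \<in> E \<and> i \<in> E \<and> k \<noteq> i \<and> (\<forall>h. btw h k i \<longrightarrow> h \<noteq> k \<longrightarrow> \<sigma> k < \<sigma> h)}"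

lemma of_rank_iff: "(k, i) \<in> of_rank \<sigma> \<longleftrightarrow>
    k \<in> E \<and> i \<in> E \<and> k \<noteq> i \<and> (\<forall>h. btw h k i \<longrightarrow> h \<noteq> k \<longrightarrow> \<sigma> k < \<sigma> h)"
  by (simp add: of_rank_def)

lemma search_of_rank:
  assumes inj: "inj_on \<sigma> E" shows "search (of_rank \<sigma>)"
  unfolding search_def
proof (intro conjI allI impI ballI)
  show "of_rank \<sigma> \<subseteq> E \<times> E" "irrefl (of_rank \<sigma>)" by (auto simp: of_rank_def irrefl_def)
  show "trans (of_rank \<sigma>)"
  proof (rule transI)
    fix k j i assume kj: "(k, j) \<in> of_rank \<sigma>" and ji: "(j, i) \<in> of_rank \<sigma>"
    have "\<sigma> k < \<sigma> j" "\<sigma> j < \<sigma> i" using kj ji by (auto simp: of_rank_iff)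
    moreover have "\<sigma> k < \<sigma> h" if "btw h k i" "h \<noteq> k" for h
      using btw_split[OF that(1), of j]
    proof
      assume "btw h j i"
      then show ?thesis using ji \<open>\<sigma> k < \<sigma> j\<close> by (cases "h = j") (auto simp: of_rank_iff)
    qed (use kj that(2) in \<open>auto simp: of_rank_iff\<close>)
    moreover have "k \<noteq> i" using calculation by auto
    ultimately show "(k, i) \<in> of_rank \<sigma>" using kj ji by (simp add: of_rank_iff)
  qed
  show "(k, h) \<in> of_rank \<sigma>" if ki: "(k, i) \<in> of_rank \<sigma>" and h: "btw h k i" "h \<noteq> k" for k i h
  proof -
    have "btw h' k i" if "btw h' k h" for h'
      using btw_shrink[of h i k h'] h that btw_commute by blast
    with ki h show ?thesis using btw_in_E by (auto simp: of_rank_iff)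
  qed
  show "\<exists>t. btw t i k \<and> (\<forall>h. btw h i k \<longrightarrow> h \<noteq> t \<longrightarrow> (t, h) \<in> of_rank \<sigma>)"
    if ik: "i \<in> E" "k \<in> E" for i k
  proof -
    obtain t where t: "btw t i k" "\<And>h. btw h i k \<Longrightarrow> \<sigma> t \<le> \<sigma> h"
      using ex_has_least_nat[of "\<lambda>h. btw h i k" i \<sigma>] by blast
    have less: "\<sigma> t < \<sigma> h" if "btw h i k" "h \<noteq> t" for h
      using t(2)[OF that(1)] inj_onD[OF inj, of t h] that t(1) btw_in_E[OF _ ik] le_neq_implies_less
      by blast
    have "(t, h) \<in> of_rank \<sigma>" if "btw h i k" "h \<noteq> t" for h
      using that t(1) btw_in_E[OF _ ik] less btw_shrink2[OF t(1) that(1)] by (auto simp: of_rank_iff)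
    with t(1) show ?thesis by blast
  qed
qed

text \<open>\<open>Q\<close> is the set of edges not yet split off. Splitting off \<open>r\<close>
  next puts it above its component of \<open>Q\<close>; being ready means that all inversions
  created in this way belong to \<open>C\<close>.\<close>

definition ready :: "(nat \<times> nat) set \<Rightarrow> nat set \<Rightarrow> nat \<Rightarrow> bool" where
  "ready C Q r \<longleftrightarrow> r \<in> Q \<and> (\<forall>j\<in>Q. j < r \<longrightarrow> (\<forall>h. btw h j r \<longrightarrow> h \<in> Q) \<longrightarrow> (j, r) \<in> C)"

definition greedy :: "(nat \<times> nat) set \<Rightarrow> (nat \<Rightarrow> nat) \<Rightarrow> bool" where
  "greedy C \<sigma> \<longleftrightarrow> inj_on \<sigma> E \<and> (\<forall>t\<in>E. ready C {x \<in> E. \<sigma> t \<le> \<sigma> x} t \<and>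
     (\<forall>r. ready C {x \<in> E. \<sigma> t \<le> \<sigma> x} r \<longrightarrow> r \<le> t))"

text \<open>The least remaining edge has no smaller competitor and is therefore always ready, so the
  choice never gets stuck.\<close>

lemma exists_greedy: "\<exists>\<sigma>. greedy C \<sigma>"
proof -
  let ?pick = "\<lambda>Q. Max {r. ready C Q r}"
  have fin: "finite {r. ready C Q r}" if "Q \<subseteq> E" for Q
    using finite_subset[OF that] by (auto simp: ready_def)
  have ne: "{r. ready C Q r} \<noteq> {}" if "Q \<noteq> {}" "Q \<subseteq> E" for Q
  proof -
    have "finite Q" using that(2) finite_subset[OF _ finite_E] by auto
    then have "ready C Q (Min Q)" using that by (auto simp: ready_def)
    then show ?thesis by blast
  qed
  have pick: "ready C Q (?pick Q)" if "Q \<noteq> {}" "Q \<subseteq> E" for Q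
    using Max_in[OF fin ne] that by blast
  have in_Q: "?pick Q \<in> Q" if "Q \<noteq> {}" "Q \<subseteq> E" for Q
    using pick[OF that] unfolding ready_def[of C Q "?pick Q"] by (rule conjunct1)
  obtain \<sigma> :: "nat \<Rightarrow> nat" where \<sigma>: "inj_on \<sigma> E" "\<forall>t\<in>E. ?pick {x \<in> E. \<sigma> t \<le> \<sigma> x} = t"
    using exists_rank[of E ?pick, OF finite_E in_Q] by blast
  have "ready C {x \<in> E. \<sigma> t \<le> \<sigma> x} t \<and> (\<forall>r. ready C {x \<in> E. \<sigma> t \<le> \<sigma> x} r \<longrightarrow> r \<le> t)"
    if "t \<in> E" for t
  proof -
    have Q: "{x \<in> E. \<sigma> t \<le> \<sigma> x} \<noteq> {}" "{x \<in> E. \<sigma> t \<le> \<sigma> x} \<subseteq> E" using that by auto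
    show ?thesis using pick[OF Q] Max_ge[OF fin[OF Q(2)]] bspec[OF \<sigma>(2) that] by auto
  qed
  with \<sigma>(1) show ?thesis unfolding greedy_def by blast
qed

lemma inversions_greedy:
  assumes "greedy C \<sigma>" shows "inversions (of_rank \<sigma>) \<subseteq> C"
proof clarify
  fix i k assume "(i, k) \<in> inversions (of_rank \<sigma>)"
  then have k: "i < k" "(k, i) \<in> of_rank \<sigma>" by auto
  have E: "k \<in> E" "i \<in> E" using k by (auto simp: of_rank_iff)
  have "h \<in> {x \<in> E. \<sigma> k \<le> \<sigma> x}" if "btw h i k" for h
    using btw_in_E[OF that] E k(2) that btw_commute by (fastforce simp: of_rank_iff)
  then show "(i, k) \<in> C" using assms E k(1) unfolding greedy_def ready_def by blast
qed

text \<open>Suppose that the greedy choice splits off another edge \<open>t\<close> of the path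
  before \<open>k\<close>. Among the edges of the component of \<open>t\<close> that exceed
  \<open>t\<close> and lie above it in \<open>S\<close>, let \<open>m\<close> be topmost in
  \<open>S\<close>. Then \<open>m\<close> was ready at the stage of \<open>t\<close>, although
  \<open>t\<close> was the largest ready edge.\<close>

lemma greedy_maximal:
  assumes "greedy C \<sigma>" "trans C" "search S" "inversions S \<subseteq> C"
  shows "inversions S \<subseteq> inversions (of_rank \<sigma>)"
proof clarify
  fix i k assume "(i, k) \<in> inversions S"
  then have ik: "i < k" "(k, i) \<in> S" by auto
  note S = search_E[OF assms(3)] search_irrefl[OF assms(3)] search_trans[OF assms(3)]
    search_asym[OF assms(3)] search_btw[OF assms(3)] search_forest[OF assms(3)]
  have inC: "(a, b) \<in> C" if "(b, a) \<in> S" "a < b" for a b using that assms(4) by auto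
  have E: "i \<in> E" "k \<in> E" using S(1) ik by auto
  have inj: "inj_on \<sigma> E" using assms(1) by (simp add: greedy_def)
  obtain t where t: "btw t i k" "\<And>h. btw h i k \<Longrightarrow> h \<noteq> t \<Longrightarrow> (t, h) \<in> of_rank \<sigma>"
    using search_top[OF search_of_rank[OF inj] E] by blast
  have tE: "t \<in> E" using btw_in_E t E by blast
  show "(i, k) \<in> inversions (of_rank \<sigma>)"
  proof (cases "t = k")
    case True
    then show ?thesis using t(2)[of i] ik by auto
  next
    case False
    define Q where "Q = {x \<in> E. \<sigma> t \<le> \<sigma> x}"
    have ready: "ready C Q t" and max: "\<And>r. ready C Q r \<Longrightarrow> r \<le> t"
      using assms(1) tE by (auto simp: greedy_def Q_def)
    define K where "K = {k \<in> Q. t < k \<and> (k, t) \<in> S \<and> (\<forall>h. btw h t k \<longrightarrow> h \<in> Q)}"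
    have "btw h t k \<Longrightarrow> h \<in> Q" for h
      using t(2)[of h] btw_shrink[OF t(1), of h] tE by (force simp: Q_def of_rank_iff)
    then have "k \<in> K"
      using btw_less[OF t(1) ik(1) False] S(5)[OF ik(2)] t(1) False btw_commute by (auto simp: K_def)
    then obtain m where m: "m \<in> K" "\<And>x. x \<in> K \<Longrightarrow> depth S m \<le> depth S x"
      using ex_has_least_nat[of "\<lambda>x. x \<in> K" k "depth S"] by blast
    have top: "(x, m) \<notin> S" if "x \<in> K" for x
      using m(2)[OF that] depth_less[OF assms(3), of x m] by auto
    have mQ: "m \<in> Q" "t < m" "(m, t) \<in> S" "\<And>h. btw h t m \<Longrightarrow> h \<in> Q" using m(1) by (auto simp: K_def)
    have "ready C Q m" unfolding ready_def
    proof (intro conjI ballI impI)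
      fix j assume j: "j \<in> Q" "j < m" "\<forall>h. btw h j m \<longrightarrow> h \<in> Q"
      have jt: "h \<in> Q" if "btw h j t" for h
        using btw_split[OF that, of m] j(3) mQ(4) btw_commute by blast
      consider "j < t" | "j = t" | "t < j" by linarith
      then show "(j, m) \<in> C"
      proof cases
        case 1
        then have "(j, t) \<in> C" using ready j(1) jt by (auto simp: ready_def)
        moreover have "(t, m) \<in> C" using inC mQ by blast
        ultimately show ?thesis using assms(2) by (meson transD)
      next
        case 2
        then show ?thesis using inC mQ by blast
      next
        case 3
        \<comment> \<open>Otherwise \<open>search_cotrans\<close> supplies a member of
          \<open>K\<close> above \<open>m\<close>, against the choice of \<open>m\<close>.\<close>
        have "(m, j) \<in> S"
        proof (rule ccontr)
          assume "(m, j) \<notin> S"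
          then obtain h where h: "anc h j" "\<not> anc h t" "\<not> anc h m" "t < h" "(h, m) \<in> S" "(h, t) \<in> S"
            using search_cotrans[OF assms(3) mQ(3) 3 j(2)] by blast
          have hj: "btw h j t" using h by (auto simp: btw_def sep_def)
          have "btw h' t h \<Longrightarrow> h' \<in> Q" for h'
            using btw_shrink[of h j t h'] hj jt btw_commute by blast
          then have "h \<in> K" using jt[OF hj] h by (auto simp: K_def)
          with top h(5) show False by blast
        qed
        then show ?thesis using inC j by blast
      qed
    qed (use mQ in auto)
    with max mQ(2) show ?thesis by fastforce
  qed
qed

lemma exists_interior:
  assumes "trans C"
  obtains R where "search R" "inversions R \<subseteq> C"
    "\<And>S. search S \<Longrightarrow> inversions S \<subseteq> C \<Longrightarrow> inversions S \<subseteq> inversions R"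
proof -
  obtain \<sigma> where \<sigma>: "greedy C \<sigma>" using exists_greedy by blast
  show ?thesis
    using that[of "of_rank \<sigma>"] \<sigma> search_of_rank inversions_greedy[OF \<sigma>] greedy_maximal[OF \<sigma> assms]
    by (auto simp: greedy_def)
qed

lemma trans_inversions: "search R \<Longrightarrow> trans (inversions R)"
  by (rule transI) (auto intro: search_trans)

section \<open>Exchanging an edge with its parent in the search forest\<close>

definition tree_parent :: "(nat \<times> nat) set \<Rightarrow> nat \<Rightarrow> nat \<Rightarrow> bool" where
  "tree_parent R e f \<longleftrightarrow> (e, f) \<in> R \<and> (\<forall>m. (e, m) \<in> R \<longrightarrow> (m, f) \<notin> R)"

text \<open>The rank places \<open>f\<close> at the level of \<open>e\<close> and \<open>e\<close> strictly between the levels of \<open>e\<close> and of its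
  children; the summand \<open>x\<close> breaks ties.\<close>

definition flip :: "(nat \<times> nat) set \<Rightarrow> nat \<Rightarrow> nat \<Rightarrow> (nat \<times> nat) set" where
  "flip R e f = of_rank (\<lambda>x. (if x = f then 2 * depth R e
                              else if x = e then 2 * depth R e + 1 else 2 * depth R x) * Suc n + x)"

lemma btw_antisym: "btw a b c \<Longrightarrow> btw b a c \<Longrightarrow> a = b"
  unfolding btw_def sep_def using anc_linear[of a c b] anc_trans[of a c b] anc_trans[of b c a]
    anc_antisym[of a b] by blast

lemma lex_less: "a \<le> n \<Longrightarrow> l < l' \<Longrightarrow> l * Suc n + a < l' * Suc n + b"
proof -
  assume "a \<le> n" "l < l'"
  then have "Suc l * Suc n \<le> l' * Suc n" by (intro mult_le_mono1) simp
  with \<open>a \<le> n\<close> show ?thesis by simp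
qed

lemma lex_inj: "a \<le> n \<Longrightarrow> b \<le> n \<Longrightarrow> l * Suc n + a = l' * Suc n + b \<Longrightarrow> a = b"
  using lex_less[of a l l' b] lex_less[of b l' l a] by (cases l l' rule: linorder_cases) auto

lemma search_flip: "search (flip R e f)"
  unfolding flip_def
  by (rule search_of_rank) (use lex_inj in \<open>force simp: inj_on_def E_def\<close>)

text \<open>This is the rotation of a binary search tree: \<open>f\<close> takes the place of
  \<open>e\<close> and gains the part of the component beyond \<open>e\<close>, while
  \<open>e\<close> loses the part beyond \<open>f\<close>.\<close>

lemma flip_iff:
  assumes R: "search R" and p: "tree_parent R e f"
  shows "(k, i) \<in> flip R e f \<longleftrightarrow>
    (k, i) \<in> R \<and> \<not> (k = e \<and> btw f e i) \<or> k = f \<and> i \<noteq> f \<and> btw e f i \<and> (i = e \<or> (e, i) \<in> R)"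
proof -
  define lev where "lev x = (if x = f then 2 * depth R e
                             else if x = e then 2 * depth R e + 1 else 2 * depth R x)" for x
  note S = search_E[OF R] search_irrefl[OF R] search_trans[OF R]
    search_asym[OF R] search_btw[OF R] search_forest[OF R]
  have ef: "(e, f) \<in> R" "\<And>m. (e, m) \<in> R \<Longrightarrow> (m, f) \<notin> R" using p by (auto simp: tree_parent_def)
  have "e \<noteq> f" using ef S(2) by auto
  have E: "e \<in> E" "f \<in> E" using S(1) ef by auto
  have flipI: "(k, i) \<in> flip R e f"
    if "k \<in> E" "i \<in> E" "k \<noteq> i" "\<And>h. btw h k i \<Longrightarrow> h \<noteq> k \<Longrightarrow> lev k < lev h" for k i
    unfolding flip_def lev_def[symmetric] of_rank_iff
    using that lex_less[of k] by (auto simp: E_def)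
  note S' = search_asym[OF search_flip] search_btw[OF search_flip]
  have old: "(k, i) \<in> flip R e f" if ki: "(k, i) \<in> R" and n: "\<not> (k = e \<and> btw f e i)" for k i
  proof (rule flipI)
    show "k \<in> E" "i \<in> E" "k \<noteq> i" using S(1,2) ki by auto
    fix h assume h: "btw h k i" "h \<noteq> k"
    then have kh: "(k, h) \<in> R" using S(5) ki by blast
    have d: "depth R k < depth R h" "depth R e < depth R f"
      using depth_less[OF R] kh ef by auto
    have "h \<noteq> f" if "k = e" using n h that by blast
    moreover have "depth R k < depth R e" if "h = f" "k \<noteq> e"
      using S(6)[of k f e] kh ef that depth_less[OF R] by blast
    ultimately show "lev k < lev h" using d \<open>e \<noteq> f\<close> by (auto simp: lev_def h(2)[symmetric])
  qed
  have new: "(f, i) \<in> flip R e f" if i: "i \<noteq> f" "btw e f i" "i = e \<or> (e, i) \<in> R" for i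
  proof (rule flipI)
    show "f \<in> E" "i \<in> E" "f \<noteq> i" using E i S(1) by auto
    fix h assume h: "btw h f i" "h \<noteq> f"
    have "h = e \<or> (e, h) \<in> R"
      using btw_split[OF h(1), of e] S(5)[OF ef(1), of h] S(5)[of e i h] i(3) btw_commute[of h e f]
      by (auto simp: btw_def sep_def)
    then show "lev f < lev h" using h(2) depth_less[OF R] by (force simp: lev_def)
  qed
  show ?thesis
  proof
    assume ki: "(k, i) \<in> flip R e f"
    show "(k, i) \<in> R \<and> \<not> (k = e \<and> btw f e i) \<or> k = f \<and> i \<noteq> f \<and> btw e f i \<and> (i = e \<or> (e, i) \<in> R)"
    proof (cases "k = e \<and> btw f e i")
      case True
      then have "(e, f) \<in> flip R e f" using ki S'(2) \<open>e \<noteq> f\<close> by blast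
      moreover have "(f, e) \<in> flip R e f" using new \<open>e \<noteq> f\<close> by blast
      ultimately show ?thesis using S'(1) by blast
    next
      case notef: False
      show ?thesis
      proof (cases "(k, i) \<in> R")
        case False
        have kiE: "k \<in> E" "i \<in> E" "k \<noteq> i" using ki by (auto simp: flip_def of_rank_iff)
        obtain t where t: "btw t k i" "\<And>h. btw h k i \<Longrightarrow> h \<noteq> t \<Longrightarrow> (t, h) \<in> R"
          using search_top[OF R kiE(1,2)] by blast
        have "t \<noteq> k" using t(2)[of i] kiE(3) False by auto
        then have tk: "(t, k) \<in> R" using t(2) by blast
        \<comment> \<open>All pairs of \<open>R\<close> survive except those of \<open>e\<close>
          with an edge at or beyond \<open>f\<close>. Hence the top \<open>t\<close> of the path in
          \<open>R\<close> can only be \<open>e\<close>.\<close>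
        have "(t, k) \<notin> flip R e f" using S'(1) S'(2)[OF ki t(1) \<open>t \<noteq> k\<close>] by blast
        then have t_eq: "t = e" and fk: "btw f e k" using old tk by blast+
        \<comment> \<open>Any other \<open>k\<close> lies beyond \<open>f\<close> as seen from
          \<open>e\<close>, and \<open>f\<close> and \<open>k\<close> are incomparable in
          \<open>R\<close>. The edge of their path above both would then lie strictly between
          \<open>e\<close> and \<open>f\<close> in the forest.\<close>
        have "k = f"
        proof (rule ccontr)
          assume "k \<noteq> f"
          have "btw f k i"
            using btw_shrink[of e i k f] t(1) fk t_eq btw_commute by blast
          then have kf: "(k, f) \<in> flip R e f" using S'(2) ki \<open>k \<noteq> f\<close> by blast
          then have "(f, k) \<notin> R" using old[of f k] S'(1) \<open>e \<noteq> f\<close> by blast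
          moreover have "(k, f) \<notin> R" using ef(2) tk t_eq by blast
          ultimately obtain h where h: "h \<noteq> f" "h \<noteq> k" "sep h f k" "(h, f) \<in> R" "(h, k) \<in> R"
            using search_incomparable[OF R, of f k] E kiE \<open>k \<noteq> f\<close> by metis
          have "btw h f k" using h by (simp add: btw_def)
          then have "btw h e k" using btw_shrink[OF fk] by blast
          then have "h = e \<or> (e, h) \<in> R" using S(5) tk t_eq by blast
          moreover have "h \<noteq> e"
            using btw_antisym[OF _ fk] \<open>btw h f k\<close> \<open>e \<noteq> f\<close> by blast
          ultimately show False using ef(2) h(4) by blast
        qed
        then show ?thesis using t t_eq kiE by auto
      qed (use notef in blast)
    qed
  next
    assume "(k, i) \<in> R \<and> \<not> (k = e \<and> btw f e i) \<or> k = f \<and> i \<noteq> f \<and> btw e f i \<and> (i = e \<or> (e, i) \<in> R)"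
    then show "(k, i) \<in> flip R e f" using old new by blast
  qed
qed

text \<open>The pairs gained by \<open>f\<close> run across \<open>e\<close>, and an edge
  \<open>i < f\<close> beyond \<open>e\<close> would force \<open>e < f\<close>. So there are only
  losses.\<close>

lemma inversions_flip:
  assumes "search R" "tree_parent R e f" "f < e"
  shows "inversions (flip R e f) = inversions R - {(x, y). y = e \<and> btw f e x}"
proof -
  have "\<not> btw e f i" if "i < f" for i
    using btw_less[of e i f] that assms(3) btw_commute by auto
  then show ?thesis using assms(3) by (fastforce simp: flip_iff[OF assms(1,2)])
qed

text \<open>Choose \<open>t\<close> of least depth in \<open>R'\<close> among the edges whose sets
  of upper edges differ, and \<open>e\<close> lowest in \<open>R\<close> among the edges that are
  above \<open>t\<close> in \<open>R\<close> only. Everything over \<open>t\<close> in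
  \<open>R'\<close> has the same upper edges in both relations; this makes \<open>e\<close> the
  parent of \<open>t\<close> in \<open>R\<close> and puts \<open>t\<close> above \<open>e\<close> in
  \<open>R'\<close>. The inclusion of inversions then orients the pair.\<close>

lemma first_difference:
  assumes R: "search R" and R': "search R'" and sub: "inversions R' \<subseteq> inversions R" and "R \<noteq> R'"
  obtains e f where "tree_parent R e f" "f < e" "(e, f) \<notin> R'"
proof -
  let ?up = "\<lambda>R t. {a. (a, t) \<in> R}"
  obtain t\<^sub>0 where "?up R t\<^sub>0 \<noteq> ?up R' t\<^sub>0" using \<open>R \<noteq> R'\<close> by auto
  then obtain t where t: "?up R t \<noteq> ?up R' t"
    and least: "\<And>x. ?up R x \<noteq> ?up R' x \<Longrightarrow> depth R' t \<le> depth R' x"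
    using ex_has_least_nat[of "\<lambda>t. ?up R t \<noteq> ?up R' t" t\<^sub>0 "depth R'"] by blast
  have same: "(a, b) \<in> R \<longleftrightarrow> (a, b) \<in> R'" if "(b, t) \<in> R'" for a b
    using least[of b] depth_less[OF R' that] by fastforce
  have sub_up: "(b, t) \<in> R" if b: "(b, t) \<in> R'" for b
  proof -
    have "t \<in> E" "b \<in> E" "b \<noteq> t" using search_E[OF R' b] search_irrefl[OF R'] b by auto
    then obtain s where s: "btw s t b" "\<And>h. btw h t b \<Longrightarrow> h \<noteq> s \<Longrightarrow> (s, h) \<in> R"
      using search_top[OF R] by meson
    have "s = b"
    proof (rule ccontr)
      assume "s \<noteq> b"
      then have "(s, b) \<in> R'" using s same[OF b] by auto
      moreover have "(b, s) \<in> R'" using search_btw[OF R' b] s(1) btw_commute \<open>s \<noteq> b\<close> by blast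
      ultimately show False using search_asym[OF R'] by blast
    qed
    then show ?thesis using s(2) \<open>b \<noteq> t\<close> by blast
  qed
  with t have "\<exists>e. (e, t) \<in> R \<and> (e, t) \<notin> R'" by blast
  then obtain e where e: "(e, t) \<in> R" "(e, t) \<notin> R'"
    and deep: "\<And>x. (x, t) \<in> R \<Longrightarrow> (x, t) \<notin> R' \<Longrightarrow> depth R x \<le> depth R e"
  proof -
    let ?A = "{x. (x, t) \<in> R \<and> (x, t) \<notin> R'}"
    assume that: "\<And>e. (e, t) \<in> R \<Longrightarrow> (e, t) \<notin> R' \<Longrightarrow>
      (\<And>x. (x, t) \<in> R \<Longrightarrow> (x, t) \<notin> R' \<Longrightarrow> depth R x \<le> depth R e) \<Longrightarrow> thesis"
    assume "\<exists>e. (e, t) \<in> R \<and> (e, t) \<notin> R'"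
    moreover have "finite ?A" by (rule finite_subset[of _ E]) (use search_E[OF R] in auto)
    ultimately have fin: "finite (depth R ` ?A)" "depth R ` ?A \<noteq> {}" by auto
    from Max_in[OF this] obtain e where "e \<in> ?A" "depth R e = Max (depth R ` ?A)" by auto
    with Max_ge[OF fin(1)] show thesis by (intro that[of e]) auto
  qed
  have "tree_parent R e t" unfolding tree_parent_def
  proof (intro conjI allI impI notI)
    fix m assume m: "(e, m) \<in> R" "(m, t) \<in> R"
    then have "(m, t) \<in> R'" using deep[of m] depth_less[OF R m(1)] by auto
    then show False using same m(1) e(2) search_trans[OF R'] by blast
  qed (rule e(1))
  moreover have te: "(t, e) \<in> R'"
  proof -
    have E: "t \<in> E" "e \<in> E" "t \<noteq> e" using search_E[OF R e(1)] search_irrefl[OF R] e(1) by auto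
    then obtain s where s: "btw s t e" "\<And>h. btw h t e \<Longrightarrow> h \<noteq> s \<Longrightarrow> (s, h) \<in> R'"
      using search_top[OF R'] by meson
    have "s = t"
    proof (rule ccontr)
      assume "s \<noteq> t"
      then have st: "(s, t) \<in> R'" using s(2) by blast
      then have "s \<noteq> e" using e(2) by auto
      then have "(e, s) \<in> R" using search_btw[OF R e(1)] s(1) btw_commute by blast
      then have "(e, s) \<in> R'" using same[OF st] by blast
      then show False using st e(2) search_trans[OF R'] by blast
    qed
    then show ?thesis using s(2) E(3) by auto
  qed
  moreover have "t < e"
  proof -
    have "t \<noteq> e" using e(1) search_irrefl[OF R] by auto
    moreover have "(e, t) \<notin> inversions R'"
      using subsetD[OF sub, of "(e, t)"] search_asym[OF R e(1)] by auto
    then have "\<not> e < t" using te by auto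
    ultimately show ?thesis by simp
  qed
  ultimately show ?thesis using that search_asym[OF R'] by blast
qed

lemma inversions_inject:
  "search R \<Longrightarrow> search R' \<Longrightarrow> inversions R = inversions R' \<Longrightarrow> R = R'"
proof (rule ccontr)
  assume R: "search R" "search R'" "inversions R = inversions R'" "R \<noteq> R'"
  then obtain e f where "tree_parent R e f" "f < e" "(e, f) \<notin> R'"
    using first_difference[of R R'] by blast
  then have "(f, e) \<in> inversions R" "(f, e) \<notin> inversions R'" by (auto simp: tree_parent_def)
  then show False using R(3) by simp
qed

text \<open>The exchange loses only pairs of \<open>e\<close> with edges at or beyond
  \<open>f\<close>; since \<open>R'\<close> lacks \<open>(e, f)\<close>, path closure shows that it
  lacks all of these.\<close>

lemma flip_towards:
  assumes "search R" "search R'" "inversions R' \<subseteq> inversions R" "R \<noteq> R'"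
  obtains e f where "tree_parent R e f" "f < e" "inversions R' \<subseteq> inversions (flip R e f)"
proof -
  obtain e f where ef: "tree_parent R e f" "f < e" "(e, f) \<notin> R'"
    using first_difference[OF assms] .
  have "e \<noteq> f" using ef by simp
  then have "\<not> btw f e x" if "(e, x) \<in> R'" for x
    using search_btw[OF assms(2) that, of f] ef(3) by auto
  then have "inversions R' \<subseteq> inversions (flip R e f)"
    using assms(3) inversions_flip[OF assms(1) ef(1,2)] by auto
  with ef that show ?thesis by blast
qed

end

section \<open>Maximal nestings as search relations\<close>

locale plane_preorder_tree = preorder_tree +
  fixes T :: plane_tree
  assumes vertices_eq: "vertices T = {..n}"
    and child_pairs_eq: "child_pairs T = {(par k, k) | k. k \<in> E}"
begin

section \<open>Tubes and their edges\<close>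

definition edges :: "nat set \<Rightarrow> nat set" where
  "edges X = {k \<in> E. k \<in> X \<and> par k \<in> X}"

lemma edges_iff: "k \<in> edges X \<longleftrightarrow> k \<in> E \<and> k \<in> X \<and> par k \<in> X"
  by (simp add: edges_def)

lemma edges_mono: "X \<subseteq> Y \<Longrightarrow> edges X \<subseteq> edges Y"
  by (auto simp: edges_def)

lemma sep_in_E: "sep h u v \<Longrightarrow> u \<le> n \<Longrightarrow> v \<le> n \<Longrightarrow> h \<in> E"
proof -
  assume h: "sep h u v" "u \<le> n" "v \<le> n"
  then have "h \<noteq> 0" using anc_zero by (metis sep_def)
  moreover have "h \<le> n" using h anc_le[of h u] anc_le[of h v] by (auto simp: sep_def)
  ultimately show ?thesis by (simp add: E_def)
qed

text \<open>Connectedness is expressed by cuts instead of walks: an edge that separates two vertices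
  of a connected set must be used inside the set.\<close>

lemma tube_iff:
  "tube T X \<longleftrightarrow> X \<noteq> {} \<and> X \<subseteq> {..n} \<and> (\<forall>u\<in>X. \<forall>v\<in>X. \<forall>h. sep h u v \<longrightarrow> h \<in> edges X)"
proof -
  define A where "A = Restr (child_pairs T \<union> (child_pairs T)\<inverse>) X"
  have A: "(x, y) \<in> A \<longleftrightarrow> x \<in> X \<and> y \<in> X \<and> (x \<in> E \<and> y = par x \<or> y \<in> E \<and> x = par y)" for x y
    by (auto simp: A_def child_pairs_eq)
  have "(\<forall>x\<in>X. \<forall>y\<in>X. (x, y) \<in> A\<^sup>*) \<longleftrightarrow> (\<forall>u\<in>X. \<forall>v\<in>X. \<forall>h. sep h u v \<longrightarrow> h \<in> edges X)"
    if X: "X \<noteq> {}" "X \<subseteq> {..n}"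
  proof (intro iffI ballI allI impI)
    fix u v h assume "\<forall>x\<in>X. \<forall>y\<in>X. (x, y) \<in> A\<^sup>*" "u \<in> X" "v \<in> X" "sep h u v"
    then have uv: "(u, v) \<in> A\<^sup>*" by blast
    show "h \<in> edges X"
    proof (rule ccontr)
      assume h: "h \<notin> edges X"
      \<comment> \<open>A walk that does not use the edge \<open>h\<close> stays on one side of
        it.\<close>
      from uv have "anc h u \<longleftrightarrow> anc h v"
      proof (induction rule: rtrancl_induct)
        case (step y z)
        with h show ?case by (auto simp: A edges_iff anc_par_iff)
      qed simp
      then show False using \<open>sep h u v\<close> by (simp add: sep_def)
    qed
  next
    fix x y assume sep: "\<forall>u\<in>X. \<forall>v\<in>X. \<forall>h. sep h u v \<longrightarrow> h \<in> edges X" and xy: "x \<in> X" "y \<in> X"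
    have fin: "finite X" using X(2) finite_subset by blast
    let ?m = "Min X"
    have m: "?m \<in> X" using fin X(1) by simp
    \<comment> \<open>The least vertex is the root of the tube: every other vertex is separated from
      it by its own parent edge, which therefore belongs to \<open>X\<close>.\<close>
    have to_root: "(z, ?m) \<in> A\<^sup>*" if "z \<in> X" for z
      using that
    proof (induction z rule: less_induct)
      case (less z)
      show ?case
      proof (cases "z = ?m")
        case False
        then have "?m < z" using less.prems fin by (simp add: order.not_eq_order_implies_strict)
        then have "sep z z ?m" using anc_le[of z ?m] by (auto simp: sep_def)
        then have "z \<in> edges X" using sep less.prems m by blast
        then have "(z, par z) \<in> A" "par z \<in> X" "par z < z" by (auto simp: A edges_iff par_less')
        with less.IH show ?thesis by (meson converse_rtrancl_into_rtrancl)
      qed simp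
    qed
    have "sym A" by (auto simp: sym_def A)
    then have "(?m, y) \<in> A\<^sup>*" using to_root[OF xy(2)] sym_rtrancl by (metis symD)
    with to_root[OF xy(1)] show "(x, y) \<in> A\<^sup>*" by (rule rtrancl_trans)
  qed
  then show ?thesis unfolding tube_def vertices_eq A_def[symmetric] by blast
qed

lemma tube_sep: "tube T X \<Longrightarrow> u \<in> X \<Longrightarrow> v \<in> X \<Longrightarrow> sep h u v \<Longrightarrow> h \<in> edges X"
  by (simp add: tube_iff)

lemma tube_finite: "tube T X \<Longrightarrow> finite X"
  by (meson finite_atMost finite_subset tube_iff)

lemma tube_btw: "tube T X \<Longrightarrow> i \<in> edges X \<Longrightarrow> k \<in> edges X \<Longrightarrow> btw h i k \<Longrightarrow> h \<in> edges X"
  using tube_sep[of X i k h] by (auto simp: btw_def edges_iff)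

text \<open>The path from \<open>u\<close> to \<open>w\<close> has to cross the boundary of
  \<open>Z\<close>. The induction replaces the end with the larger label by its parent.\<close>

lemma exit_edge:
  assumes "u \<in> Z" "w \<notin> Z" "u \<le> n" "w \<le> n"
  shows "\<exists>h. sep h u w \<and> (h \<in> Z) \<noteq> (par h \<in> Z)"
  using assms
proof (induction "u + w" arbitrary: u w rule: less_induct)
  case less
  have "u \<noteq> w" using less.prems by auto
  then consider "w < u" | "u < w" by linarith
  then show ?case
  proof cases
    case 1
    then have u: "u \<in> E" "par u < u" using less.prems by (auto simp: E_def intro: par_less)
    have nuw: "\<not> anc u w" "\<not> anc u (par u)" using 1 u anc_le[of u w] anc_le[of u "par u"] by auto
    show ?thesis
    proof (cases "par u \<in> Z")
      case True
      then obtain h where h: "sep h (par u) w" "(h \<in> Z) \<noteq> (par h \<in> Z)"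
        using less.hyps[of "par u" w] less.prems u by auto
      then have "sep h u w" using u nuw sep_par[of u h w] by (auto simp: sep_def)
      with h show ?thesis by blast
    next
      case False
      with less.prems nuw show ?thesis by (auto simp: sep_def)
    qed
  next
    case 2
    then have w: "w \<in> E" "par w < w" using less.prems by (auto simp: E_def intro: par_less)
    have nwu: "\<not> anc w u" "\<not> anc w (par w)" using 2 w anc_le[of w u] anc_le[of w "par w"] by auto
    show ?thesis
    proof (cases "par w \<in> Z")
      case True
      with less.prems nwu show ?thesis by (auto simp: sep_def)
    next
      case False
      then obtain h where h: "sep h u (par w)" "(h \<in> Z) \<noteq> (par h \<in> Z)"
        using less.hyps[of u "par w"] less.prems w by auto
      then have "sep h u w" using w nwu sep_par[of w h u] by (auto simp: sep_def)
      with h show ?thesis by blast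
    qed
  qed
qed

definition verts :: "nat set \<Rightarrow> nat set" where
  "verts A = (\<Union>k\<in>A. {k, par k})"

lemma verts_mono: "A \<subseteq> B \<Longrightarrow> verts A \<subseteq> verts B"
  by (auto simp: verts_def)

definition below :: "(nat \<times> nat) set \<Rightarrow> nat \<Rightarrow> nat set" where
  "below R k = {i. i = k \<or> (k, i) \<in> R}"

lemma below_iff: "i \<in> below R k \<longleftrightarrow> i = k \<or> (k, i) \<in> R"
  by (simp add: below_def)

text \<open>The tube of \<open>k\<close> is the component in which \<open>k\<close> is the first
  edge to be split off.\<close>

definition nest :: "(nat \<times> nat) set \<Rightarrow> nat set set" where
  "nest R = (\<lambda>k. verts (below R k)) ` E"

definition search_of :: "nat set set \<Rightarrow> (nat \<times> nat) set" where
  "search_of N = {(k, i). k \<in> E \<and> i \<in> E \<and> k \<noteq> i \<and> (\<forall>X\<in>N. k \<in> edges X \<longrightarrow> i \<in> edges X)}"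

lemma search_of_iff: "(k, i) \<in> search_of N \<longleftrightarrow>
    k \<in> E \<and> i \<in> E \<and> k \<noteq> i \<and> (\<forall>X\<in>N. k \<in> edges X \<longrightarrow> i \<in> edges X)"
  by (simp add: search_of_def)

lemma nestingD:
  assumes "nesting T N"
  shows "{..n} \<in> N" "X \<in> N \<Longrightarrow> tube T X" "X \<in> N \<Longrightarrow> 2 \<le> card X"
    "X \<in> N \<Longrightarrow> Y \<in> N \<Longrightarrow> v \<in> X \<Longrightarrow> v \<in> Y \<Longrightarrow> X \<subseteq> Y \<or> Y \<subseteq> X"
  using assms unfolding nesting_def vertices_eq by blast+

lemma edges_atMost: "edges {..n} = E"
  using par_less' by (fastforce simp: edges_def E_def)

lemma inner_tube:
  assumes N: "nesting T N" and "k \<in> E"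
  obtains X where "X \<in> N" "k \<in> edges X" "\<And>Y. Y \<in> N \<Longrightarrow> k \<in> edges Y \<Longrightarrow> X \<subseteq> Y"
proof -
  obtain X where X: "X \<in> N" "k \<in> edges X" "\<And>Y. Y \<in> N \<Longrightarrow> k \<in> edges Y \<Longrightarrow> card X \<le> card Y"
    using ex_has_least_nat[of "\<lambda>X. X \<in> N \<and> k \<in> edges X" "{..n}" card] nestingD(1)[OF N] \<open>k \<in> E\<close>
      edges_atMost by blast
  have "X \<subseteq> Y" if Y: "Y \<in> N" "k \<in> edges Y" for Y
  proof (rule ccontr)
    assume "\<not> X \<subseteq> Y"
    then have "Y \<subset> X" using nestingD(4)[OF N X(1) Y(1), of k] X(2) Y(2) by (auto simp: edges_iff)
    then have "card Y < card X" using tube_finite nestingD(2)[OF N X(1)] psubset_card_mono by blast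
    with X(3)[OF Y] show False by simp
  qed
  with X that show ?thesis by blast
qed

lemma nesting_insert_subset:
  assumes M: "maximal_nesting T N" and "tube T Y" "2 \<le> card Y"
    and "\<And>Z. Z \<in> N \<Longrightarrow> Y \<subseteq> Z \<or> Z \<subseteq> Y \<or> Y \<inter> Z = {}"
  shows "Y \<in> N"
proof -
  have "nesting T (insert Y N)"
    using assms unfolding maximal_nesting_def nesting_def by blast
  then show ?thesis using M unfolding maximal_nesting_def by blast
qed

text \<open>In a maximal nesting no two edges lie in exactly the same tubes: otherwise, cutting
  their innermost tube at \<open>i\<close> and keeping the side of \<open>k\<close> would give a
  further compatible tube \<open>Y\<close>, which contains the edge \<open>k\<close> but not
  \<open>i\<close>.\<close>

lemma search_of_asym:
  assumes M: "maximal_nesting T N" and ki: "(k, i) \<in> search_of N" and ik: "(i, k) \<in> search_of N"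
  shows False
proof -
  have N: "nesting T N" using M by (simp add: maximal_nesting_def)
  have E: "k \<in> E" "i \<in> E" "k \<noteq> i" using ki by (auto simp: search_of_iff)
  obtain X where X: "X \<in> N" "i \<in> edges X" "\<And>Z. Z \<in> N \<Longrightarrow> i \<in> edges Z \<Longrightarrow> X \<subseteq> Z"
    using inner_tube[OF N E(2)] by metis
  have kX: "k \<in> edges X" using ik X by (auto simp: search_of_iff)
  have tX: "tube T X" using nestingD(2)[OF N X(1)] .
  define Y where "Y = {v \<in> X. anc i v \<longleftrightarrow> anc i k}"
  have kY: "k \<in> edges Y" using kX E by (auto simp: Y_def edges_iff anc_par_iff)
  have "Y \<in> N"
  proof (rule nesting_insert_subset[OF M])
    show "tube T Y" unfolding tube_iff
    proof (intro conjI ballI allI impI)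
      show "Y \<noteq> {}" "Y \<subseteq> {..n}" using kY tX by (auto simp: Y_def edges_iff tube_iff)
      fix u v h assume uv: "u \<in> Y" "v \<in> Y" "sep h u v"
      then have hX: "h \<in> edges X" using tube_sep[OF tX] by (auto simp: Y_def)
      have "h \<noteq> i" using uv by (auto simp: Y_def sep_def)
      have same: "anc i u \<longleftrightarrow> anc i k" "anc i v \<longleftrightarrow> anc i k" using uv by (auto simp: Y_def)
      have "anc i h \<longleftrightarrow> anc i k"
        using same uv(3) anc_linear[of i u h] anc_linear[of i v h] anc_trans unfolding sep_def by blast
      then show "h \<in> edges Y" using hX \<open>h \<noteq> i\<close> by (auto simp: Y_def edges_iff anc_par_iff)
    qed
    have "{k, par k} \<subseteq> Y" "finite Y" "par k \<noteq> k"
      using kY tube_finite[OF tX] par_less'[OF E(1)] by (auto simp: edges_iff Y_def)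
    then show "2 \<le> card Y" using card_mono[of Y "{k, par k}"] by auto
    fix Z assume Z: "Z \<in> N"
    show "Y \<subseteq> Z \<or> Z \<subseteq> Y \<or> Y \<inter> Z = {}"
    proof (cases "X \<inter> Z = {} \<or> X \<subseteq> Z")
      case False
      then have "Z \<subseteq> X" using nestingD(4)[OF N X(1) Z] by blast
      \<comment> \<open>A member of \<open>N\<close> properly inside the innermost tube of
        \<open>i\<close> misses this edge and so lies on one side of the cut.\<close>
      have "i \<notin> edges Z" using X(3)[OF Z] False by blast
      then have "anc i u \<longleftrightarrow> anc i v" if "u \<in> Z" "v \<in> Z" for u v
        using tube_sep[OF nestingD(2)[OF N Z] that] by (auto simp: sep_def)
      with \<open>Z \<subseteq> X\<close> show ?thesis unfolding Y_def by blast
    qed (auto simp: Y_def)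
  qed
  then have "i \<in> edges Y" using ki kY by (auto simp: search_of_iff)
  then show False using E by (auto simp: Y_def edges_iff anc_par_iff)
qed

lemma search_search_of:
  assumes M: "maximal_nesting T N" shows "search (search_of N)"
  unfolding search_def
proof (intro conjI allI impI ballI)
  have N: "nesting T N" using M by (simp add: maximal_nesting_def)
  show "search_of N \<subseteq> E \<times> E" "irrefl (search_of N)" by (auto simp: search_of_def irrefl_def)
  show "trans (search_of N)"
  proof (rule transI)
    fix k j i assume *: "(k, j) \<in> search_of N" "(j, i) \<in> search_of N"
    then have "k \<noteq> i" using search_of_asym[OF M, of k j] by blast
    with * show "(k, i) \<in> search_of N" by (auto simp: search_of_iff)
  qed
  show "(k, h) \<in> search_of N" if "(k, i) \<in> search_of N" "btw h k i" "h \<noteq> k" for k i h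
    using that tube_btw[OF nestingD(2)[OF N], of _ k i h] btw_in_E[of h k i] unfolding search_of_iff by blast
  show "\<exists>t. btw t i k \<and> (\<forall>h. btw h i k \<longrightarrow> h \<noteq> t \<longrightarrow> (t, h) \<in> search_of N)"
    if ik: "i \<in> E" "k \<in> E" for i k
  proof (cases "\<forall>Z\<in>N. i \<in> edges Z \<longrightarrow> k \<in> edges Z")
    case True
    then have "(i, h) \<in> search_of N" if "btw h i k" "h \<noteq> i" for h
      using that btw_in_E[OF that(1) ik] ik tube_btw[OF nestingD(2)[OF N], of _ i k h]
      by (auto simp: search_of_iff)
    then show ?thesis by blast
  next
    case False
    then obtain Z\<^sub>0 where "Z\<^sub>0 \<in> N \<and> i \<in> edges Z\<^sub>0 \<and> k \<notin> edges Z\<^sub>0" by blast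
    moreover have "card Z < Suc (card {..n})" if "Z \<in> N" for Z
      using card_mono[of "{..n}" Z] nestingD(2)[OF N that] by (simp add: tube_iff)
    \<comment> \<open>Take the largest tube that contains \<open>i\<close> but not \<open>k\<close>.
      The edge \<open>h\<close> by which the path leaves it is the top: a tube containing
      \<open>h\<close> is strictly larger than \<open>Z\<close> and contains \<open>i\<close>, so it
      contains \<open>k\<close> and the whole path.\<close>
    ultimately obtain Z where Z: "Z \<in> N" "i \<in> edges Z" "k \<notin> edges Z"
      and max: "\<And>Z'. Z' \<in> N \<Longrightarrow> i \<in> edges Z' \<Longrightarrow> k \<notin> edges Z' \<Longrightarrow> card Z' \<le> card Z"
      using ex_has_greatest_nat[of "\<lambda>Z. Z \<in> N \<and> i \<in> edges Z \<and> k \<notin> edges Z" Z\<^sub>0 card] by blast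
    obtain w where w: "w = k \<or> w = par k" "w \<notin> Z" using Z(3) ik by (auto simp: edges_iff)
    have "w \<le> n" "i \<le> n" using w(1) ik par_less'[of k] by (auto simp: E_def)
    then obtain h where h: "sep h i w" "(h \<in> Z) \<noteq> (par h \<in> Z)"
      using exit_edge[of i Z w] Z w by (auto simp: edges_iff)
    have hb: "btw h i k" using sep_endpoints[OF ik _ w(1) h(1)] by simp
    have hE: "h \<in> E" using btw_in_E[OF hb ik] .
    have "(h, j) \<in> search_of N" if j: "btw j i k" "j \<noteq> h" for j
      unfolding search_of_iff
    proof (intro conjI ballI impI)
      fix Z' assume Z': "Z' \<in> N" "h \<in> edges Z'"
      then have "Z \<subset> Z'" using nestingD(4)[OF N Z(1) Z'(1)] h(2) by (auto simp: edges_iff)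
      then have "i \<in> edges Z'" "card Z < card Z'"
        using Z(2) edges_mono[of Z Z'] tube_finite[OF nestingD(2)[OF N Z'(1)]] psubset_card_mono by auto
      then have "k \<in> edges Z'" using max[OF Z'(1)] by fastforce
      then show "j \<in> edges Z'"
        using tube_btw[OF nestingD(2)[OF N Z'(1)] \<open>i \<in> edges Z'\<close>] j(1) by blast
    qed (use hE btw_in_E[OF j(1) ik] j(2) in auto)
    with hb show ?thesis by blast
  qed
qed

section \<open>From search relations back to maximal nestings\<close>

context
  fixes R assumes R: "search R"
begin

lemma below_subset_E: "k \<in> E \<Longrightarrow> below R k \<subseteq> E"
  using search_E[OF R] by (auto simp: below_def)

lemma below_btw: "\<lbrakk>i \<in> below R k; j \<in> below R k; btw h i j\<rbrakk> \<Longrightarrow> h \<in> below R k"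
  using btw_split[of h i j k] search_btw[OF R, of k i h] search_btw[OF R, of k j h] btw_commute[of h i k]
  by (auto simp: below_iff) (auto simp: btw_def sep_def)

lemma verts_below_sep:
  assumes "k \<in> E" "u \<in> verts (below R k)" "v \<in> verts (below R k)" "sep h u v"
  shows "h \<in> below R k"
proof -
  obtain i j where "i \<in> below R k" "u = i \<or> u = par i" "j \<in> below R k" "v = j \<or> v = par j"
    using assms by (auto simp: verts_def)
  then show ?thesis using sep_endpoints[of i j u v h] below_btw below_subset_E assms by blast
qed

lemma edges_verts_below:
  assumes "k \<in> E" shows "edges (verts (below R k)) = below R k"
proof (intro equalityI subsetI)
  fix h assume h: "h \<in> edges (verts (below R k))"
  then have "sep h h (par h)" by (auto simp: sep_def edges_iff anc_par_iff)
  with h show "h \<in> below R k" using verts_below_sep[OF assms] by (auto simp: edges_iff)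
qed (use below_subset_E[OF assms] in \<open>auto simp: edges_iff verts_def\<close>)

lemma tube_verts_below: "k \<in> E \<Longrightarrow> tube T (verts (below R k))"
proof -
  assume k: "k \<in> E"
  have "verts (below R k) \<subseteq> {..n}"
    using below_subset_E[OF k] par_less' by (fastforce simp: verts_def E_def)
  moreover have "verts (below R k) \<noteq> {}" by (auto simp: verts_def below_def)
  ultimately show ?thesis using verts_below_sep[OF k] edges_verts_below[OF k] by (auto simp: tube_iff)
qed

text \<open>Two edges that share a vertex have no third edge on their path, so they are equal or
  comparable. This yields an edge below both \<open>k\<close> and \<open>j\<close>, and the forest
  property compares \<open>k\<close> with \<open>j\<close>.\<close>

lemma below_laminar:
  assumes "k \<in> E" "j \<in> E" "v \<in> verts (below R k)" "v \<in> verts (below R j)"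
  shows "below R k \<subseteq> below R j \<or> below R j \<subseteq> below R k"
proof -
  note S = search_trans[OF R] search_forest[OF R]
  obtain i i' where i: "i \<in> below R k" "v = i \<or> v = par i" "i' \<in> below R j" "v = i' \<or> v = par i'"
    using assms by (auto simp: verts_def)
  have E: "i \<in> E" "i' \<in> E" using below_subset_E i assms by blast+
  have "anc h i \<longleftrightarrow> anc h v" if "h \<noteq> i" for h using i(2) E that by (auto simp: anc_par_iff)
  moreover have "anc h i' \<longleftrightarrow> anc h v" if "h \<noteq> i'" for h using i(4) E that by (auto simp: anc_par_iff)
  ultimately have "btw h i i' \<Longrightarrow> h = i \<or> h = i'" for h unfolding btw_def sep_def by blast
  then have "i = i' \<or> (i, i') \<in> R \<or> (i', i) \<in> R"
    using search_top[OF R E] btw_ends by blast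
  then have "\<exists>m. m \<in> below R k \<and> m \<in> below R j"
    using i(1,3) S(1) unfolding below_iff by blast
  then have "k = j \<or> (k, j) \<in> R \<or> (j, k) \<in> R"
    using S(2)[of k _ j] unfolding below_iff by blast
  then show ?thesis using S(1) by (auto simp: below_def)
qed

text \<open>Convexity keeps the top of every path inside \<open>A\<close>, so an edge of least depth
  is itself the top of its paths to all others.\<close>

lemma search_top_set:
  assumes "A \<subseteq> E" "A \<noteq> {}" "\<And>i j h. i \<in> A \<Longrightarrow> j \<in> A \<Longrightarrow> btw h i j \<Longrightarrow> h \<in> A"
  obtains t where "t \<in> A" "A \<subseteq> below R t"
proof -
  obtain t where t: "t \<in> A" "\<And>x. x \<in> A \<Longrightarrow> depth R t \<le> depth R x"
    using assms(2) ex_has_least_nat[of "\<lambda>x. x \<in> A" _ "depth R"] by blast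
  have "i \<in> below R t" if "i \<in> A" for i
  proof -
    have "t \<in> E" "i \<in> E" using assms(1) t that by auto
    then obtain s where s: "btw s t i" "\<And>h. btw h t i \<Longrightarrow> h \<noteq> s \<Longrightarrow> (s, h) \<in> R"
      using search_top[OF R] by meson
    have "s \<in> A" using assms(3) s(1) t(1) that by blast
    then have "(s, t) \<notin> R" using depth_less[OF R, of s t] t(2) by fastforce
    then have "s = t" using s(2) by blast
    then show ?thesis using s(2) by (auto simp: below_iff)
  qed
  with t that show ?thesis by blast
qed

lemma nesting_nest:
  assumes "E \<noteq> {}" shows "nesting T (nest R)"
  unfolding nesting_def vertices_eq
proof (intro conjI ballI)
  obtain t where t: "t \<in> E" "E \<subseteq> below R t" using search_top_set[of E] assms btw_in_E by auto
  then have "below R t = E" using below_subset_E by blast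
  have "verts E = {..n}"
  proof (intro equalityI subsetI)
    fix v assume v: "v \<in> {..n}"
    show "v \<in> verts E"
    proof (cases "v = 0")
      case True
      have "1 \<in> E" using assms by (auto simp: E_def)
      then have "par 1 = 0" using par_less'[of 1] by simp
      moreover have "par 1 \<in> verts E" unfolding verts_def using \<open>1 \<in> E\<close> by blast
      ultimately show ?thesis using True by simp
    next
      case False
      then have "v \<in> E" using v by (auto simp: E_def)
      then show ?thesis by (auto simp: verts_def)
    qed
  qed (use par_less' in \<open>fastforce simp: verts_def E_def\<close>)
  moreover have "verts (below R t) \<in> nest R" using t by (auto simp: nest_def)
  ultimately show "{..n} \<in> nest R" using \<open>below R t = E\<close> by simp
next
  fix X assume "X \<in> nest R"
  then obtain k where k: "k \<in> E" "X = verts (below R k)" by (auto simp: nest_def)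
  then show tX: "tube T X" using tube_verts_below by simp
  have "{k, par k} \<subseteq> X" using k(2) by (auto simp: verts_def below_def)
  moreover have "par k \<noteq> k" using par_less'[OF k(1)] by simp
  ultimately show "2 \<le> card X" using card_mono[OF tube_finite[OF tX], of "{k, par k}"] by simp
next
  fix X Y assume "X \<in> nest R" "Y \<in> nest R"
  then obtain k j where "k \<in> E" "X = verts (below R k)" "j \<in> E" "Y = verts (below R j)"
    by (auto simp: nest_def)
  then have "X \<subseteq> Y \<or> Y \<subseteq> X" if "v \<in> X" "v \<in> Y" for v
    using below_laminar[of k j v] that verts_mono by metis
  then show "X \<subseteq> Y \<or> Y \<subseteq> X \<or> X \<inter> Y = {}" by blast
qed

text \<open>A compatible tube \<open>Y\<close> is compared with the tube \<open>V\<close> of its top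
  edge \<open>t\<close>. It cannot leave \<open>V\<close>, because its edges lie below
  \<open>t\<close>. If it were smaller, an edge \<open>h\<close> leading out of \<open>Y\<close>
  within \<open>V\<close> would lie below \<open>t\<close>, but its tube is nested with
  \<open>Y\<close>, so it contains \<open>Y\<close> and the edge \<open>t\<close>.\<close>

lemma maximal_nest:
  assumes "E \<noteq> {}" shows "maximal_nesting T (nest R)"
  unfolding maximal_nesting_def
proof (intro conjI allI impI)
  fix N assume "nesting T N \<and> nest R \<subseteq> N"
  then have N: "nesting T N" and sub: "nest R \<subseteq> N" by auto
  have "Y \<in> nest R" if Y: "Y \<in> N" for Y
  proof (rule ccontr)
    assume notin: "Y \<notin> nest R"
    have tY: "tube T Y" using nestingD(2)[OF N Y] .
    have "\<not> (\<exists>x. Y \<subseteq> {x})" using nestingD(3)[OF N Y] card_mono[of "{_}" Y] by fastforce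
    then obtain u v where uv: "u \<in> Y" "v \<in> Y" "u \<noteq> v" by blast
    then have "sep u u v \<or> sep v u v" using anc_antisym by (auto simp: sep_def)
    then have "edges Y \<noteq> {}" using tube_sep[OF tY uv(1,2)] by blast
    moreover have "edges Y \<subseteq> E" by (auto simp: edges_def)
    ultimately obtain t where t: "t \<in> edges Y" "edges Y \<subseteq> below R t"
      using search_top_set tube_btw[OF tY] by metis
    have tE: "t \<in> E" using t by (simp add: edges_iff)
    define V where "V = verts (below R t)"
    have V: "V \<in> N" "tube T V" "V \<in> nest R" "edges V = below R t"
      using sub tE nestingD(2)[OF N] edges_verts_below by (auto simp: V_def nest_def)
    have tV: "t \<in> V" "t \<in> Y" "par t \<in> Y" using V(4) t by (auto simp: edges_iff below_iff)
    have "Y \<subseteq> V"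
    proof
      fix y assume "y \<in> Y"
      show "y \<in> V"
      proof (rule ccontr)
        assume "y \<notin> V"
        then obtain h where h: "sep h t y" "(h \<in> V) \<noteq> (par h \<in> V)"
          using exit_edge[OF tV(1), of y] \<open>y \<in> Y\<close> tV(2) tY by (auto simp: tube_iff)
        then have "h \<in> edges Y" using tube_sep[OF tY tV(2) \<open>y \<in> Y\<close>] by blast
        then have "h \<in> edges V" using t(2) V(4) by blast
        with h(2) show False by (auto simp: edges_iff)
      qed
    qed
    moreover have "Y \<noteq> V" using notin V(3) by metis
    ultimately obtain w where w: "w \<in> V" "w \<notin> Y" by blast
    then obtain h where h: "sep h t w" "(h \<in> Y) \<noteq> (par h \<in> Y)"
      using exit_edge[OF tV(2) w(2)] V(2) tV(1) by (auto simp: tube_iff)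
    then have "h \<in> edges V" using tube_sep[OF V(2) tV(1) w(1)] by blast
    then have hb: "h \<in> below R t" "h \<noteq> t" "h \<in> E" using V(4) h(2) tV by (auto simp: edges_iff)
    then have hW: "verts (below R h) \<in> N" using sub by (auto simp: nest_def)
    have e: "edges (verts (below R h)) = below R h" using edges_verts_below hb by blast
    have hh: "h \<in> verts (below R h)" "par h \<in> verts (below R h)" by (auto simp: verts_def below_def)
    then have "verts (below R h) \<subseteq> Y \<or> Y \<subseteq> verts (below R h)"
      using nestingD(4)[OF N hW Y] h(2) by blast
    then have "Y \<subseteq> verts (below R h)" using hh h(2) by blast
    then have "t \<in> below R h" using e edges_mono t(1) by blast
    then show False using hb search_asym[OF R] by (auto simp: below_iff)
  qed
  with sub show "N = nest R" by blast
qed (rule nesting_nest[OF assms])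

lemma search_of_nest: "search_of (nest R) = R"
proof (intro equalityI subrelI)
  fix k i assume "(k, i) \<in> search_of (nest R)"
  then have ki: "k \<in> E" "k \<noteq> i" "\<And>j. j \<in> E \<Longrightarrow> k \<in> below R j \<Longrightarrow> i \<in> below R j"
    using edges_verts_below by (auto simp: search_of_iff nest_def)
  then show "(k, i) \<in> R" by (force simp: below_iff)
next
  fix k i assume ki: "(k, i) \<in> R"
  have "k \<in> E" "i \<in> E" "k \<noteq> i" using ki search_E[OF R] search_irrefl[OF R] by auto
  moreover have "i \<in> below R j" if "k \<in> below R j" for j
    using that ki search_trans[OF R] by (auto simp: below_iff)
  ultimately show "(k, i) \<in> search_of (nest R)"
    using edges_verts_below by (auto simp: search_of_iff nest_def)
qed

end

lemma E_nonempty: "nesting T N \<Longrightarrow> E \<noteq> {}"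
  using nestingD(1)[of N] nestingD(3)[of N "{..n}"] by (auto simp: E_def)

lemma tube_verts_edges:
  assumes "tube T X" "2 \<le> card X" shows "verts (edges X) = X"
proof (intro equalityI subsetI)
  fix u assume u: "u \<in> X"
  have "X \<noteq> {u}" using assms(2) by auto
  then obtain v where v: "v \<in> X" "v \<noteq> u" using u by blast
  consider "\<not> anc u v" | "anc u v" by blast
  then show "u \<in> verts (edges X)"
  proof cases
    case 1
    then have "u \<in> edges X" using tube_sep[OF assms(1) u v(1), of u] by (auto simp: sep_def)
    then show ?thesis by (auto simp: verts_def)
  next
    case 2
    then obtain c where c: "par c = u" "c \<in> E" "anc c v" using child_towards v(2) by metis
    then have "sep c u v" using anc_le[of c u] par_less'[of c] by (auto simp: sep_def)
    then have "c \<in> edges X" using tube_sep[OF assms(1) u v(1)] by blast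
    with c show ?thesis by (auto simp: verts_def)
  qed
qed (auto simp: verts_def edges_iff)

text \<open>The tubes constructed from \<open>search_of N\<close> are the innermost tubes of the
  edges in \<open>N\<close>. This gives one inclusion, and maximality turns it into
  equality.\<close>

lemma nest_search_of:
  assumes M: "maximal_nesting T N" shows "nest (search_of N) = N"
proof -
  have N: "nesting T N" using M by (simp add: maximal_nesting_def)
  have S: "search (search_of N)" using search_search_of[OF M] .
  have "verts (below (search_of N) k) \<in> N" if k: "k \<in> E" for k
  proof -
    obtain X where X: "X \<in> N" "k \<in> edges X" "\<And>Z. Z \<in> N \<Longrightarrow> k \<in> edges Z \<Longrightarrow> X \<subseteq> Z"
      using inner_tube[OF N k] by metis
    have "i \<in> edges X \<longleftrightarrow> i \<in> below (search_of N) k" for i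
      using X k edges_mono[OF X(3)] by (auto simp: below_iff search_of_iff edges_iff)
    then have "edges X = below (search_of N) k" by blast
    then show ?thesis using tube_verts_edges[of X] nestingD(2,3)[OF N X(1)] X(1) by simp
  qed
  then have "nest (search_of N) \<subseteq> N" by (auto simp: nest_def)
  moreover have "maximal_nesting T (nest (search_of N))" using maximal_nest[OF S E_nonempty[OF N]] .
  ultimately show ?thesis using N unfolding maximal_nesting_def by blast
qed

end

section \<open>The order on maximal nestings\<close>

context plane_preorder_tree
begin

lemma exists_tree_parent:
  assumes R: "search R" and a: "(a, f) \<in> R"
  obtains e where "tree_parent R e f"
proof -
  have "finite {x. (x, f) \<in> R}" by (rule finite_subset[of _ E]) (use search_E[OF R] in auto)
  then have fin: "finite (depth R ` {x. (x, f) \<in> R})" by simp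
  moreover have "depth R ` {x. (x, f) \<in> R} \<noteq> {}" using a by auto
  ultimately have "Max (depth R ` {x. (x, f) \<in> R}) \<in> depth R ` {x. (x, f) \<in> R}" by (rule Max_in)
  then obtain e where e: "(e, f) \<in> R" "depth R e = Max (depth R ` {x. (x, f) \<in> R})" by auto
  have "depth R m \<le> depth R e" if "(m, f) \<in> R" for m
    using Max_ge[OF fin, of "depth R m"] e(2) that by auto
  then have "tree_parent R e f" using e(1) depth_less[OF R] unfolding tree_parent_def
    by (meson not_le)
  then show ?thesis using that by blast
qed

section \<open>The component left below an edge when its parent is split off\<close>

context
  fixes R e f assumes R: "search R" and p: "tree_parent R e f"
begin

lemma parentD: "(e, f) \<in> R" "e \<in> E" "f \<in> E" "e \<noteq> f" "(f, e) \<notin> R" "\<And>m. (e, m) \<in> R \<Longrightarrow> (m, f) \<notin> R"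
  using p search_E[OF R] search_irrefl[OF R] search_asym[OF R] by (auto simp: tree_parent_def)

text \<open>Splitting off \<open>e\<close> leaves two sides. As \<open>e\<close> covers
  \<open>f\<close>, the edge \<open>f\<close> is the top of one of them.\<close>

lemma parent_split:
  assumes "(e, i) \<in> R" shows "i = f \<or> (f, i) \<in> R \<or> btw e f i"
proof -
  have E: "f \<in> E" "i \<in> E" using parentD(3) assms search_E[OF R] by auto
  obtain s where s: "btw s f i" "\<And>h. btw h f i \<Longrightarrow> h \<noteq> s \<Longrightarrow> (s, h) \<in> R"
    using search_top[OF R E] by blast
  have "s = e \<or> (e, s) \<in> R"
    using btw_split[OF s(1), of e] search_btw[OF R parentD(1), of s] search_btw[OF R assms, of s]
      btw_commute[of s e f] by blast
  moreover have "s = f \<or> (s, f) \<in> R" using s(2) by blast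
  ultimately have "s = e \<or> s = f" using parentD(6) by blast
  with s show ?thesis by blast
qed

lemma above_parent: "(j, f) \<in> R \<longleftrightarrow> j = e \<or> (j, e) \<in> R"
  using parentD search_forest[OF R, of j f e] search_trans[OF R, of j e f] by blast

text \<open>Inside the tube of \<open>e\<close>, the tube of \<open>f\<close> can be left only
  through \<open>e\<close>: any other exit edge would have a tube strictly between the two.\<close>

lemma leave_child_tube:
  assumes b: "b \<in> verts (below R e)" "b \<notin> verts (below R f)"
  shows "sep e b f"
proof -
  let ?X = "verts (below R f)"
  have f: "f \<in> ?X" by (auto simp: verts_def below_def)
  have P: "tube T (verts (below R e))" using tube_verts_below[OF R parentD(2)] .
  have fe: "f \<in> below R e" using parentD by (simp add: below_iff)
  then have fP: "f \<in> verts (below R e)" by (auto simp: verts_def)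
  obtain h where h: "sep h f b" "(h \<in> ?X) \<noteq> (par h \<in> ?X)"
    using exit_edge[OF f b(2)] P b(1) fP by (auto simp: tube_iff)
  have he: "h \<in> below R e"
    using tube_sep[OF P fP b(1) h(1)] edges_verts_below[OF R parentD(2)] by simp
  have "h = e"
  proof (rule ccontr)
    assume "h \<noteq> e"
    then have eh: "(e, h) \<in> R" using he by (simp add: below_iff)
    have hE: "h \<in> E" using search_E[OF R eh] by simp
    have "h \<in> verts (below R h)" "par h \<in> verts (below R h)" by (auto simp: verts_def below_def)
    then have "below R h \<subseteq> below R f \<or> below R f \<subseteq> below R h"
      using below_laminar[OF R hE parentD(3)] h(2) by blast
    moreover have "h \<notin> below R f" using h(2) by (auto simp: verts_def)
    ultimately have "f \<in> below R h" "f \<noteq> h" by (auto simp: below_iff)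
    then show False using eh parentD(6) by (auto simp: below_iff)
  qed
  with h(1) show ?thesis using sep_commute by blast
qed

end

lemma nest_memI: "k \<in> E \<Longrightarrow> verts (below R k) \<in> nest R"
  by (auto simp: nest_def)

lemma verts_below_inject:
  "\<lbrakk>search R; k \<in> E; j \<in> E; verts (below R k) = verts (below R j)\<rbrakk> \<Longrightarrow> k = j"
  using edges_verts_below search_asym by (metis below_iff)

text \<open>Let \<open>X\<close> be the tube of \<open>f\<close>, and \<open>e\<close> the parent of
  \<open>f\<close>. Without \<open>X\<close>, the edges \<open>e\<close> and \<open>f\<close> lie in
  the same tubes, so \<open>X'\<close> has to tell them apart. Thus a move is an exchange of
  \<open>e\<close> and \<open>f\<close>, and the condition on minima amounts to
  \<open>f < e\<close>.\<close>

lemma nesting_move_inversions: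
  assumes move: "(N, N') \<in> nesting_move T"
  shows "inversions (search_of N') \<subseteq> inversions (search_of N)"
proof -
  have M: "maximal_nesting T N" "maximal_nesting T N'"
    and *: "\<exists>X\<in>N - N'. \<exists>X'\<in>N' - N. N - {X} = N' - {X'} \<and> (\<exists>a\<in>X - X'. \<forall>b\<in>X' - X. a < b)"
    using move by (simp_all add: nesting_move_def)
  from * obtain X X' where XX': "X \<in> N - N'" "X' \<in> N' - N"
    and K: "N - {X} = N' - {X'}" and min: "\<exists>a\<in>X - X'. \<forall>b\<in>X' - X. a < b"
    by metis
  from XX' have X: "X \<in> N" "X \<notin> N'" and X': "X' \<in> N'" "X' \<notin> N" by auto
  from min obtain a where a: "a \<in> X" "a \<notin> X'" "\<And>b. b \<in> X' \<Longrightarrow> b \<notin> X \<Longrightarrow> a < b"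
    by blast
  have N: "nesting T N" "nesting T N'" using M by (auto simp: maximal_nesting_def)
  define R R' where "R = search_of N" and "R' = search_of N'"
  have R: "search R" "search R'" using search_search_of M by (auto simp: R_def R'_def)
  have nest: "nest R = N" using nest_search_of[OF M(1)] by (simp add: R_def)
  have in_N': "Z \<in> N'" if "Z \<in> N" "Z \<noteq> X" for Z using K that by blast
  have in_N: "Z \<in> N" if "Z \<in> N'" "Z \<noteq> X'" for Z using K that by blast
  have tX': "tube T X'" "2 \<le> card X'" using nestingD(2,3)[OF N(2) X'(1)] by auto
  let ?V = "\<lambda>k. verts (below R k)"
  note ev = edges_verts_below[OF R(1)]
  have V_N: "?V k \<in> N" if "k \<in> E" for k using nest_memI[OF that, of R] nest by simp
  obtain f where f: "f \<in> E" "X = ?V f" using X(1) nest by (auto simp: nest_def)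
  have eX: "edges X = below R f" using f ev by simp
  have V_N': "?V k \<in> N'" if "k \<in> E" "k \<noteq> f" for k
    using in_N'[OF V_N[OF that(1)]] verts_below_inject[OF R(1) that(1) f(1)] f(2) that(2) by blast
  have tX: "tube T X" using nestingD(2)[OF N(1) X(1)] .
  have fX: "f \<in> X" "par f \<in> X" using eX by (auto simp: edges_iff below_iff)
  \<comment> \<open>The full vertex set belongs to both nestings, so \<open>X\<close> is proper and
    \<open>f\<close> is not the top edge.\<close>
  have "\<exists>c. (c, f) \<in> R"
  proof (rule ccontr)
    assume no: "\<nexists>c. (c, f) \<in> R"
    have "X \<subset> {..n}" using nestingD(1)[OF N(2)] X(2) tX by (auto simp: tube_iff)
    then obtain w where w: "w \<le> n" "w \<notin> X" by auto
    moreover have "f \<le> n" using f(1) by (simp add: E_def)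
    ultimately obtain h where h: "sep h f w" "(h \<in> X) \<noteq> (par h \<in> X)"
      using exit_edge[OF fX(1)] by blast
    have hE: "h \<in> E" using sep_in_E[OF h(1) \<open>f \<le> n\<close> w(1)] .
    have "h \<notin> below R f" using h(2) eX by (auto simp: edges_iff)
    then obtain s where "btw s f h" "\<And>h'. btw h' f h \<Longrightarrow> h' \<noteq> s \<Longrightarrow> (s, h') \<in> R" "s \<noteq> f"
      using search_top[OF R(1) f(1) hE] by (metis below_iff btw_ends(2))
    then show False using no by blast
  qed
  then obtain e where p: "tree_parent R e f" using exists_tree_parent[OF R(1)] by blast
  note e = parentD[OF R(1) p]
  have P: "?V e \<in> N'" using V_N' e by blast
  have eP: "e \<in> edges (?V e)" "f \<in> edges (?V e)" using ev e by (auto simp: below_iff)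
  have XP: "X \<subseteq> ?V e"
    using f(2) verts_mono[of "below R f" "below R e"] e(1) search_trans[OF R(1)] by (auto simp: below_def)
  have Z_ef: "f \<in> edges Z \<longleftrightarrow> e \<in> edges Z" if Z: "Z \<in> N'" "Z \<noteq> X'" for Z
  proof -
    have "Z \<in> N" using in_N Z by blast
    then obtain j where j: "j \<in> E" "Z = ?V j" using nest by (auto simp: nest_def)
    then have "j \<noteq> f" using Z X f by auto
    then show ?thesis using j ev above_parent[OF R(1) p, of j] by (auto simp: below_iff)
  qed
  have X'_ef: "f \<in> edges X' \<longleftrightarrow> e \<notin> edges X'"
  proof (rule ccontr)
    assume "\<not> ?thesis"
    then have "f \<in> edges Z \<longleftrightarrow> e \<in> edges Z" if "Z \<in> N'" for Z using Z_ef that by blast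
    then have "(e, f) \<in> R'" "(f, e) \<in> R'" using e by (auto simp: R'_def search_of_iff)
    then show False using search_asym[OF R(2)] by blast
  qed
  \<comment> \<open>If \<open>X'\<close> contained \<open>f\<close> and not \<open>e\<close>, it
    would lie inside \<open>X\<close> and be compatible with all of \<open>N\<close>.\<close>
  have eX': "e \<in> edges X'"
  proof (rule ccontr)
    assume "e \<notin> edges X'"
    then have fX': "f \<in> edges X'" "f \<in> X'" using X'_ef by (auto simp: edges_iff)
    have "X' \<subseteq> ?V e"
      using nestingD(4)[OF N(2) X'(1) P, of f] fX' eP(2) edges_mono[of "?V e" X'] eP(1)
        \<open>e \<notin> edges X'\<close> by (auto simp: edges_iff)
    then have "X' \<subseteq> X"
      using leave_child_tube[OF R(1) p] tube_sep[OF tX'(1) _ fX'(2), of _ e] \<open>e \<notin> edges X'\<close> f(2) by blast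
    then have "X' \<in> N"
      using nesting_insert_subset[OF M(1) tX'] N(2) in_N' X'(1) unfolding nesting_def by metis
    then show False using X' by blast
  qed
  then have fX': "f \<notin> edges X'" using X'_ef by blast
  have e_notin: "e \<notin> edges X" using eX e by (auto simp: below_iff)
  \<comment> \<open>Suppose \<open>e < f\<close>. If \<open>e\<close> is an ancestor of
    \<open>f\<close>, all of \<open>X\<close> lies below \<open>e\<close>, and \<open>par e\<close>
    is a smaller element of \<open>X' - X\<close>. Otherwise \<open>a < e < f\<close>, and the edge
    where the path from \<open>e\<close> to \<open>a\<close> leaves \<open>X'\<close> is not
    \<open>f\<close>; its tube is in \<open>N'\<close> and contains \<open>X'\<close>, hence
    \<open>e\<close>, although \<open>e\<close> is above that edge.\<close>
  have "f < e"
  proof (rule ccontr)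
    assume "\<not> f < e"
    then have "e < f" using e(4) by simp
    show False
    proof (cases "anc e f")
      case True
      have "anc e x" if "x \<in> X" for x
        using tube_sep[OF tX that fX(1), of e] e_notin True by (auto simp: sep_def)
      moreover have "\<not> anc e (par e)" using e(2) by (simp add: anc_par_iff)
      ultimately have "e \<le> a" "par e \<notin> X" using a(1) anc_le by auto
      then show False using a(3)[of "par e"] eX' par_less'[OF e(2)] by (auto simp: edges_iff)
    next
      case False
      then have "e \<notin> X" using tube_sep[OF tX _ fX(1), of e e] e_notin by (auto simp: sep_def)
      then have "a < e" using a(3) eX' by (auto simp: edges_iff)
      have ae: "e \<in> X'" "e \<in> ?V e" "a \<in> ?V e" using eX' eP a(1) XP by (auto simp: edges_iff)
      have tP: "tube T (?V e)" using nestingD(2)[OF N(2) P] .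
      then obtain h where h: "sep h e a" "(h \<in> X') \<noteq> (par h \<in> X')"
        using exit_edge[OF ae(1) a(2)] ae by (auto simp: tube_iff)
      have he: "h \<in> below R e" using tube_sep[OF tP ae(2,3) h(1)] ev e(2) by simp
      have "h \<noteq> e" using h(2) eX' by (auto simp: edges_iff)
      then have eh: "(e, h) \<in> R" "h \<in> E" using he search_E[OF R(1)] by (auto simp: below_iff)
      show False
      proof (cases "h = f")
        case True
        then have "anc f a \<or> anc f e" using h(1) by (auto simp: sep_def)
        then show False using anc_le[of f a] anc_le[of f e] \<open>a < e\<close> \<open>e < f\<close> by auto
      next
        case False
        have hh: "h \<in> ?V h" "par h \<in> ?V h" by (auto simp: verts_def below_def)
        then have "X' \<subseteq> ?V h \<or> ?V h \<subseteq> X'"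
          using nestingD(4)[OF N(2) X'(1) V_N'[OF eh(2) False]] h(2) by blast
        then have "X' \<subseteq> ?V h" using hh h(2) by blast
        then have "e \<in> below R h" using eX' edges_mono ev[OF eh(2)] by blast
        then show False using eh search_asym[OF R(1)] \<open>h \<noteq> e\<close> by (auto simp: below_iff)
      qed
    qed
  qed
  show ?thesis
  proof clarify
    fix i k assume "(i, k) \<in> inversions (search_of N')"
    then have ik: "i < k" and ki: "(k, i) \<in> R'" by (auto simp: R'_def)
    have E: "k \<in> E" "i \<in> E" "k \<noteq> i" using ki by (auto simp: R'_def search_of_iff)
    have R'_edges: "i \<in> edges Z" if "Z \<in> N'" "k \<in> edges Z" for Z
      using ki that by (auto simp: R'_def search_of_iff)
    have "(k, i) \<in> R"
    proof (rule ccontr)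
      assume no: "(k, i) \<notin> R"
      have "k \<noteq> f \<Longrightarrow> False"
        using R'_edges[OF V_N'[OF E(1)]] ev[OF E(1)] no E(3) by (auto simp: below_iff)
      then have "k = f" by blast
      then have "i \<in> below R e" using R'_edges[OF P] eP ev e by auto
      moreover have "i \<noteq> e" using ik \<open>k = f\<close> \<open>f < e\<close> by auto
      ultimately have "btw e f i"
        using parent_split[OF R(1) p, of i] no \<open>k = f\<close> E(3) by (auto simp: below_iff)
      then show False using btw_less[of e i f] ik \<open>k = f\<close> \<open>f < e\<close> btw_commute by auto
    qed
    then show "(i, k) \<in> inversions (search_of N)" using ik by (simp add: R_def)
  qed
qed

text \<open>After the exchange, the tube of \<open>f\<close> is the old tube of \<open>e\<close>,
  and the tubes of all other edges are unchanged. So the old tube of \<open>f\<close> is replaced by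
  the new tube of \<open>e\<close>.\<close>

lemma nesting_move_flip:
  assumes R: "search R" and p: "tree_parent R e f" and "f < e"
  shows "(nest R, nest (flip R e f)) \<in> nesting_move T"
proof -
  define R1 where "R1 = flip R e f"
  have R1: "search R1" using search_flip by (simp add: R1_def)
  note e = parentD[OF R p]
  have "E \<noteq> {}" using e by auto
  have iff: "(k, i) \<in> R1 \<longleftrightarrow>
      (k, i) \<in> R \<and> \<not> (k = e \<and> btw f e i) \<or> k = f \<and> i \<noteq> f \<and> btw e f i \<and> (i = e \<or> (e, i) \<in> R)" for k i
    unfolding R1_def by (rule flip_iff[OF R p])
  let ?X = "verts (below R f)" and ?X' = "verts (below R1 e)"
  have same_iff: "(k, i) \<in> R1 \<longleftrightarrow> (k, i) \<in> R" if "k \<noteq> e" "k \<noteq> f" for k i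
    using that iff by simp
  have same: "below R1 k = below R k" if "k \<noteq> e" "k \<noteq> f" for k
    using that iff by (auto simp: below_def)
  have top: "below R1 f = below R e"
    using iff parent_split[OF R p] search_trans[OF R e(1)] e by (auto simp: below_def)
  have fe: "(f, e) \<in> R1" using iff e by auto
  then have ef: "(e, f) \<notin> R1" using search_asym[OF R1] by blast
  have tX: "tube T ?X" "tube T ?X'" using tube_verts_below R R1 e by auto
  have eX: "edges ?X = below R f" "edges ?X' = below R1 e" using edges_verts_below R R1 e by auto
  have fX: "f \<in> ?X" "par f \<in> ?X" "e \<in> ?X'" by (auto simp: verts_def below_def)
  have f_notin: "f \<notin> edges ?X'" using ef e(4) eX by (auto simp: below_iff)
  have e_notin: "e \<notin> edges ?X" using e eX by (auto simp: below_iff)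
  have X: "?X \<notin> nest R1"
  proof
    assume "?X \<in> nest R1"
    then obtain j where j: "j \<in> E" "?X = verts (below R1 j)" by (auto simp: nest_def)
    then have "below R f = below R1 j" by (metis eX(1) edges_verts_below[OF R1 j(1)])
    then have "f \<in> below R1 j" "e \<notin> below R1 j" "j \<in> below R f" using e_notin eX by (auto simp: below_iff)
    then show False using ef e(4) fe same_iff[of j] search_asym[OF R] by (auto simp: below_iff)
  qed
  have X': "?X' \<notin> nest R"
  proof
    assume "?X' \<in> nest R"
    then obtain j where j: "j \<in> E" "?X' = verts (below R j)" by (auto simp: nest_def)
    then have "below R1 e = below R j" by (metis eX(2) edges_verts_below[OF R j(1)])
    then have "e \<in> below R j" "f \<notin> below R j" "j \<in> below R1 e" using f_notin eX by (auto simp: below_iff)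
    then show False using e same_iff[of j] search_asym[OF R1] by (auto simp: below_iff)
  qed
  have Es: "E = insert e (insert f (E - {e, f}))" using e by auto
  have rest: "(\<lambda>k. verts (below R1 k)) ` (E - {e, f}) = (\<lambda>k. verts (below R k)) ` (E - {e, f})"
    using same by (intro image_cong) auto
  have nests: "nest R = insert ?X (insert (verts (below R e)) ((\<lambda>k. verts (below R k)) ` (E - {e, f})))"
    "nest R1 = insert ?X' (insert (verts (below R e)) ((\<lambda>k. verts (below R k)) ` (E - {e, f})))"
    unfolding nest_def by (subst Es, simp add: insert_commute rest top)+
  have K: "nest R - {?X} = nest R1 - {?X'}" using X X' unfolding nests by blast
  \<comment> \<open>The witness is \<open>par f\<close> if \<open>f\<close> is an ancestor of
    \<open>e\<close>, and \<open>f\<close> itself otherwise.\<close>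
  have "\<exists>a\<in>?X - ?X'. \<forall>b\<in>?X' - ?X. a < b"
  proof (cases "anc f e")
    case True
    have "anc f x" if "x \<in> ?X'" for x
      using tube_sep[OF tX(2) that fX(3), of f] f_notin True by (auto simp: sep_def)
    moreover have "\<not> anc f (par f)" "par f < f" using e(3) par_less' by (auto simp: anc_par_iff)
    ultimately show ?thesis using fX(2) anc_le by (meson DiffD1 DiffI less_le_trans)
  next
    case False
    then have "f \<notin> ?X'" using tube_sep[OF tX(2) _ fX(3), of f f] f_notin by (auto simp: sep_def)
    moreover have "f < b" if b: "b \<in> ?X'" "b \<notin> ?X" for b
    proof -
      have "below R1 e \<subseteq> below R1 f" using fe search_trans[OF R1] by (auto simp: below_def)
      then have "b \<in> verts (below R e)" using b(1) verts_mono top by blast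
      then have "sep e b f" using leave_child_tube[OF R p] b(2) by blast
      then have "anc e b" using anc_le[of e f] \<open>f < e\<close> by (auto simp: sep_def)
      then show ?thesis using anc_le \<open>f < e\<close> by fastforce
    qed
    ultimately show ?thesis using fX(1) by blast
  qed
  moreover have "?X \<in> nest R" "?X' \<in> nest R1" using nest_memI e by auto
  moreover have "maximal_nesting T (nest R)" "maximal_nesting T (nest R1)"
    using maximal_nest R R1 \<open>E \<noteq> {}\<close> by auto
  ultimately show ?thesis
    unfolding R1_def[symmetric] nesting_move_def using X X' K by blast
qed

lemma nesting_moves_inversions:
  "(N, N') \<in> (nesting_move T)\<^sup>* \<Longrightarrow> inversions (search_of N') \<subseteq> inversions (search_of N)"
  by (induction rule: rtrancl_induct) (use nesting_move_inversions in blast)+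

lemma flip_psubset:
  assumes "search R" "tree_parent R e f" "f < e"
  shows "inversions (flip R e f) \<subset> inversions R"
proof -
  have "(f, e) \<in> inversions R" using parentD[OF assms(1,2)] assms(3) by simp
  moreover have "(f, e) \<notin> inversions (flip R e f)"
    unfolding inversions_flip[OF assms] by (simp del: inversions_iff)
  moreover have "inversions (flip R e f) \<subseteq> inversions R"
    unfolding inversions_flip[OF assms] by (rule Diff_subset)
  ultimately show ?thesis by blast
qed

lemma finite_inversions: "search R \<Longrightarrow> finite (inversions R)"
  by (rule finite_subset[of _ "E \<times> E"]) (use search_E in auto)

text \<open>Each step of \<open>flip_towards\<close> loses inversions, so the steps end at
  \<open>R'\<close>. The last exchange is recorded too, because join-semidistributivity needs a move
  that arrives at \<open>R'\<close> rather than one that starts at \<open>R\<close>.\<close>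

lemma flip_sequence:
  assumes "search R" "search R'" "inversions R' \<subseteq> inversions R"
  shows "(nest R, nest R') \<in> (nesting_move T)\<^sup>* \<and>
    (R \<noteq> R' \<longrightarrow> (\<exists>S e f. search S \<and> tree_parent S e f \<and> f < e \<and> R' = flip S e f \<and>
       inversions S \<subseteq> inversions R))"
  using assms
proof (induction "card (inversions R)" arbitrary: R rule: less_induct)
  case less
  show ?case
  proof (cases "R = R'")
    case ne: False
    obtain e f where ef: "tree_parent R e f" "f < e" "inversions R' \<subseteq> inversions (flip R e f)"
      using flip_towards[OF less.prems ne] by blast
    let ?S = "flip R e f"
    have S: "search ?S" "inversions ?S \<subset> inversions R"
      using search_flip flip_psubset[OF less.prems(1) ef(1,2)] by auto
    have c: "card (inversions ?S) < card (inversions R)"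
      using psubset_card_mono[OF finite_inversions[OF less.prems(1)] S(2)] .
    note IH = less.hyps[OF c S(1) less.prems(2) ef(3)]
    have "(nest R, nest R') \<in> (nesting_move T)\<^sup>*"
      using IH nesting_move_flip[OF less.prems(1) ef(1,2)] by (meson converse_rtrancl_into_rtrancl)
    moreover have "\<exists>S e f. search S \<and> tree_parent S e f \<and> f < e \<and> R' = flip S e f \<and>
           inversions S \<subseteq> inversions R"
    proof (cases "?S = R'")
      case True
      with less.prems(1) ef show ?thesis by blast
    next
      case False
      with IH obtain S e' f' where "search S" "tree_parent S e' f'" "f' < e'" "R' = flip S e' f'"
        "inversions S \<subseteq> inversions ?S" by blast
      moreover have "inversions S \<subseteq> inversions R" using calculation(5) S(2) by blast
      ultimately show ?thesis by blast
    qed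
    ultimately show ?thesis by blast
  qed simp
qed

lemma nesting_moves_iff:
  assumes "maximal_nesting T N" "maximal_nesting T N'"
  shows "(N, N') \<in> (nesting_move T)\<^sup>* \<longleftrightarrow> inversions (search_of N') \<subseteq> inversions (search_of N)"
proof
  assume "inversions (search_of N') \<subseteq> inversions (search_of N)"
  then show "(N, N') \<in> (nesting_move T)\<^sup>*"
    using flip_sequence[OF search_search_of[OF assms(1)] search_search_of[OF assms(2)]]
      nest_search_of[OF assms(1)] nest_search_of[OF assms(2)] by simp
qed (rule nesting_moves_inversions)

end

section \<open>Exchanges when branching occurs only on the spine\<close>

context preorder_tree
begin

text \<open>Condition (V) without the tree itself: the rightmost branch consists of the ancestors of
  the last vertex \<open>n\<close>.\<close>

definition narrow :: bool where
  "narrow \<longleftrightarrow> (\<forall>b\<in>E. \<forall>c\<in>E. par b = par c \<longrightarrow> b \<noteq> c \<longrightarrow> anc (par b) n)"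

text \<open>Nothing branches at or below a vertex \<open>f\<close> off the rightmost branch, so its
  descendants form a chain in the order of their labels.\<close>

lemma narrow_chain:
  assumes narrow "anc f j" "anc f g" "j \<le> g" "g \<le> n" "\<not> anc f n"
  shows "anc j g"
  using assms(3-5)
proof (induction g rule: less_induct)
  case (less g)
  show ?case
  proof (cases "g = f \<or> j = g")
    case True
    then show ?thesis using anc_le[OF assms(2)] less.prems by auto
  next
    case False
    then have g: "g \<in> E" "anc f (par g)" "par g < g"
      using less.prems anc_le[of f g] anc_par[of g f] par_less'[of g] by (auto simp: E_def)
    show ?thesis
    proof (cases "j \<le> par g")
      case True
      then have "anc j (par g)" using less.IH[of "par g"] g less.prems by auto
      then show ?thesis using g(1) by (simp add: anc_par)
    next
      case nle: False
      have "anc (par g) g" using g(1) by (simp add: anc_par)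
      then have "anc (par g) j" using anc_interval[of "par g" g j] nle less.prems by auto
      then obtain c where c: "c \<in> E" "par c = par g" "anc c j" using child_towards nle by blast
      then have "c \<noteq> g" using anc_le[of c j] less.prems False by auto
      then have "anc (par g) n" using assms(1) c(1,2) g(1) unfolding narrow_def by metis
      then show ?thesis using anc_trans g(2) assms(6) by blast
    qed
  qed
qed

lemma not_anc_n: "\<not> anc f e \<Longrightarrow> f \<le> e \<Longrightarrow> e \<in> E \<Longrightarrow> \<not> anc f n"
  using anc_interval[of f n e] by (auto simp: E_def)

text \<open>Suppose that the greedy choice for the intersection splits off an edge \<open>t\<close> between \<open>f\<close> and \<open>e\<close>
  first. Then \<open>e\<close> was not ready because of an edge \<open>j\<close> with \<open>t < j < e\<close>, and the least such \<open>j\<close>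
  is either itself ready or a descendant of \<open>t\<close> on another branch than \<open>f\<close>.\<close>

lemma common_descent:
  assumes narrow and R: "search R" "tree_parent R e f" "f < e"
    and X: "search X" "inversions X \<subseteq> inversions R" "(e, f) \<in> X"
    and Y: "search Y" "inversions Y \<subseteq> inversions R" "(e, f) \<in> Y"
  obtains Z where "search Z" "inversions Z \<subseteq> inversions X \<inter> inversions Y" "(e, f) \<in> Z"
proof -
  define C where "C = inversions X \<inter> inversions Y"
  have trC: "(i, k) \<in> C" if "(i, j) \<in> C" "(j, k) \<in> C" for i j k
    using that search_trans[OF X(1), of k j i] search_trans[OF Y(1), of k j i] by (auto simp: C_def)
  obtain \<sigma> where \<sigma>: "greedy C \<sigma>" using exists_greedy by blast
  define Z where "Z = of_rank \<sigma>"
  have Z: "search Z" using search_of_rank \<sigma> by (auto simp: greedy_def Z_def)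
  have ef: "e \<in> E" "f \<in> E" "\<And>m. (e, m) \<in> R \<Longrightarrow> (m, f) \<notin> R"
    using R(2) search_E[OF R(1)] by (auto simp: tree_parent_def)
  have "(e, f) \<in> Z"
  proof (rule ccontr)
    assume no: "(e, f) \<notin> Z"
    obtain t where t: "btw t f e" "\<And>h. btw h f e \<Longrightarrow> h \<noteq> t \<Longrightarrow> (t, h) \<in> Z"
      using search_top[OF Z ef(2,1)] by blast
    have "t \<noteq> e" using t(2)[of f] no R(3) by auto
    then have te: "t < e" using btw_less t(1) R(3) by blast
    have tE: "t \<in> E" using btw_in_E[OF t(1) ef(2,1)] .
    define Q where "Q = {x \<in> E. \<sigma> t \<le> \<sigma> x}"
    have max: "\<And>r. ready C Q r \<Longrightarrow> r \<le> t" and rt: "ready C Q t"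
      using \<sigma> tE by (auto simp: greedy_def Q_def)
    have path_Q: "h \<in> Q" if "btw h f e" for h
      using t(2)[OF that] tE by (cases "h = t") (auto simp: Q_def Z_def of_rank_iff)
    have et_Q: "h \<in> Q" if "btw h e t" for h
      using path_Q btw_shrink[of t f e h] t(1) that btw_commute by blast
    have Xt: "(e, t) \<in> X" and Yt: "(e, t) \<in> Y"
      using search_btw[OF X(1,3)] search_btw[OF Y(1,3)] t(1) \<open>t \<noteq> e\<close> btw_commute by blast+
    \<comment> \<open>These are the edges that \<open>search_cotrans\<close> returns when
      \<open>e\<close> fails to be above some edge of the component. The least of them turns out to
      be ready, although it exceeds \<open>t\<close>.\<close>
    define J where "J = {j \<in> Q. t < j \<and> j < e \<and> \<not> anc j t \<and> \<not> anc j e \<and>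
                          (\<forall>h. btw h j t \<longrightarrow> h \<in> Q) \<and> ((j, e) \<in> X \<or> (j, e) \<in> Y)}"
    have J: "\<exists>h\<in>J. h \<le> j \<and> (h, e) \<in> S"
      if S: "search S" "(e, t) \<in> S" "(e, j) \<notin> S" "S = X \<or> S = Y" "t < j" "j < e"
        "\<And>h. btw h j t \<Longrightarrow> h \<in> Q" for S j
    proof -
      obtain h where h: "anc h j" "\<not> anc h t" "\<not> anc h e" "t < h" "(h, e) \<in> S"
        using search_cotrans[OF S(1,2,5,6,3)] by blast
      have b: "btw h j t" using h by (auto simp: btw_def sep_def)
      then have "btw h' h t \<Longrightarrow> h' \<in> Q" for h' using btw_shrink[of h j t h'] S(7) by blast
      then have "h \<in> J" using h S(4,6) S(7)[OF b] anc_le[of h j] by (auto simp: J_def)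
      then show ?thesis using h anc_le by blast
    qed
    have "\<not> ready C Q e" using max te by fastforce
    then obtain j\<^sub>0 where j0: "j\<^sub>0 \<in> Q" "j\<^sub>0 < e" "\<And>h. btw h j\<^sub>0 e \<Longrightarrow> h \<in> Q" "(j\<^sub>0, e) \<notin> C"
      using path_Q[of e] by (auto simp: ready_def)
    have j0t: "h \<in> Q" if "btw h j\<^sub>0 t" for h
      using btw_split[OF that, of e] j0(3) et_Q by blast
    have tC: "(t, e) \<in> C" using te Xt Yt by (simp add: C_def)
    have "\<not> j\<^sub>0 < t" using rt j0t j0(1,4) trC tC unfolding ready_def by blast
    moreover have "j\<^sub>0 \<noteq> t" using tC j0(4) by auto
    ultimately have "t < j\<^sub>0" by simp
    moreover have "(e, j\<^sub>0) \<notin> X \<or> (e, j\<^sub>0) \<notin> Y" using j0(2,4) by (auto simp: C_def)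
    ultimately have "J \<noteq> {}" using J[OF X(1) Xt] J[OF Y(1) Yt] j0(2) j0t by blast
    moreover have "finite J" by (rule finite_subset[of _ E]) (auto simp: J_def Q_def)
    ultimately obtain j where jJ: "j \<in> J" and least: "\<And>h. h \<in> J \<Longrightarrow> j \<le> h"
      using Min_in Min_le by metis
    then have j: "j \<in> Q" "t < j" "j < e" "\<not> anc j t" "\<not> anc j e" "\<And>h. btw h j t \<Longrightarrow> h \<in> Q"
      by (auto simp: J_def)
    have above: "(e, i) \<in> S"
      if S: "search S" "(e, t) \<in> S" "S = X \<or> S = Y" "t < i" "i \<le> j" "\<And>h. btw h i t \<Longrightarrow> h \<in> Q"
        "i = j \<Longrightarrow> (j, e) \<notin> S" for S i
    proof (rule ccontr)
      assume "(e, i) \<notin> S"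
      then obtain h where "h \<in> J" "h \<le> i" "(h, e) \<in> S" using J[OF S(1,2) _ S(3,4)] S(5,6) j(3) by auto
      then show False using least[of h] S(5,7) by (cases "h = j") auto
    qed
    \<comment> \<open>Narrowness enters here. It follows that \<open>t < j < f\<close> and that
      \<open>f\<close> but not \<open>e\<close> is a descendant of \<open>t\<close>. The descendants
      of \<open>t\<close> form a chain, so \<open>j\<close> lies on the path from \<open>e\<close>
      to \<open>f\<close>, where \<open>e\<close> is on top.\<close>
    have one: False
      if S: "search S" "inversions S \<subseteq> inversions R" "(e, f) \<in> S" "(e, t) \<in> S" "(j, e) \<in> S"
        and eR: "(e, j) \<in> R" for S
    proof -
      have "(j, t) \<in> R" using subsetD[OF S(2), of "(t, j)"] search_trans[OF S(1,5,4)] j(2) by simp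
      then have "t \<noteq> f" using ef(3)[OF eR] by auto
      have jf: "(j, f) \<in> S" using search_trans[OF S(1,5,3)] .
      then have "\<not> f < j" using subsetD[OF S(2), of "(f, j)"] ef(3)[OF eR] by auto
      moreover have "j \<noteq> f" using jf search_irrefl[OF S(1)] by auto
      ultimately have "j < f" by simp
      have st: "sep t f e" using t(1) \<open>t \<noteq> f\<close> \<open>t \<noteq> e\<close> by (auto simp: btw_def)
      moreover have "\<not> (anc t e \<and> \<not> anc t f)"
        using anc_interval[of t e f] j(2) \<open>j < f\<close> R(3) ef(1) by (auto simp: E_def)
      ultimately have tf: "anc t f" "\<not> anc t e" by (auto simp: sep_def)
      then have "anc t j" using anc_interval[of t f j] j(2) \<open>j < f\<close> ef(2) by (auto simp: E_def)
      then have "anc j f"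
        using narrow_chain[OF assms(1) _ tf(1)] \<open>j < f\<close> ef not_anc_n[OF tf(2)] te by (auto simp: E_def)
      then have "btw j e f" using j(5) by (auto simp: btw_def sep_def)
      then have "(e, j) \<in> S" using search_btw[OF S(1,3)] j(3) by blast
      then show False using search_asym[OF S(1)] S(5) by blast
    qed
    \<comment> \<open>If \<open>j\<close> were above \<open>e\<close> in only one of the two
      relations, minimality of \<open>j\<close> would put \<open>e\<close> above \<open>j\<close> in
      the other, hence in \<open>R\<close>, which \<open>one\<close> excludes.\<close>
    have both: "(j, e) \<in> X \<and> (j, e) \<in> Y"
    proof (rule ccontr)
      assume "\<not> ?thesis"
      then consider "(j, e) \<in> X" "(j, e) \<notin> Y" | "(j, e) \<in> Y" "(j, e) \<notin> X"
        using jJ by (auto simp: J_def)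
      then show False
      proof cases
        case 1
        then have "(e, j) \<in> Y" using above[OF Y(1) Yt] j by auto
        then show False using one[OF X Xt 1(1)] subsetD[OF Y(2), of "(j, e)"] j(3) by auto
      next
        case 2
        then have "(e, j) \<in> X" using above[OF X(1) Xt] j by auto
        then show False using one[OF Y Yt 2(1)] subsetD[OF X(2), of "(j, e)"] j(3) by auto
      qed
    qed
    have "ready C Q j" unfolding ready_def
    proof (intro conjI ballI impI)
      fix i assume i: "i \<in> Q" "i < j" "\<forall>h. btw h i j \<longrightarrow> h \<in> Q"
      have it: "h \<in> Q" if "btw h i t" for h using btw_split[OF that, of j] i(3) j(6) by blast
      have tj: "(t, j) \<in> C"
        using both Xt Yt j(2) search_trans[OF X(1), of j e t] search_trans[OF Y(1), of j e t]
        by (simp add: C_def)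
      consider "i < t" | "i = t" | "t < i" by linarith
      then show "(i, j) \<in> C"
      proof cases
        case 1
        then have "(i, t) \<in> C" using rt i(1) it unfolding ready_def by blast
        then show ?thesis using trC tj by blast
      next
        case 3
        then have "(e, i) \<in> X" "(e, i) \<in> Y"
          using above[OF X(1) Xt _ 3] above[OF Y(1) Yt _ 3] i(2) it by auto
        then show ?thesis
          using both i(2) search_trans[OF X(1), of j e i] search_trans[OF Y(1), of j e i]
          by (simp add: C_def)
      qed (use tj in simp)
    qed (rule j(1))
    with max j(2) show False by fastforce
  qed
  then show ?thesis using that Z inversions_greedy[OF \<sigma>] unfolding Z_def C_def by blast
qed

lemma tree_parent_flip:
  assumes "search R" "tree_parent R e f"
  shows "tree_parent (flip R e f) f e"
  unfolding tree_parent_def flip_iff[OF assms]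
  using assms(2) search_asym[OF assms(1)] search_irrefl[OF assms(1)] search_trans[OF assms(1)]
  unfolding tree_parent_def by blast

text \<open>The witness \<open>g\<close> is the last descendant of \<open>f\<close> that lies below \<open>f\<close> in \<open>R\<close>, or \<open>f\<close> itself if
  \<open>f\<close> is an ancestor of \<open>e\<close>.\<close>

lemma flip_witness:
  assumes narrow and R: "search R" "tree_parent R e f" "f < e"
  obtains g where "(e, g) \<in> R" "f \<le> g" "g < e" "anc f g" "anc f e \<Longrightarrow> g = f" "g = f \<or> (f, g) \<in> R"
    "\<And>X. \<lbrakk>search X; inversions (flip R e f) \<subseteq> inversions X; \<not> inversions R \<subseteq> inversions X\<rbrakk>
       \<Longrightarrow> (e, g) \<notin> X"
proof -
  have ef: "e \<in> E" "f \<in> E" "(e, f) \<in> R" "e \<noteq> f" "\<And>m. (e, m) \<in> R \<Longrightarrow> (m, f) \<notin> R"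
    using R(2,3) search_E[OF R(1)] by (auto simp: tree_parent_def)
  define G where "G = {x. anc f x \<and> (x = f \<or> (f, x) \<in> R)}"
  define g where "g = (if anc f e then f else Max G)"
  have finG: "finite G"
    by (rule finite_subset[of _ E]) (use ef(2) search_E[OF R(1)] in \<open>auto simp: G_def\<close>)
  have "f \<in> G" by (simp add: G_def)
  then have gG: "g \<in> G" using Max_in[OF finG] by (auto simp: g_def)
  have fg: "anc f g" "g = f \<or> (f, g) \<in> R" "f \<le> g" using gG anc_le by (auto simp: G_def)
  have gE: "g \<in> E" using fg(2) ef(2) search_E[OF R(1)] by auto
  have eg: "(e, g) \<in> R" using fg(2) ef(3) search_trans[OF R(1)] by blast
  have ge: "g < e"
  proof (cases "anc f e")
    case False
    then show ?thesis
      using anc_interval[OF fg(1), of e] R(3) gE fg(1) by (cases "e \<le> g") (auto simp: E_def)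
  qed (use R(3) in \<open>simp add: g_def\<close>)
  have "(e, g) \<notin> X"
    if X: "search X" "inversions (flip R e f) \<subseteq> inversions X" "\<not> inversions R \<subseteq> inversions X" for X
  proof
    assume "(e, g) \<in> X"
    from X(3) obtain x y where xy: "x < y" "(y, x) \<in> R" "(y, x) \<notin> X"
      by (auto simp: inversions_def)
    then have "y = e" "btw f e x"
      using subsetD[OF X(2), of "(x, y)"] inversions_flip[OF R] by auto
    note xy = xy[unfolded \<open>y = e\<close>]
    have "btw f e g" using fg(1) ge anc_le[of f e] unfolding g_def
      by (auto simp: btw_def sep_def split: if_splits)
    then have fX: "(e, f) \<in> X" using search_btw[OF X(1) \<open>(e, g) \<in> X\<close>] ef(4) by blast
    then have "x \<noteq> f" using xy by auto
    then have sx: "sep f e x" using \<open>btw f e x\<close> ef(4) by (auto simp: btw_def)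
    have fx: "(f, x) \<in> R"
    proof -
      have xE: "x \<in> E" using search_E[OF R(1)] xy by blast
      obtain s where s: "btw s f x" "\<And>h. btw h f x \<Longrightarrow> h \<noteq> s \<Longrightarrow> (s, h) \<in> R"
        using search_top[OF R(1) ef(2) xE] by blast
      have "btw s e x" using btw_shrink[OF \<open>btw f e x\<close> s(1)] .
      then have "s = e \<or> (e, s) \<in> R" using search_btw[OF R(1) xy(2)] by blast
      moreover have "s \<noteq> e" using btw_antisym[of e f x] s(1) \<open>btw f e x\<close> ef(4) by blast
      ultimately have "s = f" using s(2)[of f] ef(5) by blast
      then show ?thesis using s(2) \<open>x \<noteq> f\<close> by blast
    qed
    show False
    proof (cases "anc f e")
      case True
      then have "\<not> anc f x" using sx by (auto simp: sep_def)
      \<comment> \<open>\<open>x\<close> is outside the interval of descendants of \<open>f\<close>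
        and smaller than \<open>e\<close>, so it comes before \<open>f\<close>. The inversion of
        \<open>x\<close> and \<open>f\<close> survives the exchange and passes to
        \<open>X\<close>.\<close>
      then have "x < f"
        using anc_interval[OF True, of x] xy(1) ef(1) by (cases "f \<le> x") (auto simp: E_def)
      then have "(x, f) \<in> inversions (flip R e f)" using fx ef(4) inversions_flip[OF R] by auto
      then have "(f, x) \<in> X" using subsetD[OF X(2), of "(x, f)"] by simp
      then show False using search_trans[OF X(1) fX] xy(3) by blast
    next
      case False
      then have "anc f x" using sx by (auto simp: sep_def)
      then have "x \<le> g" using Max_ge[OF finG, of x] fx False by (simp add: g_def G_def)
      then have "anc x g"
        using narrow_chain[OF assms(1) \<open>anc f x\<close> fg(1)] not_anc_n[OF False] R(3) ef(1) gE
        by (auto simp: E_def)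
      moreover have "\<not> anc x e" using False \<open>anc f x\<close> anc_trans by blast
      ultimately have "btw x e g" by (auto simp: btw_def sep_def)
      then show False using search_btw[OF X(1) \<open>(e, g) \<in> X\<close>] xy by blast
    qed
  qed
  with that[OF eg fg(3) ge fg(1) _ fg(2)] show ?thesis by (auto simp: g_def)
qed

text \<open>The path from \<open>y\<close> to \<open>c\<close> leaves the descendants of
  \<open>h\<close> through \<open>h\<close>, which is therefore below \<open>c\<close>. This is the
  step that shortcuts chains of inversions.\<close>

lemma inversions_leave:
  assumes "search X" "(y, c) \<in> inversions X" "anc h y" "\<not> anc h c"
  shows "(h, c) \<in> inversions X"
proof -
  have "btw h c y" "h \<noteq> c" using assms(3,4) by (auto simp: btw_def sep_def)
  then have "(c, h) \<in> X" using search_btw[OF assms(1), of c y h] assms(2) by simp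
  then show ?thesis using anc_le[OF assms(3)] assms(2) by simp
qed

lemma chain_leaves:
  assumes "(c, e) \<in> U ^^ m" "anc h c" "\<not> anc h e" "\<And>x y. (x, y) \<in> U \<Longrightarrow> x < y"
  obtains y c' m' where "anc h y" "c \<le> y" "(y, c') \<in> U" "\<not> anc h c'" "(c', e) \<in> U ^^ m'" "m' < m"
  using assms(1-3)
proof (induction m arbitrary: c thesis)
  case (Suc m)
  obtain d where d: "(c, d) \<in> U" "(d, e) \<in> U ^^ m" using Suc.prems(2) by (meson relpow_Suc_D2)
  show ?case
  proof (cases "anc h d")
    case True
    then obtain y c' m' where "anc h y" "d \<le> y" "(y, c') \<in> U" "\<not> anc h c'" "(c', e) \<in> U ^^ m'" "m' < m"
      using Suc.IH[OF _ d(2)] Suc.prems(4) by metis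
    then show ?thesis using Suc.prems(1)[of y c' m'] assms(4)[OF d(1)] by auto
  next
    case False
    then show ?thesis using Suc.prems(1)[of c d m] Suc.prems(3) d by auto
  qed
qed auto

lemma chain_le: "(c, e) \<in> U ^^ m \<Longrightarrow> (\<And>x y. (x, y) \<in> U \<Longrightarrow> x < y) \<Longrightarrow> c \<le> (e::nat)"
proof (induction m arbitrary: c)
  case (Suc m)
  then show ?case by (meson relpow_Suc_D2 less_imp_le order_trans)
qed auto

text \<open>A chain of inversions of \<open>X\<close> and \<open>Y\<close> from \<open>g\<close> to \<open>e\<close> is shortened by replacing the part that
  runs through the descendants of an edge \<open>h\<close> by \<open>h\<close> itself.\<close>

lemma common_ascent:
  assumes narrow and R: "search R" "tree_parent R e f" "f < e"
    and X: "search X" "inversions (flip R e f) \<subseteq> inversions X" "\<not> inversions R \<subseteq> inversions X"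
    and Y: "search Y" "inversions (flip R e f) \<subseteq> inversions Y" "\<not> inversions R \<subseteq> inversions Y"
  shows "\<not> inversions R \<subseteq> (inversions X \<union> inversions Y)\<^sup>+"
proof
  assume sub: "inversions R \<subseteq> (inversions X \<union> inversions Y)\<^sup>+"
  obtain g where g: "(e, g) \<in> R" "f \<le> g" "g < e" "anc f g" "anc f e \<Longrightarrow> g = f" "g = f \<or> (f, g) \<in> R"
    and gX: "(e, g) \<notin> X" and gY: "(e, g) \<notin> Y"
    using flip_witness[OF assms(1) R] X Y by metis
  define R' where "R' = flip R e f"
  have R': "search R'" using search_flip by (simp add: R'_def)
  have p': "tree_parent R' f e" using tree_parent_flip[OF R(1,2)] by (simp add: R'_def)
  have ef: "e \<in> E" "f \<in> E" "(e, f) \<in> R" "e \<noteq> f" "(f, e) \<in> R'"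
    using R(2,3) search_E[OF R(1)] p' by (auto simp: tree_parent_def)
  have below_top: "h = f \<or> (h, f) \<in> R'" if "(h, e) \<in> R'" for h
    using p' search_forest[OF R' that ef(5)] that by (auto simp: tree_parent_def)
  have fg: "g = f \<or> (f, g) \<in> R'" using g(6) ef(4) flip_iff[OF R(1,2)] by (auto simp: R'_def)
  define U where "U = inversions X \<union> inversions Y"
  have U_less: "x < y" if "(x, y) \<in> U" for x y using that by (auto simp: U_def)
  have U_leave: "(h, c) \<in> U" if "(y, c) \<in> U" "anc h y" "\<not> anc h c" for h y c
    using inversions_leave X(1) Y(1) that by (auto simp: U_def simp del: inversions_iff)
  \<comment> \<open>\<open>ok c\<close> places \<open>c\<close> after \<open>f\<close>, and after
    all descendants of \<open>f\<close> unless \<open>e\<close> is among them. Increasing chains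
    that end at \<open>e\<close> keep this property.\<close>
  define ok where "ok c \<longleftrightarrow> f < c \<and> (anc f c \<longrightarrow> anc f e)" for c
  have ok_mono: "ok d" if "ok c" "c < d" "d \<le> e" for c d
    using that anc_interval[of f d c] ef(1) by (auto simp: ok_def E_def)
  \<comment> \<open>The allowed starting points of a chain: \<open>g\<close>, and edges above
    \<open>f\<close> in the exchanged relation, which form inversions with \<open>g\<close>
    there.\<close>
  define W where "W = {w. w = g \<or> ok w \<and> (w, f) \<in> R'}"
  have W: "(g, w) \<in> inversions R'" if "w \<in> W" "w \<noteq> g" for w
  proof -
    have w: "ok w" "(w, f) \<in> R'" using that by (auto simp: W_def)
    then have "(w, g) \<in> R'" using fg search_trans[OF R'] by blast
    moreover have "w \<le> n" using w(2) search_E[OF R'] by (auto simp: E_def)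
    then have "g < w"
      using w(1) g(2,4,5) anc_interval[OF g(4), of w] that(2) g(3) ef(1)
      by (cases "anc f e"; cases "w \<le> g") (auto simp: ok_def E_def)
    ultimately show ?thesis by simp
  qed
  have no_chain: False if "w \<in> W" "(w, c) \<in> U" "ok c" "(c, e) \<in> U ^^ m" for w c m
    using that
  proof (induction m arbitrary: w c rule: less_induct)
    case (less m)
    \<comment> \<open>\<open>S\<close> is the relation among \<open>X\<close> and \<open>Y\<close>
      that contains the first step. It puts \<open>c\<close> above \<open>g\<close> but not
      \<open>e\<close> above \<open>g\<close>, so the chain has not yet arrived at
      \<open>e\<close>.\<close>
    obtain S where S: "search S" "inversions R' \<subseteq> inversions S" "(w, c) \<in> inversions S" "(e, g) \<notin> S"
      using less.prems(2) X Y gX gY unfolding U_def R'_def by blast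
    have gc: "(c, g) \<in> S"
    proof (cases "w = g")
      case False
      then have "(g, w) \<in> inversions S" using W less.prems(1) S(2) by blast
      then show ?thesis using S(3) search_trans[OF S(1)] by auto
    qed (use S(3) in auto)
    have "c \<noteq> e" using gc S(4) by auto
    moreover have "c \<le> e" using chain_le[OF less.prems(4)] U_less by blast
    ultimately have "c < e" by simp
    have "m \<noteq> 0" using less.prems(4) \<open>c \<noteq> e\<close> by (cases m) auto
    then obtain m1 d where d: "m = Suc m1" "(c, d) \<in> U" "(d, e) \<in> U ^^ m1"
      using less.prems(4) by (metis not0_implies_Suc relpow_Suc_D2)
    have "f < c" using less.prems(3) by (simp add: ok_def)
    show False
    proof (cases "(c, f) \<in> R'")
      case True
      have "d \<le> e" using chain_le[OF d(3)] U_less by blast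
      then show False
        using less.IH[of m1 c d] d True less.prems(3) ok_mono[OF less.prems(3) U_less[OF d(2)]]
        by (auto simp: W_def)
    next
      case False
      have cE: "c \<in> E" using search_E[OF S(1) gc] by simp
      have "(e, c) \<notin> S" using search_trans[OF S(1) _ gc] S(4) by blast
      then have "(e, c) \<notin> R'" using subsetD[OF S(2), of "(c, e)"] \<open>c < e\<close> by auto
      moreover have "(c, e) \<notin> R'" using below_top[of c] False \<open>f < c\<close> by auto
      \<comment> \<open>As \<open>c\<close> and \<open>e\<close> are incomparable, some edge
        \<open>h\<close> above both separates them. It turns out to lie in \<open>W\<close>, with
        \<open>c\<close> but not \<open>e\<close> as a descendant, so it can replace the part of the
        chain among its descendants.\<close>
      ultimately obtain h where h: "sep h c e" "(h, c) \<in> R'" "(h, e) \<in> R'"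
        using search_incomparable[OF R' cE ef(1) \<open>c \<noteq> e\<close>] by metis
      have "h \<noteq> f"
        using h(1) less.prems(3) anc_interval[of f e c] \<open>f < c\<close> \<open>c < e\<close> ef(1)
        by (auto simp: sep_def ok_def E_def)
      then have hf: "(h, f) \<in> R'" using below_top h(3) by blast
      have "\<not> btw h f e" using search_btw[OF R' ef(5) _ \<open>h \<noteq> f\<close>] search_asym[OF R' hf] by blast
      then have hfe: "anc h f \<longleftrightarrow> anc h e" by (auto simp: btw_def sep_def)
      have hc: "anc h c" "\<not> anc h e"
        using h(1) hfe anc_interval[of h e c] anc_le[of h f] \<open>f < c\<close> \<open>c < e\<close> ef(1)
        by (auto simp: sep_def E_def)
      have "f < h"
        using anc_interval[OF hc(1), of f] hc(2) hfe \<open>f < c\<close> cE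
        by (cases "h \<le> f") (auto simp: E_def)
      then have hW: "h \<in> W"
        using hf less.prems(3) hc(1) anc_trans[of h c f] by (auto simp: W_def ok_def)
      obtain y c' m' where y: "anc h y" "c \<le> y" "(y, c') \<in> U" "\<not> anc h c'" "(c', e) \<in> U ^^ m'" "m' < m"
        using chain_leaves[OF less.prems(4) hc] U_less by metis
      have "c' \<le> e" using chain_le[OF y(5)] U_less by blast
      then have "ok c'" using ok_mono[OF less.prems(3), of c'] y(2) U_less[OF y(3)] by auto
      then show False using less.IH[OF y(6) hW U_leave[OF y(3,1,4)] _ y(5)] by blast
    qed
  qed
  have "(g, e) \<in> U\<^sup>+" using sub g(1,3) by (auto simp: U_def)
  then obtain c where "(g, c) \<in> U" "(c, e) \<in> U\<^sup>*" by (meson tranclD)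
  then obtain m where c: "(g, c) \<in> U" "(c, e) \<in> U ^^ m" by (meson rtrancl_imp_relpow)
  have gW: "g \<in> W" by (simp add: W_def)
  have "g < c" using U_less c(1) by blast
  show False
  proof (cases "ok c")
    case True
    then show False using no_chain gW c by blast
  next
    case False
    then have fc: "anc f c" "\<not> anc f e" using \<open>g < c\<close> g(2) by (auto simp: ok_def)
    \<comment> \<open>The chain has to leave the descendants of \<open>f\<close>. By narrowness
      \<open>g\<close> is an ancestor of the vertex \<open>y\<close> where this happens, so one step
      from \<open>g\<close> replaces the initial part.\<close>
    obtain y c' m' where y: "anc f y" "c \<le> y" "(y, c') \<in> U" "\<not> anc f c'" "(c', e) \<in> U ^^ m'"
      using chain_leaves[OF c(2) fc] U_less by metis
    have "c' \<le> e" "y < c'" using chain_le[OF y(5)] U_less y(3) by blast+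
    then have "anc g y"
      using narrow_chain[OF assms(1) g(4) y(1)] y(2) \<open>g < c\<close> not_anc_n[OF fc(2)] R(3) ef(1)
      by (auto simp: E_def)
    moreover have "\<not> anc g c'" using y(4) g(4) anc_trans by blast
    ultimately have "(g, c') \<in> U" using U_leave y(3) by blast
    moreover have "ok c'" using y(4) g(2) \<open>g < c\<close> y(2) \<open>y < c'\<close> by (auto simp: ok_def)
    ultimately show False using no_chain gW y(5) by blast
  qed
qed

end

section \<open>Semidistributivity\<close>

context plane_preorder_tree
begin

abbreviation tinv :: "nat set set \<Rightarrow> (nat \<times> nat) set" where
  "tinv N \<equiv> inversions (search_of N)"

lemma carrier_MN: "N \<in> carrier (MN T) \<longleftrightarrow> maximal_nesting T N"
  by (simp add: MN_def)

lemma search_carrier: "N \<in> carrier (MN T) \<Longrightarrow> search (search_of N)"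
  by (simp add: carrier_MN search_search_of)

lemma le_MN:
  assumes "N \<in> carrier (MN T)" "N' \<in> carrier (MN T)"
  shows "N \<sqsubseteq>\<^bsub>MN T\<^esub> N' \<longleftrightarrow> tinv N' \<subseteq> tinv N"
  using nesting_moves_iff[of N N'] assms by (simp add: MN_def)

lemma tinv_inject:
  assumes "N \<in> carrier (MN T)" "N' \<in> carrier (MN T)" "tinv N = tinv N'"
  shows "N = N'"
proof -
  have "search_of N = search_of N'" using inversions_inject search_carrier assms by blast
  then show ?thesis using nest_search_of assms(1,2) by (metis carrier_MN)
qed

lemma nest_carrier: "search R \<Longrightarrow> N \<in> carrier (MN T) \<Longrightarrow> nest R \<in> carrier (MN T)"
  unfolding carrier_MN using maximal_nest[of R] E_nonempty[of N] maximal_nesting_def[of T N] by blast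

lemma tinv_nest: "search R \<Longrightarrow> tinv (nest R) = inversions R"
  by (simp add: search_of_nest)

lemma join_exists:
  assumes N: "N \<in> carrier (MN T)" "N' \<in> carrier (MN T)"
  obtains M where "M \<in> carrier (MN T)" "tinv M \<subseteq> tinv N \<inter> tinv N'"
    "\<And>R. search R \<Longrightarrow> inversions R \<subseteq> tinv N \<inter> tinv N' \<Longrightarrow> inversions R \<subseteq> tinv M"
proof -
  have "trans (tinv N \<inter> tinv N')" using trans_inversions search_carrier N trans_Int by blast
  then obtain R where "search R" "inversions R \<subseteq> tinv N \<inter> tinv N'"
    "\<And>S. search S \<Longrightarrow> inversions S \<subseteq> tinv N \<inter> tinv N' \<Longrightarrow> inversions S \<subseteq> inversions R"
    using exists_interior by metis
  then show ?thesis using that[of "nest R"] nest_carrier[OF _ N(1)] tinv_nest by simp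
qed

text \<open>The closure contains both inversion sets, so its interior does as well; being
  transitive, the interior is then the whole closure.\<close>

lemma meet_exists:
  assumes N: "N \<in> carrier (MN T)" "N' \<in> carrier (MN T)"
  obtains M where "M \<in> carrier (MN T)" "tinv N \<union> tinv N' \<subseteq> tinv M"
    "tinv M \<subseteq> (tinv N \<union> tinv N')\<^sup>+"
proof -
  let ?C = "(tinv N \<union> tinv N')\<^sup>+"
  obtain R where R: "search R" "inversions R \<subseteq> ?C"
    "\<And>S. search S \<Longrightarrow> inversions S \<subseteq> ?C \<Longrightarrow> inversions S \<subseteq> inversions R"
    using exists_interior[of ?C] trans_trancl by metis
  have "tinv N \<subseteq> ?C" "tinv N' \<subseteq> ?C" by (auto simp del: inversions_iff)
  then have "tinv N \<union> tinv N' \<subseteq> inversions R" using R(3) search_carrier N by (simp del: inversions_iff)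
  then show ?thesis using that[of "nest R"] nest_carrier[OF R(1) N(1)] tinv_nest[OF R(1)] R(2) by simp
qed

lemma lattice_MN: "lattice (MN T)"
proof
  show "\<exists>s. least (MN T) s (Upper (MN T) {x, y})" if N: "x \<in> carrier (MN T)" "y \<in> carrier (MN T)" for x y
  proof -
    obtain M where M: "M \<in> carrier (MN T)" "tinv M \<subseteq> tinv x \<inter> tinv y"
      "\<And>R. search R \<Longrightarrow> inversions R \<subseteq> tinv x \<inter> tinv y \<Longrightarrow> inversions R \<subseteq> tinv M"
      using join_exists[OF N] by metis
    have "least (MN T) M (Upper (MN T) {x, y})"
    proof (rule least_UpperI)
      fix z assume "z \<in> Upper (MN T) {x, y}"
      then have z: "z \<in> carrier (MN T)" "x \<sqsubseteq>\<^bsub>MN T\<^esub> z" "y \<sqsubseteq>\<^bsub>MN T\<^esub> z" using N by (auto simp: Upper_def)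
      then have "tinv z \<subseteq> tinv x \<inter> tinv y" using le_MN N by simp
      then show "M \<sqsubseteq>\<^bsub>MN T\<^esub> z" using M(3)[OF search_carrier[OF z(1)]] le_MN M(1) z(1) by simp
    next
      fix z assume "z \<in> {x, y}"
      then have "z \<in> carrier (MN T)" "tinv M \<subseteq> tinv z" using N M(2) by (auto simp del: inversions_iff)
      then show "z \<sqsubseteq>\<^bsub>MN T\<^esub> M" using le_MN M(1) by simp
    qed (use N M in auto)
    then show ?thesis ..
  qed
  show "\<exists>s. greatest (MN T) s (Lower (MN T) {x, y})" if N: "x \<in> carrier (MN T)" "y \<in> carrier (MN T)" for x y
  proof -
    obtain M where M: "M \<in> carrier (MN T)" "tinv x \<union> tinv y \<subseteq> tinv M"
      "tinv M \<subseteq> (tinv x \<union> tinv y)\<^sup>+"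
      using meet_exists[OF N] by metis
    have "greatest (MN T) M (Lower (MN T) {x, y})"
    proof (rule greatest_LowerI)
      fix z assume "z \<in> Lower (MN T) {x, y}"
      then have z: "z \<in> carrier (MN T)" "z \<sqsubseteq>\<^bsub>MN T\<^esub> x" "z \<sqsubseteq>\<^bsub>MN T\<^esub> y" using N by (auto simp: Lower_def)
      then have "tinv x \<union> tinv y \<subseteq> tinv z" using le_MN N by simp
      moreover have "(tinv z)\<^sup>+ = tinv z" using trans_inversions[OF search_carrier[OF z(1)]] by (rule trancl_id)
      ultimately have "(tinv x \<union> tinv y)\<^sup>+ \<subseteq> tinv z" using trancl_mono_subset by metis
      then show "z \<sqsubseteq>\<^bsub>MN T\<^esub> M" using le_MN M(1,3) z(1) by simp
    next
      fix z assume "z \<in> {x, y}"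
      then have "z \<in> carrier (MN T)" "tinv z \<subseteq> tinv M" using N M(2) by (auto simp del: inversions_iff)
      then show "M \<sqsubseteq>\<^bsub>MN T\<^esub> z" using le_MN M(1) by simp
    qed (use N M in auto)
    then show ?thesis ..
  qed
  show "x .=\<^bsub>MN T\<^esub> y"
    if "x \<sqsubseteq>\<^bsub>MN T\<^esub> y" "y \<sqsubseteq>\<^bsub>MN T\<^esub> x" "x \<in> carrier (MN T)" "y \<in> carrier (MN T)" for x y
    using tinv_inject[OF that(3,4)] le_MN that by (simp add: MN_def)
qed (auto simp: MN_def)

text \<open>If the two meets differ, a first move leads from the smaller towards the larger. Neither
  \<open>y\<close> nor \<open>z\<close> is above its target, since otherwise the target would lie
  below \<open>x \<sqinter> y\<close>. By \<open>common_descent\<close> their join is not above it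
  either.\<close>

lemma meet_semidistributive:
  assumes narrow shows "meet_semidistributive_lattice (MN T)"
proof -
  interpret lattice "MN T" by (rule lattice_MN)
  show ?thesis
  proof
    fix x y z assume xyz: "x \<in> carrier (MN T)" "y \<in> carrier (MN T)" "z \<in> carrier (MN T)"
      and eq: "x \<sqinter>\<^bsub>MN T\<^esub> y = x \<sqinter>\<^bsub>MN T\<^esub> z"
    let ?w = "x \<sqinter>\<^bsub>MN T\<^esub> y" and ?j = "y \<squnion>\<^bsub>MN T\<^esub> z"
    let ?u = "x \<sqinter>\<^bsub>MN T\<^esub> ?j"
    have c: "?w \<in> carrier (MN T)" "?j \<in> carrier (MN T)" "?u \<in> carrier (MN T)" using xyz by auto
    have w: "tinv x \<subseteq> tinv ?w" "tinv y \<subseteq> tinv ?w" "tinv z \<subseteq> tinv ?w"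
      using meet_left[OF xyz(1,2)] meet_right[OF xyz(1,2)] meet_right[OF xyz(1,3)]
        le_MN[OF c(1)] xyz by (simp_all add: eq)
    have u: "tinv x \<subseteq> tinv ?u" "tinv ?j \<subseteq> tinv ?u"
      using meet_left[OF xyz(1) c(2)] meet_right[OF xyz(1) c(2)] le_MN c xyz by simp_all
    have "tinv ?u \<subseteq> tinv ?w"
    proof -
      have "?w \<sqsubseteq>\<^bsub>MN T\<^esub> ?j"
        using le_trans[OF meet_right[OF xyz(1,2)] join_left[OF xyz(2,3)]] c xyz by simp
      then have "?w \<sqsubseteq>\<^bsub>MN T\<^esub> ?u" using meet_le[OF meet_left[OF xyz(1,2)]] c xyz by simp
      then show ?thesis using le_MN c by simp
    qed
    show "?w = ?u"
    proof (rule ccontr)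
      assume "?w \<noteq> ?u"
      then have "search_of ?w \<noteq> search_of ?u" using tinv_inject c by metis
      then obtain e f where ef: "tree_parent (search_of ?w) e f" "f < e"
          "tinv ?u \<subseteq> inversions (flip (search_of ?w) e f)"
        using flip_towards[OF search_carrier search_carrier \<open>tinv ?u \<subseteq> tinv ?w\<close>] c by metis
      let ?F = "flip (search_of ?w) e f"
      have sw: "search (search_of ?w)" using search_carrier c by blast
      have F: "inversions ?F \<subset> tinv ?w" using flip_psubset[OF sw ef(1,2)] .
      have fe: "(f, e) \<notin> inversions ?F"
        unfolding inversions_flip[OF sw ef(1,2)] by (simp del: inversions_iff)
      have N1: "nest ?F \<in> carrier (MN T)" "tinv (nest ?F) = inversions ?F"
        using nest_carrier[OF search_flip c(1)] tinv_nest[OF search_flip] by auto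
      \<comment> \<open>As \<open>s\<close> is not above the exchanged nesting, it has one of the
        inversions lost there, and path closure then yields \<open>(e, f)\<close>.\<close>
      have in_s: "(e, f) \<in> search_of s"
        if s: "s \<in> carrier (MN T)" "x \<sqinter>\<^bsub>MN T\<^esub> s = ?w" "tinv s \<subseteq> tinv ?w" for s
      proof -
        have "\<not> tinv s \<subseteq> inversions ?F"
        proof
          assume "tinv s \<subseteq> inversions ?F"
          moreover have "tinv x \<subseteq> inversions ?F" using u(1) ef(3) by blast
          ultimately have "nest ?F \<sqsubseteq>\<^bsub>MN T\<^esub> ?w"
            using meet_le[of "nest ?F" x s] le_MN N1 xyz(1) s by simp
          then show False using le_MN[OF N1(1) c(1)] N1(2) F by simp
        qed
        then obtain i k where ik: "(i, k) \<in> tinv s" "(i, k) \<notin> inversions ?F"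
          by (auto simp del: inversions_iff)
        then have "k = e" "btw f e i" using s(3) unfolding inversions_flip[OF sw ef(1,2)] by blast+
        then show ?thesis
          using search_btw[OF search_carrier[OF s(1)], of e i f] ik(1) ef(2) by simp
      qed
      obtain Z where Z: "search Z" "inversions Z \<subseteq> tinv y \<inter> tinv z" "(e, f) \<in> Z"
        using common_descent[OF assms sw ef(1,2) search_carrier[OF xyz(2)] w(2) in_s[OF xyz(2) HOL.refl w(2)]
            search_carrier[OF xyz(3)] w(3) in_s[OF xyz(3) eq[symmetric] w(3)]] by metis
      have nZ: "nest Z \<in> carrier (MN T)" "tinv (nest Z) = inversions Z"
        using nest_carrier[OF Z(1) c(1)] tinv_nest[OF Z(1)] by auto
      then have "?j \<sqsubseteq>\<^bsub>MN T\<^esub> nest Z" using join_le[of y "nest Z" z] le_MN xyz Z(2) by simp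
      then have "inversions Z \<subseteq> tinv ?j" using le_MN[OF c(2) nZ(1)] nZ(2) by simp
      moreover have "(f, e) \<in> inversions Z" using Z(3) ef(2) by simp
      ultimately show False using u(2) ef(3) fe by blast
    qed
  qed
qed

text \<open>Here the last move into \<open>x \<squnion> y\<close> is used: neither \<open>y\<close>
  nor \<open>z\<close> is below its source, so by \<open>common_ascent\<close> their meet is not
  below it.\<close>

lemma join_semidistributive:
  assumes narrow shows "join_semidistributive_lattice (MN T)"
proof -
  interpret lattice "MN T" by (rule lattice_MN)
  show ?thesis
  proof
    fix x y z assume xyz: "x \<in> carrier (MN T)" "y \<in> carrier (MN T)" "z \<in> carrier (MN T)"
      and eq: "x \<squnion>\<^bsub>MN T\<^esub> y = x \<squnion>\<^bsub>MN T\<^esub> z"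
    let ?w = "x \<squnion>\<^bsub>MN T\<^esub> y" and ?m = "y \<sqinter>\<^bsub>MN T\<^esub> z"
    let ?u = "x \<squnion>\<^bsub>MN T\<^esub> ?m"
    have c: "?w \<in> carrier (MN T)" "?m \<in> carrier (MN T)" "?u \<in> carrier (MN T)" using xyz by auto
    have w: "tinv ?w \<subseteq> tinv x" "tinv ?w \<subseteq> tinv y" "tinv ?w \<subseteq> tinv z"
      using join_left[OF xyz(1,2)] join_right[OF xyz(1,2)] join_right[OF xyz(1,3)]
        le_MN[OF _ c(1)] xyz by (simp_all add: eq)
    have u: "tinv ?u \<subseteq> tinv x" "tinv ?u \<subseteq> tinv ?m"
      using join_left[OF xyz(1) c(2)] join_right[OF xyz(1) c(2)] le_MN c xyz by simp_all
    have "tinv ?w \<subseteq> tinv ?u"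
    proof -
      have "?m \<sqsubseteq>\<^bsub>MN T\<^esub> ?w"
        using le_trans[OF meet_left[OF xyz(2,3)] join_right[OF xyz(1,2)]] c xyz by simp
      then have "?u \<sqsubseteq>\<^bsub>MN T\<^esub> ?w" using join_le[OF join_left[OF xyz(1,2)]] c xyz by simp
      then show ?thesis using le_MN c by simp
    qed
    show "?w = ?u"
    proof (rule ccontr)
      assume "?w \<noteq> ?u"
      then have "search_of ?u \<noteq> search_of ?w" using tinv_inject c by metis
      then obtain S e f where S: "search S" "tree_parent S e f" "f < e" "search_of ?w = flip S e f"
          "inversions S \<subseteq> tinv ?u"
        using flip_sequence[OF search_carrier search_carrier \<open>tinv ?w \<subseteq> tinv ?u\<close>] c by metis
      have wS: "tinv ?w \<subset> inversions S" using flip_psubset[OF S(1-3)] S(4) by simp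
      have N: "nest S \<in> carrier (MN T)" "tinv (nest S) = inversions S"
        using nest_carrier[OF S(1) c(1)] tinv_nest[OF S(1)] by auto
      have not_sub: "\<not> inversions S \<subseteq> tinv s"
        if s: "s \<in> carrier (MN T)" "x \<squnion>\<^bsub>MN T\<^esub> s = ?w" for s
      proof
        assume "inversions S \<subseteq> tinv s"
        moreover have "inversions S \<subseteq> tinv x" using u(1) S(5) by blast
        ultimately have "?w \<sqsubseteq>\<^bsub>MN T\<^esub> nest S"
          using join_le[of x "nest S" s] le_MN N xyz(1) s by simp
        then show False using le_MN[OF c(1) N(1)] N(2) wS by simp
      qed
      have "\<not> inversions S \<subseteq> (tinv y \<union> tinv z)\<^sup>+"
        using common_ascent[OF assms S(1-3) search_carrier[OF xyz(2)] _ not_sub[OF xyz(2) HOL.refl]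
            search_carrier[OF xyz(3)] _ not_sub[OF xyz(3) eq[symmetric]]] w(2,3) S(4) by simp
      moreover obtain M where M: "M \<in> carrier (MN T)" "tinv y \<union> tinv z \<subseteq> tinv M"
        "tinv M \<subseteq> (tinv y \<union> tinv z)\<^sup>+"
        using meet_exists[OF xyz(2,3)] by metis
      have "M \<sqsubseteq>\<^bsub>MN T\<^esub> ?m" using meet_le[of M y z] le_MN M(1,2) xyz by simp
      then have "tinv ?m \<subseteq> tinv M" using le_MN M(1) c by simp
      ultimately show False using S(5) u(2) M(3) by blast
    qed
  qed
qed

end

text \<open>The four edges \<open>a\<close>, \<open>b\<close>, \<open>c\<close>, \<open>d\<close> form the tree \<open>Y\<close> after all other edges on the path
  between \<open>a\<close> and \<open>d\<close> have been contracted; placing the other edges last in a rank has that effect.\<close>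

locale broad_preorder_tree = plane_preorder_tree +
  fixes a b c d :: nat
  assumes abcd: "a < b" "b < c" "c < d" "d = n" "a \<in> E" "par b = a" "par c = a" "\<not> anc a d"
begin

lemma in_E: "a \<in> E" "b \<in> E" "c \<in> E" "d \<in> E"
  using abcd by (auto simp: E_def)

lemma anc_abcd: "anc a b" "anc a c" "\<not> anc b d" "\<not> anc c d" "\<not> anc b a" "\<not> anc c a"
proof -
  show *: "anc a b" "anc a c" using abcd in_E by (auto simp: anc_par)
  show "\<not> anc b d" "\<not> anc c d" using anc_trans[OF _ *(1)] anc_trans[OF _ *(2)] abcd(8) by auto
  show "\<not> anc b a" "\<not> anc c a" using anc_le[of b a] anc_le[of c a] abcd by auto
qed

text \<open>\<open>b\<close> and \<open>c\<close> are siblings, so no vertex lies below both, and a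
  path to \<open>d\<close> uses at most one of them.\<close>

lemma not_both: "k = d \<Longrightarrow> btw b i k \<Longrightarrow> btw c i k \<Longrightarrow> False"
proof -
  assume "k = d" "btw b i k" "btw c i k"
  then have bc: "anc b i" "anc c i" using anc_abcd abcd by (auto simp: btw_def sep_def)
  have "\<not> anc b c" using anc_par[OF in_E(3)] abcd anc_abcd by auto
  moreover have "\<not> anc c b" using anc_le[of c b] abcd by auto
  ultimately show False using anc_linear[OF bc] by blast
qed

lemma btw_bc: "k = d \<Longrightarrow> btw b i k \<Longrightarrow> btw a i k" "k = d \<Longrightarrow> btw c i k \<Longrightarrow> btw a i k"
  using anc_abcd abcd anc_trans[of b i a] anc_trans[of c i a] by (auto simp: btw_def sep_def)

text \<open>A child of \<open>a\<close> is its only ancestor that is not an ancestor of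
  \<open>a\<close>, so here co-transitivity holds as for permutations.\<close>

lemma cotrans_abcd:
  assumes "search R" "(d, a) \<in> R" "x = b \<or> x = c" shows "(d, x) \<in> R \<or> (x, a) \<in> R"
proof (rule ccontr)
  assume no: "\<not> ?thesis"
  have x: "a < x" "x < d" "x \<in> E" "par x = a" using assms(3) abcd in_E by auto
  obtain h where h: "anc h x" "\<not> anc h a" "(h, a) \<in> R"
    using search_cotrans[OF assms(1,2) x(1,2)] no by metis
  then have "h = x" using anc_par[OF x(3), of h] x(4) by auto
  with h no show False by blast
qed

definition rank4 :: "nat \<Rightarrow> nat \<Rightarrow> nat \<Rightarrow> nat \<Rightarrow> (nat \<times> nat) set" where
  "rank4 p q r s =
     of_rank (\<lambda>x. if x = p then 0 else if x = q then 1 else if x = r then 2 else if x = s then 3 else 4 + x)"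

lemma search_rank4: "search (rank4 p q r s)"
  unfolding rank4_def by (rule search_of_rank) (auto simp: inj_on_def split: if_splits)

lemma inversions_rank4:
  assumes "distinct [p, q, r, s]"
  shows "(i, k) \<in> inversions (rank4 p q r s) \<longleftrightarrow> i \<in> E \<and> k \<in> E \<and> i < k \<and>
    (k = p \<or> k = q \<and> \<not> btw p i k \<or> k = r \<and> \<not> btw p i k \<and> \<not> btw q i k \<or>
     k = s \<and> \<not> btw p i k \<and> \<not> btw q i k \<and> \<not> btw r i k \<or>
     k \<notin> {p, q, r, s} \<and> (\<forall>h. btw h i k \<longrightarrow> h \<noteq> k \<longrightarrow> h \<notin> {p, q, r, s} \<and> k < h))"
proof -
  define \<sigma> :: "nat \<Rightarrow> nat" where
    "\<sigma> x = (if x = p then 0 else if x = q then 1 else if x = r then 2 else if x = s then 3 else 4 + x)" for x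
  have mem: "(i, k) \<in> inversions (rank4 p q r s) \<longleftrightarrow>
      i \<in> E \<and> k \<in> E \<and> i < k \<and> (\<forall>h. btw h i k \<longrightarrow> h \<noteq> k \<longrightarrow> \<sigma> k < \<sigma> h)"
    unfolding rank4_def \<sigma>_def[symmetric] by (auto simp: of_rank_iff btw_commute[of _ k i])
  have "\<sigma> p < \<sigma> h \<longleftrightarrow> h \<noteq> p" "\<sigma> q < \<sigma> h \<longleftrightarrow> h \<noteq> p \<and> h \<noteq> q"
    "\<sigma> r < \<sigma> h \<longleftrightarrow> h \<noteq> p \<and> h \<noteq> q \<and> h \<noteq> r"
    "\<sigma> s < \<sigma> h \<longleftrightarrow> h \<noteq> p \<and> h \<noteq> q \<and> h \<noteq> r \<and> h \<noteq> s"
    "k \<notin> {p, q, r, s} \<Longrightarrow> \<sigma> k < \<sigma> h \<longleftrightarrow> h \<notin> {p, q, r, s} \<and> k < h" for h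
    using assms by (auto simp: \<sigma>_def)
  note less = this
  consider "k = p" | "k = q" | "k = r" | "k = s" | "k \<notin> {p, q, r, s}" by blast
  then show ?thesis
  proof cases
    case 1
    then show ?thesis unfolding mem by (simp add: less)
  next
    case 2
    then have "(\<forall>h. btw h i k \<longrightarrow> h \<noteq> k \<longrightarrow> \<sigma> k < \<sigma> h) \<longleftrightarrow> \<not> btw p i k"
      using assms by (auto simp: less)
    then show ?thesis unfolding mem using 2 assms by simp
  next
    case 3
    then have "(\<forall>h. btw h i k \<longrightarrow> h \<noteq> k \<longrightarrow> \<sigma> k < \<sigma> h) \<longleftrightarrow> \<not> btw p i k \<and> \<not> btw q i k"
      using assms by (auto simp: less)
    then show ?thesis unfolding mem using 3 assms by simp
  next
    case 4
    then have "(\<forall>h. btw h i k \<longrightarrow> h \<noteq> k \<longrightarrow> \<sigma> k < \<sigma> h) \<longleftrightarrow>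
        \<not> btw p i k \<and> \<not> btw q i k \<and> \<not> btw r i k"
      using assms by (auto simp: less)
    then show ?thesis unfolding mem using 4 assms by simp
  next
    case 5
    have "(\<forall>h. btw h i k \<longrightarrow> h \<noteq> k \<longrightarrow> \<sigma> k < \<sigma> h) \<longleftrightarrow>
        (\<forall>h. btw h i k \<longrightarrow> h \<noteq> k \<longrightarrow> h \<notin> {p, q, r, s} \<and> k < h)"
      by (simp only: less(5)[OF 5])
    then show ?thesis unfolding mem using 5 by simp
  qed
qed

lemma not_btw_larger:
  assumes "i < k"
  shows "k = a \<Longrightarrow> \<not> btw b i k \<and> \<not> btw c i k \<and> \<not> btw d i k"
    "k = b \<Longrightarrow> \<not> btw c i k \<and> \<not> btw d i k" "k = c \<Longrightarrow> \<not> btw d i k"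
  using btw_less[of _ i k] assms abcd by fastforce+

lemma distinct_abcd:
  "a \<noteq> b" "a \<noteq> c" "a \<noteq> d" "b \<noteq> c" "b \<noteq> d" "c \<noteq> d" "b \<noteq> a" "c \<noteq> a" "d \<noteq> a" "c \<noteq> b" "d \<noteq> b" "d \<noteq> c"
  using abcd by auto

text \<open>These inversions, whose upper edge is not one of the four, are the same for every order
  of the four and play the same part in all comparisons.\<close>

definition low_edge :: "nat \<Rightarrow> nat \<Rightarrow> bool" where
  "low_edge i k \<longleftrightarrow>
     k \<notin> {a, b, c, d} \<and> (\<forall>h. btw h i k \<longrightarrow> h \<noteq> k \<longrightarrow> h \<notin> {a, b, c, d} \<and> k < h)"

lemma not_low_edge: "\<not> low_edge i a" "\<not> low_edge i b" "\<not> low_edge i c" "\<not> low_edge i d"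
  by (simp_all add: low_edge_def)

lemma inversions_rank4_abcd:
  assumes "set [p, q, r, s] = {a, b, c, d}" "distinct [p, q, r, s]"
  shows "(i, k) \<in> inversions (rank4 p q r s) \<longleftrightarrow> i \<in> E \<and> k \<in> E \<and> i < k \<and>
    (k = p \<or> k = q \<and> \<not> btw p i k \<or> k = r \<and> \<not> btw p i k \<and> \<not> btw q i k \<or>
     k = s \<and> \<not> btw p i k \<and> \<not> btw q i k \<and> \<not> btw r i k \<or>
     low_edge i k)"
proof -
  have eq: "{p, q, r, s} = {a, b, c, d}" using assms(1) by simp
  from inversions_rank4[OF assms(2), of i k, unfolded eq, folded low_edge_def] show ?thesis .
qed

lemma nest_MN: "search R \<Longrightarrow> nest R \<in> carrier (MN T)"
  using maximal_nest in_E(1) by (auto simp: carrier_MN)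

lemma le_nest_MN:
  assumes "search R" "search S" shows "nest R \<sqsubseteq>\<^bsub>MN T\<^esub> nest S \<longleftrightarrow> inversions S \<subseteq> inversions R"
  using le_MN[OF nest_MN nest_MN] assms tinv_nest by simp

lemma carrier_nest:
  assumes "N \<in> carrier (MN T)" obtains R where "search R" "N = nest R"
  using assms search_carrier nest_search_of by (metis carrier_MN)

text \<open>Write a nesting as the four edges from the top down: x = cdba, y = bdac, z = dabc. Both
  meets are w = dcba. But x is below the join of y and z: if the join had \<open>d\<close> above an
  edge at or beyond \<open>c\<close>, it would have \<open>d\<close> above \<open>a\<close>, so
  either \<open>d\<close> above \<open>b\<close>, which y forbids, or \<open>b\<close> above
  \<open>a\<close>, which z forbids. The pair \<open>(c, d)\<close> tells w from x.\<close>

lemma meet_not_semidistributive: "\<not> meet_semidistributive_lattice (MN T)"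
proof
  assume "meet_semidistributive_lattice (MN T)"
  then interpret meet_semidistributive_lattice "MN T" .
  let ?X = "rank4 c d b a" and ?Y = "rank4 b d a c" and ?Z = "rank4 d a b c" and ?W = "rank4 d c b a"
  note S = search_rank4
  let ?x = "nest ?X" and ?y = "nest ?Y" and ?z = "nest ?Z" and ?w = "nest ?W"
  note C = nest_MN[OF S]
  have X: "(i, k) \<in> inversions ?X \<longleftrightarrow> i \<in> E \<and> k \<in> E \<and> i < k \<and>
      (k = a \<or> k = b \<or> k = c \<or> k = d \<and> \<not> btw c i k \<or> low_edge i k)" for i k
    using not_btw_larger[of i k]
    by (subst inversions_rank4_abcd; (blast | use distinct_abcd in auto))
  have Y: "(i, k) \<in> inversions ?Y \<longleftrightarrow> i \<in> E \<and> k \<in> E \<and> i < k \<and>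
      (k = a \<or> k = b \<or> k = c \<and> \<not> btw a i k \<and> \<not> btw b i k \<or> k = d \<and> \<not> btw b i k \<or> low_edge i k)" for i k
    using not_btw_larger[of i k]
    by (subst inversions_rank4_abcd; (blast | use distinct_abcd in auto))
  have Z: "(i, k) \<in> inversions ?Z \<longleftrightarrow> i \<in> E \<and> k \<in> E \<and> i < k \<and>
      (k = a \<or> k = b \<and> \<not> btw a i k \<or> k = c \<and> \<not> btw a i k \<and> \<not> btw b i k \<or> k = d \<or> low_edge i k)" for i k
    using not_btw_larger[of i k]
    by (subst inversions_rank4_abcd; (blast | use distinct_abcd in auto))
  have W: "(i, k) \<in> inversions ?W \<longleftrightarrow> i \<in> E \<and> k \<in> E \<and> i < k \<and>
      (k = a \<or> k = b \<or> k = c \<or> k = d \<or> low_edge i k)" for i k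
    using not_btw_larger[of i k]
    by (subst inversions_rank4_abcd; (blast | use distinct_abcd in auto))
  have W_le: "inversions ?X \<subseteq> inversions ?W" "inversions ?Y \<subseteq> inversions ?W" "inversions ?Z \<subseteq> inversions ?W"
    by (rule subrelI, unfold X Y Z W, blast)+
  have le_W: "inversions ?W \<subseteq> inversions ?X \<union> inversions ?Y" "inversions ?W \<subseteq> inversions ?X \<union> inversions ?Z"
    by (rule subrelI, unfold Un_iff X Y Z W, use not_both in blast)+
  have meet: "?x \<sqinter>\<^bsub>MN T\<^esub> nest R = ?w"
    if R: "search R" "inversions R \<subseteq> inversions ?W" "inversions ?W \<subseteq> inversions ?X \<union> inversions R" for R
  proof (rule le_antisym)
    obtain M where M: "search M" "?x \<sqinter>\<^bsub>MN T\<^esub> nest R = nest M"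
      using carrier_nest[OF meet_closed] C nest_MN R(1) by metis
    have "nest M \<sqsubseteq>\<^bsub>MN T\<^esub> ?x" "nest M \<sqsubseteq>\<^bsub>MN T\<^esub> nest R"
      using meet_left[of ?x "nest R"] meet_right[of ?x "nest R"] C nest_MN R(1) M by auto
    then show "?x \<sqinter>\<^bsub>MN T\<^esub> nest R \<sqsubseteq>\<^bsub>MN T\<^esub> ?w"
      using R M(1) S by (auto simp: le_nest_MN M(2) simp del: inversions_iff)
    show "?w \<sqsubseteq>\<^bsub>MN T\<^esub> ?x \<sqinter>\<^bsub>MN T\<^esub> nest R"
      using meet_le[of ?w ?x "nest R"] le_nest_MN S R(1,2) C nest_MN W_le(1) by simp
  qed (use C nest_MN R(1) in auto)
  have "?x \<sqinter>\<^bsub>MN T\<^esub> ?y = ?w" "?x \<sqinter>\<^bsub>MN T\<^esub> ?z = ?w"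
    using meet[OF S] W_le(2,3) le_W by auto
  then have eq: "?x \<sqinter>\<^bsub>MN T\<^esub> (?y \<squnion>\<^bsub>MN T\<^esub> ?z) = ?w"
    using meet_semidistrib[OF C C C, of c d b a b d a c d a b c] by simp
  obtain J where J: "search J" "?y \<squnion>\<^bsub>MN T\<^esub> ?z = nest J"
    using carrier_nest[OF join_closed] C by metis
  have "?y \<sqsubseteq>\<^bsub>MN T\<^esub> nest J" "?z \<sqsubseteq>\<^bsub>MN T\<^esub> nest J"
    using join_left[of ?y ?z] join_right[of ?y ?z] C J(2) by auto
  then have JY: "inversions J \<subseteq> inversions ?Y" and JZ: "inversions J \<subseteq> inversions ?Z"
    using le_nest_MN S J(1) by auto
  have no: "\<not> btw c i d" if "(d, i) \<in> J" for i
  proof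
    assume i: "btw c i d"
    have "(d, a) \<in> J" using search_btw[OF J(1) that, of a] btw_bc(2)[OF HOL.refl i] distinct_abcd btw_commute by blast
    then consider "(d, b) \<in> J" | "(b, a) \<in> J" using cotrans_abcd[OF J(1)] by blast
    then show False
    proof cases
      case 1
      then have "(b, d) \<in> inversions ?Y" using subsetD[OF JY, of "(b, d)"] abcd by auto
      then show False using distinct_abcd unfolding Y by (auto simp: not_low_edge)
    next
      case 2
      then have "(a, b) \<in> inversions ?Z" using subsetD[OF JZ, of "(a, b)"] abcd by auto
      then show False using distinct_abcd unfolding Z by (auto simp: not_low_edge)
    qed
  qed
  have "inversions J \<subseteq> inversions ?X"
  proof (rule subrelI)
    fix i k assume ik: "(i, k) \<in> inversions J"
    have "(i, k) \<in> inversions ?Y" using subsetD[OF JY ik] .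
    moreover have "k = d \<Longrightarrow> \<not> btw c i k" using ik no[of i] by auto
    ultimately show "(i, k) \<in> inversions ?X" unfolding X Y by blast
  qed
  then have "?x \<sqsubseteq>\<^bsub>MN T\<^esub> ?x \<sqinter>\<^bsub>MN T\<^esub> nest J"
    using meet_le[of ?x ?x "nest J"] le_nest_MN S J(1) C nest_MN by simp
  then have "inversions ?W \<subseteq> inversions ?X" using eq J(2) le_nest_MN[OF S S] by simp
  moreover have "(c, d) \<in> inversions ?W" unfolding W using in_E abcd(3) by simp
  moreover have "(c, d) \<notin> inversions ?X" unfolding X using distinct_abcd not_low_edge by simp
  ultimately show False by blast
qed

text \<open>In the same notation x = dabc, y = bdac, z = cdab, and both joins are v = adbc: with
  \<open>d\<close> above \<open>a\<close> in the join, either \<open>d\<close> would be above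
  \<open>p\<close>, where \<open>p\<close> is \<open>b\<close> for y and \<open>c\<close> for z, or
  \<open>p\<close> above \<open>a\<close>, which x forbids. But y meet z is below x, since no path
  to \<open>d\<close> uses both \<open>b\<close> and \<open>c\<close>. The pair
  \<open>(a, d)\<close> tells x from v.\<close>

lemma join_not_semidistributive: "\<not> join_semidistributive_lattice (MN T)"
proof
  assume "join_semidistributive_lattice (MN T)"
  then interpret join_semidistributive_lattice "MN T" .
  let ?X = "rank4 d a b c" and ?Y = "rank4 b d a c" and ?Z = "rank4 c d a b" and ?V = "rank4 a d b c"
  note S = search_rank4
  let ?x = "nest ?X" and ?y = "nest ?Y" and ?z = "nest ?Z" and ?v = "nest ?V"
  note C = nest_MN[OF S]
  have X: "(i, k) \<in> inversions ?X \<longleftrightarrow> i \<in> E \<and> k \<in> E \<and> i < k \<and>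
      (k = a \<or> k = b \<and> \<not> btw a i k \<or> k = c \<and> \<not> btw a i k \<and> \<not> btw b i k \<or> k = d \<or> low_edge i k)" for i k
    using not_btw_larger[of i k]
    by (subst inversions_rank4_abcd; (blast | use distinct_abcd in auto))
  have Y: "(i, k) \<in> inversions ?Y \<longleftrightarrow> i \<in> E \<and> k \<in> E \<and> i < k \<and>
      (k = a \<or> k = b \<or> k = c \<and> \<not> btw a i k \<and> \<not> btw b i k \<or> k = d \<and> \<not> btw b i k \<or> low_edge i k)" for i k
    using not_btw_larger[of i k]
    by (subst inversions_rank4_abcd; (blast | use distinct_abcd in auto))
  have Z: "(i, k) \<in> inversions ?Z \<longleftrightarrow> i \<in> E \<and> k \<in> E \<and> i < k \<and>
      (k = a \<or> k = b \<and> \<not> btw a i k \<or> k = c \<or> k = d \<and> \<not> btw c i k \<or> low_edge i k)" for i k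
    using not_btw_larger[of i k]
    by (subst inversions_rank4_abcd; (blast | use distinct_abcd in auto))
  have V: "(i, k) \<in> inversions ?V \<longleftrightarrow> i \<in> E \<and> k \<in> E \<and> i < k \<and>
      (k = a \<or> k = b \<and> \<not> btw a i k \<or> k = c \<and> \<not> btw a i k \<and> \<not> btw b i k \<or> k = d \<and> \<not> btw a i k \<or> low_edge i k)" for i k
    using not_btw_larger[of i k]
    by (subst inversions_rank4_abcd; (blast | use distinct_abcd in auto))
  have le_X: "inversions ?V \<subseteq> inversions ?X" by (rule subrelI, unfold X V, blast)
  have le_YZ: "inversions ?V \<subseteq> inversions ?Y" "inversions ?V \<subseteq> inversions ?Z"
    by (rule subrelI, unfold Y Z V, use btw_bc in blast)+
  have join: "?x \<squnion>\<^bsub>MN T\<^esub> nest R = ?v"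
    if R: "search R" "inversions ?V \<subseteq> inversions R" and p: "p = b \<or> p = c" "(p, d) \<notin> inversions R" for R p
  proof (rule le_antisym)
    obtain M where M: "search M" "?x \<squnion>\<^bsub>MN T\<^esub> nest R = nest M"
      using carrier_nest[OF join_closed] C nest_MN R(1) by metis
    have "?x \<sqsubseteq>\<^bsub>MN T\<^esub> nest M" "nest R \<sqsubseteq>\<^bsub>MN T\<^esub> nest M"
      using join_left[of ?x "nest R"] join_right[of ?x "nest R"] C nest_MN R(1) M by auto
    then have MX: "inversions M \<subseteq> inversions ?X" and MR: "inversions M \<subseteq> inversions R"
      using le_nest_MN S M(1) R(1) by auto
    have no: "\<not> btw a i d" if i: "(d, i) \<in> M" for i
    proof
      assume "btw a i d"
      then have "(d, a) \<in> M" using search_btw[OF M(1) i, of a] distinct_abcd btw_commute by blast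
      then consider "(d, p) \<in> M" | "(p, a) \<in> M" using cotrans_abcd[OF M(1)] p(1) by blast
      then show False
      proof cases
        case 1
        then show False using subsetD[OF MR, of "(p, d)"] p abcd by auto
      next
        case 2
        then have "(a, p) \<in> inversions ?X" using subsetD[OF MX, of "(a, p)"] p(1) abcd by auto
        then show False using p(1) distinct_abcd unfolding X by (auto simp: not_low_edge)
      qed
    qed
    have "inversions M \<subseteq> inversions ?V"
    proof (rule subrelI)
      fix i k assume ik: "(i, k) \<in> inversions M"
      have "(i, k) \<in> inversions ?X" using subsetD[OF MX ik] .
      moreover have "k = d \<Longrightarrow> \<not> btw a i k" using ik no[of i] by auto
      ultimately show "(i, k) \<in> inversions ?V" unfolding X V by blast
    qed
    then show "?v \<sqsubseteq>\<^bsub>MN T\<^esub> ?x \<squnion>\<^bsub>MN T\<^esub> nest R" using le_nest_MN S M by simp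
    show "?x \<squnion>\<^bsub>MN T\<^esub> nest R \<sqsubseteq>\<^bsub>MN T\<^esub> ?v"
      using join_le[of ?x ?v "nest R"] le_nest_MN S R(1,2) C nest_MN le_X by simp
  qed (use C nest_MN R(1) in auto)
  have "(b, d) \<notin> inversions ?Y" "(c, d) \<notin> inversions ?Z" unfolding Y Z using distinct_abcd by (auto simp: not_low_edge)
  then have "?x \<squnion>\<^bsub>MN T\<^esub> ?y = ?v" "?x \<squnion>\<^bsub>MN T\<^esub> ?z = ?v"
    using join[OF S le_YZ(1), of b] join[OF S le_YZ(2), of c] by auto
  then have eq: "?x \<squnion>\<^bsub>MN T\<^esub> (?y \<sqinter>\<^bsub>MN T\<^esub> ?z) = ?v"
    using join_semidistrib[OF C C C, of d a b c b d a c c d a b] by simp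
  obtain J where J: "search J" "?y \<sqinter>\<^bsub>MN T\<^esub> ?z = nest J"
    using carrier_nest[OF meet_closed] C by metis
  have "nest J \<sqsubseteq>\<^bsub>MN T\<^esub> ?y" "nest J \<sqsubseteq>\<^bsub>MN T\<^esub> ?z"
    using meet_left[of ?y ?z] meet_right[of ?y ?z] C J(2) by auto
  then have JYZ: "inversions ?Y \<union> inversions ?Z \<subseteq> inversions J"
    using le_nest_MN S J(1) by (auto simp del: inversions_iff)
  moreover have "inversions ?X \<subseteq> inversions ?Y \<union> inversions ?Z"
    by (rule subrelI, unfold Un_iff X Y Z, use not_both in blast)
  ultimately have "inversions ?X \<subseteq> inversions J" by blast
  then have "?x \<squnion>\<^bsub>MN T\<^esub> nest J \<sqsubseteq>\<^bsub>MN T\<^esub> ?x"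
    using join_le[of ?x ?x "nest J"] le_nest_MN S J(1) C nest_MN by simp
  then have "inversions ?X \<subseteq> inversions ?V" using eq J(2) le_nest_MN[OF S S] by simp
  moreover have "(a, d) \<in> inversions ?X" unfolding X using in_E abcd(1-3) by simp
  moreover have "(a, d) \<notin> inversions ?V" unfolding V using distinct_abcd not_low_edge by simp
  ultimately show False by blast
qed

end

section \<open>Rooted plane trees\<close>

abbreviation forest_size :: "plane_tree list \<Rightarrow> nat" where
  "forest_size ts \<equiv> \<Sum>t\<leftarrow>ts. num_vertices t"

lemma num_vertices_pos [simp]: "0 < num_vertices t"
  by (cases t) simp

lemma child_pairs_range:
  "(v, w) \<in> child_pairs_from k t \<Longrightarrow> k \<le> v \<and> v < w \<and> w < k + num_vertices t"
  "(v, w) \<in> child_pairs_forest p k ts \<Longrightarrow> p < k \<Longrightarrow>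
     (v = p \<or> k \<le> v) \<and> v < w \<and> k \<le> w \<and> w < k + forest_size ts"
proof (induction k t and p k ts arbitrary: v w and v w
    rule: child_pairs_from_child_pairs_forest.induct)
  case (3 p k t ts)
  from 3(3) consider "(v, w) = (p, k)" | "(v, w) \<in> child_pairs_from k t"
    | "(v, w) \<in> child_pairs_forest p (k + num_vertices t) ts" by auto
  then show ?case
  proof cases
    case 1
    then show ?thesis using 3(4) by simp
  next
    case 2
    then show ?thesis using 3(1)[OF 2] by auto
  next
    case 3
    then show ?thesis using "3.IH"(2)[OF 3] "3.prems"(2) by auto
  qed
qed force+

lemma exists_parent:
  "k < w \<Longrightarrow> w < k + num_vertices t \<Longrightarrow> \<exists>v. (v, w) \<in> child_pairs_from k t"
  "k \<le> w \<Longrightarrow> w < k + forest_size ts \<Longrightarrow> \<exists>v. (v, w) \<in> child_pairs_forest p k ts"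
proof (induction k t and p k ts arbitrary: w and w
    rule: child_pairs_from_child_pairs_forest.induct)
  case (3 p k t ts)
  consider "w = k" | "k < w" "w < k + num_vertices t" | "k + num_vertices t \<le> w"
    using 3(3) by linarith
  then show ?case
  proof cases
    case 2
    then show ?thesis using 3(1) by auto
  next
    case 3
    then show ?thesis using "3.IH"(2)[of w] "3.prems"(2) by auto
  qed auto
qed auto

lemma unique_parent:
  "(v, w) \<in> child_pairs_from k t \<Longrightarrow> (v', w) \<in> child_pairs_from k t \<Longrightarrow> v = v'"
  "(v, w) \<in> child_pairs_forest p k ts \<Longrightarrow> (v', w) \<in> child_pairs_forest p k ts \<Longrightarrow> p < k \<Longrightarrow> v = v'"
proof (induction k t and p k ts arbitrary: v w and v w
    rule: child_pairs_from_child_pairs_forest.induct)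
  case (3 p k t ts)
  have pk: "p < k + num_vertices t" using 3(5) by simp
  show ?case
    using 3(3,4) 3(1,2) pk child_pairs_range(1)[of _ w k t]
      child_pairs_range(2)[of _ w p "k + num_vertices t" ts] by fastforce
qed auto

text \<open>This supplies \<open>par_nested\<close>. Consecutive subtrees occupy consecutive label
  intervals, so pairs from different subtrees cannot cross.\<close>

lemma noncrossing:
  "(v, w) \<in> child_pairs_from k t \<Longrightarrow> (v', w') \<in> child_pairs_from k t \<Longrightarrow> v < w' \<Longrightarrow> w' < w \<Longrightarrow> v \<le> v'"
  "(v, w) \<in> child_pairs_forest p k ts \<Longrightarrow> (v', w') \<in> child_pairs_forest p k ts \<Longrightarrow> p < k \<Longrightarrow>
     v < w' \<Longrightarrow> w' < w \<Longrightarrow> v \<le> v'"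
proof (induction k t and p k ts arbitrary: v w v' w' and v w v' w'
    rule: child_pairs_from_child_pairs_forest.induct)
  case (3 p k t ts)
  let ?k = "k + num_vertices t"
  have pk: "p < ?k" using 3(5) by simp
  have range: "(v', w') = (p, k) \<or> (v', w') \<in> child_pairs_from k t \<and> k \<le> v' \<and> k < w' \<and> w' < ?k \<or>
      (v', w') \<in> child_pairs_forest p ?k ts \<and> (v' = p \<or> ?k \<le> v') \<and> ?k \<le> w'"
    using 3(4) child_pairs_range(1)[of v' w' k t] child_pairs_range(2)[of v' w' p ?k ts, OF _ pk] by auto
  from 3(3) consider "v = p" | "(v, w) \<in> child_pairs_from k t"
    | "(v, w) \<in> child_pairs_forest p ?k ts" "v \<noteq> p" by auto
  then show ?case
  proof cases
    case 1
    then show ?thesis using range 3(5) by auto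
  next
    case 2
    then have "k \<le> v" "w < ?k" using child_pairs_range(1) by auto
    then have "(v', w') \<in> child_pairs_from k t" using range "3.prems"(4,5) by auto
    then show ?thesis using "3.IH"(1)[OF 2] "3.prems"(4,5) by blast
  next
    case 3
    then have "?k \<le> v" using child_pairs_range(2)[OF 3(1) pk] by auto
    then have "(v', w') \<in> child_pairs_forest p ?k ts" using range "3.prems"(4,5) by auto
    then show ?thesis using "3.IH"(2)[OF 3(1) _ pk] "3.prems"(4,5) by blast
  qed
qed auto

lemma child_pairs_forest_append:
  "child_pairs_forest p k (us @ ws) =
     child_pairs_forest p k us \<union> child_pairs_forest p (k + forest_size us) ws"
  by (induction us arbitrary: k) (auto simp: add.assoc)

lemma child_pairs_snoc:
  "child_pairs_from k (Node (us @ [t])) = child_pairs_forest k (Suc k) us \<union>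
     insert (k, Suc k + forest_size us) (child_pairs_from (Suc k + forest_size us) t)"
  by (auto simp: child_pairs_forest_append)

lemma rightmost_snoc:
  "rightmost_branch_from k (Node (us @ [t])) =
     insert k (rightmost_branch_from (Suc k + forest_size us) t)"
  by simp

declare rightmost_branch_from.simps [simp del] child_pairs_from.simps [simp del]

text \<open>The rightmost branch continues in the last subtree, so the induction splits off the last
  child.\<close>

lemma plane_tree_rev_induct [case_names leaf snoc]:
  assumes "P (Node [])" "\<And>us t. (\<And>u. u \<in> set us \<Longrightarrow> P u) \<Longrightarrow> P t \<Longrightarrow> P (Node (us @ [t]))"
  shows "P t"
proof (induction t)
  case (Node ts)
  then show ?case using assms by (cases ts rule: rev_cases) auto
qed

lemma rightmost_leaf: "rightmost_branch_from k (Node []) = {k}"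
  by (simp add: rightmost_branch_from.simps)

lemma rightmost_range:
  "v \<in> rightmost_branch_from k t \<Longrightarrow> k \<le> v \<and> v < k + num_vertices t"
proof (induction t arbitrary: k rule: plane_tree_rev_induct)
  case (snoc us t)
  from snoc(3) consider "v = k" | "v \<in> rightmost_branch_from (Suc k + forest_size us) t"
    by (auto simp: rightmost_snoc)
  then show ?case using snoc(2)[of "Suc k + forest_size us"] by cases auto
qed (simp add: rightmost_leaf)

lemma root_in_rightmost: "k \<in> rightmost_branch_from k t"
  by (cases t) (simp add: rightmost_branch_from.simps)

lemma last_in_rightmost: "k + num_vertices t - 1 \<in> rightmost_branch_from k t"
proof (induction t arbitrary: k rule: plane_tree_rev_induct)
  case (snoc us t)
  show ?case using snoc(2)[of "Suc k + forest_size us"] by (simp add: rightmost_snoc add.assoc)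
qed (simp add: rightmost_leaf)

lemma parent_in_rightmost:
  "(v, w) \<in> child_pairs_from k t \<Longrightarrow> w \<in> rightmost_branch_from k t \<Longrightarrow> v \<in> rightmost_branch_from k t"
proof (induction t arbitrary: k rule: plane_tree_rev_induct)
  case (snoc us t)
  let ?k = "Suc k + forest_size us"
  have "k < w" using child_pairs_range(1)[OF snoc(3)] by simp
  then have w: "w \<in> rightmost_branch_from ?k t" using snoc(4) by (auto simp: rightmost_snoc)
  then have "(v, w) \<notin> child_pairs_forest k (Suc k) us"
    using rightmost_range[OF w] child_pairs_range(2)[of v w k "Suc k" us] by auto
  then consider "v = k" | "(v, w) \<in> child_pairs_from ?k t" using snoc(3) by (auto simp: child_pairs_snoc)
  then show ?case using snoc(2) w by cases (auto simp: rightmost_snoc)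
qed (simp add: child_pairs_from.simps)

lemma child_in_rightmost:
  "v \<in> rightmost_branch_from k t \<Longrightarrow> v \<noteq> k + num_vertices t - 1 \<Longrightarrow>
     \<exists>w\<in>rightmost_branch_from k t. (v, w) \<in> child_pairs_from k t"
proof (induction t arbitrary: k rule: plane_tree_rev_induct)
  case (snoc us t)
  let ?k = "Suc k + forest_size us"
  from snoc(3) consider "v = k" | "v \<in> rightmost_branch_from ?k t" by (auto simp: rightmost_snoc)
  then show ?case
  proof cases
    case 1
    then show ?thesis using root_in_rightmost by (auto simp: rightmost_snoc child_pairs_snoc)
  next
    case 2
    then obtain w where "w \<in> rightmost_branch_from ?k t" "(v, w) \<in> child_pairs_from ?k t"
      using snoc(2)[OF 2] snoc(4) by (auto simp: add.assoc)
    then show ?thesis by (auto simp: rightmost_snoc child_pairs_snoc)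
  qed
qed (simp add: rightmost_leaf)

section \<open>Paths, combs and branching off the rightmost branch\<close>

inductive path_tree :: "plane_tree \<Rightarrow> bool" where
  path_leaf: "path_tree (Node [])"
| path_step: "path_tree t \<Longrightarrow> path_tree (Node [t])"

text \<open>The rightmost branch is the spine, and only paths hang off it.\<close>

inductive comb_tree :: "plane_tree \<Rightarrow> bool" where
  comb_leaf: "comb_tree (Node [])"
| comb_step: "\<lbrakk>\<forall>u\<in>set us. path_tree u; comb_tree t\<rbrakk> \<Longrightarrow> comb_tree (Node (us @ [t]))"

lemma path_tree_Node: "path_tree (Node ts) \<longleftrightarrow> ts = [] \<or> (\<exists>t. ts = [t] \<and> path_tree t)"
  by (subst path_tree.simps) auto

lemma comb_tree_snoc: "comb_tree (Node (us @ [t])) \<longleftrightarrow> (\<forall>u\<in>set us. path_tree u) \<and> comb_tree t"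
  by (subst comb_tree.simps) auto

lemma path_tree_imp_comb: "path_tree t \<Longrightarrow> comb_tree t"
proof (induction rule: path_tree.induct)
  case (path_step t)
  then show ?case using comb_tree_snoc[of "[]" t] by simp
qed (rule comb_leaf)

lemma paths_imp_comb: "\<forall>u\<in>set us. path_tree u \<Longrightarrow> comb_tree (Node us)"
  by (cases us rule: rev_cases) (auto simp: comb_tree_snoc path_tree_imp_comb comb_leaf)

definition unary_from :: "nat \<Rightarrow> plane_tree \<Rightarrow> bool" where
  "unary_from k t \<longleftrightarrow>
     (\<forall>v w w'. (v, w) \<in> child_pairs_from k t \<longrightarrow> (v, w') \<in> child_pairs_from k t \<longrightarrow> w = w')"

definition spine_from :: "nat \<Rightarrow> plane_tree \<Rightarrow> bool" where
  "spine_from k t \<longleftrightarrow>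
     (\<forall>v w w'. (v, w) \<in> child_pairs_from k t \<longrightarrow> (v, w') \<in> child_pairs_from k t \<longrightarrow> w \<noteq> w' \<longrightarrow>
        v \<in> rightmost_branch_from k t)"

lemma unary_from_iff: "unary_from k t \<longleftrightarrow> path_tree t"
proof (induction t arbitrary: k)
  case (Node ts)
  consider "ts = []" | t where "ts = [t]" | t u r where "ts = t # u # r"
    by (cases ts; cases "tl ts") auto
  then show ?case
  proof cases
    case 1
    then show ?thesis by (simp add: unary_from_def path_leaf child_pairs_from.simps)
  next
    case (2 t)
    have cp: "child_pairs_from k (Node ts) = insert (k, Suc k) (child_pairs_from (Suc k) t)"
      using 2 by (simp add: child_pairs_from.simps)
    have "v \<noteq> k" if "(v, w) \<in> child_pairs_from (Suc k) t" for v w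
      using child_pairs_range(1)[OF that] by simp
    then have "unary_from k (Node ts) \<longleftrightarrow> unary_from (Suc k) t"
      unfolding unary_from_def cp by blast
    then show ?thesis using Node[of t "Suc k"] 2 by (simp add: path_tree_Node)
  next
    case (3 t u r)
    have "(k, Suc k) \<in> child_pairs_from k (Node ts)"
      "(k, Suc k + num_vertices t) \<in> child_pairs_from k (Node ts)"
      using 3 by (auto simp: child_pairs_from.simps)
    then have "\<not> unary_from k (Node ts)" unfolding unary_from_def
      using num_vertices_pos[of t] by (metis add_cancel_right_right less_numeral_extra(3))
    then show ?thesis using 3 by (simp add: path_tree_Node)
  qed
qed

lemma unary_forest:
  "\<lbrakk>\<forall>u\<in>set us. path_tree u; p < k; v \<noteq> p; (v, w) \<in> child_pairs_forest p k us;
    (v, w') \<in> child_pairs_forest p k us\<rbrakk> \<Longrightarrow> w = w'"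
proof (induction us arbitrary: k)
  case (Cons u us)
  let ?k = "k + num_vertices u"
  have pk: "p < ?k" using Cons.prems(2) by simp
  have split: "(v, x) \<in> child_pairs_from k u \<and> v < ?k \<or> (v, x) \<in> child_pairs_forest p ?k us \<and> ?k \<le> v"
    if "(v, x) \<in> child_pairs_forest p k (u # us)" for x
    using that Cons.prems(3) child_pairs_range(1)[of v x k u] child_pairs_range(2)[of v x p ?k us, OF _ pk]
    by auto
  have "unary_from k u" using Cons.prems(1) by (simp add: unary_from_iff)
  then show ?case
    using split[OF Cons.prems(4)] split[OF Cons.prems(5)] Cons.IH[OF _ pk Cons.prems(3)] Cons.prems(1)
    unfolding unary_from_def by auto
qed simp

text \<open>The subtrees before the last one are disjoint from the rightmost branch and so must be
  paths; the last subtree satisfies the same condition again.\<close>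

lemma spine_from_iff: "spine_from k t \<longleftrightarrow> comb_tree t"
proof (induction t arbitrary: k rule: plane_tree_rev_induct)
  case leaf
  then show ?case by (simp add: spine_from_def comb_leaf child_pairs_from.simps)
next
  case (snoc us t)
  let ?k = "Suc k + forest_size us"
  have split: "v = k \<or> (v, w) \<in> child_pairs_forest k (Suc k) us \<and> k < v \<and> v < ?k \<or>
      (v, w) \<in> child_pairs_from ?k t \<and> ?k \<le> v"
    if "(v, w) \<in> child_pairs_from k (Node (us @ [t]))" for v w
    using that child_pairs_range(1)[of v w ?k t] child_pairs_range(2)[of v w k "Suc k" us]
    by (auto simp: child_pairs_snoc)
  show ?case
  proof
    assume L: "spine_from k (Node (us @ [t]))"
    have "spine_from ?k t" unfolding spine_from_def
    proof (intro allI impI)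
      fix v w w' assume *: "(v, w) \<in> child_pairs_from ?k t" "(v, w') \<in> child_pairs_from ?k t" "w \<noteq> w'"
      then have "v \<in> rightmost_branch_from k (Node (us @ [t]))"
        using L unfolding spine_from_def child_pairs_snoc by blast
      moreover have "v \<noteq> k" using child_pairs_range(1)[OF *(1)] by simp
      ultimately show "v \<in> rightmost_branch_from ?k t" by (simp add: rightmost_snoc)
    qed
    moreover have "path_tree u" if u: "u \<in> set us" for u
    proof -
      obtain us1 us2 where us: "us = us1 @ u # us2" using split_list[OF u] by blast
      let ?j = "Suc k + forest_size us1"
      have "unary_from ?j u" unfolding unary_from_def
      proof (intro allI impI)
        fix v w w' assume *: "(v, w) \<in> child_pairs_from ?j u" "(v, w') \<in> child_pairs_from ?j u"
        have "child_pairs_from ?j u \<subseteq> child_pairs_from k (Node (us @ [t]))"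
          unfolding child_pairs_snoc us child_pairs_forest_append by auto
        moreover have "?j + num_vertices u \<le> ?k" by (simp add: us)
        then have "v \<notin> rightmost_branch_from k (Node (us @ [t]))"
          using rightmost_range[of v ?k t] child_pairs_range(1)[OF *(1)] unfolding rightmost_snoc by auto
        ultimately show "w = w'" using L * unfolding spine_from_def by blast
      qed
      then show ?thesis by (simp add: unary_from_iff)
    qed
    ultimately show "comb_tree (Node (us @ [t]))" using snoc(2) by (simp add: comb_tree_snoc)
  next
    assume "comb_tree (Node (us @ [t]))"
    then have us: "\<forall>u\<in>set us. path_tree u" and t: "spine_from ?k t"
      using snoc(2) by (auto simp: comb_tree_snoc)
    show "spine_from k (Node (us @ [t]))" unfolding spine_from_def
    proof (intro allI impI)
      fix v w w' assume w: "(v, w) \<in> child_pairs_from k (Node (us @ [t]))"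
        "(v, w') \<in> child_pairs_from k (Node (us @ [t]))" "w \<noteq> w'"
      show "v \<in> rightmost_branch_from k (Node (us @ [t]))"
        using split[OF w(1)] split[OF w(2)] unary_forest[OF us, of k "Suc k" v w w'] t w(3)
        unfolding spine_from_def rightmost_snoc by auto
    qed
  qed
qed

lemma card_children_iff:
  "(\<forall>v \<in> vertices T - rightmost_branch T. card {w. (v, w) \<in> child_pairs T} \<le> 1) \<longleftrightarrow> spine_from 0 T"
proof -
  have fin: "finite {w. (v, w) \<in> child_pairs T}" for v
    by (rule finite_subset[of _ "{..<num_vertices T}"])
      (use child_pairs_range(1)[of v _ 0 T] in \<open>auto simp: child_pairs_def\<close>)
  have card: "card {w. (v, w) \<in> child_pairs T} \<le> 1 \<longleftrightarrow>
      (\<forall>w w'. (v, w) \<in> child_pairs T \<longrightarrow> (v, w') \<in> child_pairs T \<longrightarrow> w = w')" for v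
    using card_le_Suc0_iff_eq[OF fin, of v] by auto
  have "v \<in> vertices T" if "(v, w) \<in> child_pairs T" for v w
    using child_pairs_range(1)[of v w 0 T] that by (auto simp: vertices_def child_pairs_def)
  then show ?thesis
    unfolding card spine_from_def rightmost_branch_def child_pairs_def[symmetric] by blast
qed

section \<open>Combs and edge contraction\<close>

lemma contracts_subtree:
  "contract_edge\<^sup>*\<^sup>* t t' \<Longrightarrow> contract_edge\<^sup>*\<^sup>* (Node (us @ t # ws)) (Node (us @ t' # ws))"
  by (induction rule: rtranclp_induct) (auto intro: rtranclp.rtrancl_into_rtrancl contract_edge.in_subtree)

lemma contracts_to_leaf: "contract_edge\<^sup>*\<^sup>* t (Node [])"
proof (induction t)
  case (Node ts)
  then show ?case
  proof (induction ts)
    case (Cons t ts)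
    have "contract_edge\<^sup>*\<^sup>* (Node ([] @ t # ts)) (Node ([] @ Node [] # ts))"
      using Cons.prems by (intro contracts_subtree) simp
    moreover have "contract_edge (Node ([] @ Node [] # ts)) (Node ([] @ [] @ ts))"
      by (rule contract_edge.at_root)
    moreover have "contract_edge\<^sup>*\<^sup>* (Node ts) (Node [])" using Cons by simp
    ultimately show ?case by simp
  qed simp
qed

lemma contracts_remove: "contract_edge\<^sup>*\<^sup>* (Node (us @ ts @ ws)) (Node (us @ ws))"
proof (induction ts)
  case (Cons t ts)
  have "contract_edge\<^sup>*\<^sup>* (Node (us @ t # ts @ ws)) (Node (us @ Node [] # ts @ ws))"
    by (rule contracts_subtree[OF contracts_to_leaf])
  moreover have "contract_edge (Node (us @ Node [] # ts @ ws)) (Node (us @ [] @ ts @ ws))"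
    by (rule contract_edge.at_root)
  ultimately show ?case using Cons by simp
qed simp

text \<open>Single children are followed down to the first branching, where all but two subtrees are
  removed and those two shrink to leaves; the edges on the way are contracted too.\<close>

lemma contracts_to_cherry: "\<not> path_tree t \<Longrightarrow> contract_edge\<^sup>*\<^sup>* t (Node [Node [], Node []])"
proof (induction t)
  case (Node ts)
  consider "ts = []" | t where "ts = [t]" | t u r where "ts = t # u # r"
    by (cases ts; cases "tl ts") auto
  then show ?case
  proof cases
    case 1
    then show ?thesis using Node.prems path_leaf by simp
  next
    case (2 t)
    then have "contract_edge\<^sup>*\<^sup>* (Node ([] @ t # [])) (Node ([] @ Node [Node [], Node []] # []))"
      using Node by (intro contracts_subtree) (auto simp: path_tree_Node)
    moreover have "contract_edge (Node ([] @ Node [Node [], Node []] # []))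
        (Node ([] @ [Node [], Node []] @ []))" by (rule contract_edge.at_root)
    ultimately show ?thesis using 2 by simp
  next
    case (3 t u r)
    have "contract_edge\<^sup>*\<^sup>* (Node (t # u # r)) (Node [t, u])"
      using contracts_remove[of "[t, u]" r "[]"] by simp
    moreover have "contract_edge\<^sup>*\<^sup>* (Node [t, u]) (Node [Node [], u])"
      using contracts_subtree[OF contracts_to_leaf, of "[]" t "[u]"] by simp
    moreover have "contract_edge\<^sup>*\<^sup>* (Node [Node [], u]) (Node [Node [], Node []])"
      using contracts_subtree[OF contracts_to_leaf, of "[Node []]" u "[]"] by simp
    ultimately show ?thesis using 3 by simp
  qed
qed

text \<open>If the last subtree is not a comb, it contracts to \<open>Y_tree\<close> and is merged
  with the root. Otherwise an earlier subtree that is not a path becomes the cherry at vertex 1, and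
  the last subtree shrinks to vertex 4.\<close>

lemma contracts_to_Y: "\<not> comb_tree t \<Longrightarrow> contract_edge\<^sup>*\<^sup>* t Y_tree"
proof (induction t rule: plane_tree_rev_induct)
  case leaf
  then show ?case using comb_leaf by simp
next
  case (snoc us t)
  show ?case
  proof (cases "comb_tree t")
    case False
    have "contract_edge\<^sup>*\<^sup>* (Node (us @ [t])) (Node [t])" using contracts_remove[of "[]" us "[t]"] by simp
    moreover have "contract_edge\<^sup>*\<^sup>* (Node [t]) (Node [Y_tree])"
      using contracts_subtree[OF snoc(2)[OF False], of "[]" "[]"] by simp
    moreover have "contract_edge (Node [Y_tree]) Y_tree"
      using contract_edge.at_root[of "[]" "[Node [Node [], Node []], Node []]" "[]"] by (simp add: Y_tree_def)
    ultimately show ?thesis by simp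
  next
    case True
    then obtain u where u: "u \<in> set us" "\<not> path_tree u" using snoc(3) by (auto simp: comb_tree_snoc)
    obtain us1 us2 where us: "us = us1 @ u # us2" using split_list[OF u(1)] by blast
    have "contract_edge\<^sup>*\<^sup>* (Node (us @ [t])) (Node (u # us2 @ [t]))"
      using contracts_remove[of "[]" us1 "u # us2 @ [t]"] by (simp add: us)
    moreover have "contract_edge\<^sup>*\<^sup>* (Node (u # us2 @ [t])) (Node [u, t])"
      using contracts_remove[of "[u]" us2 "[t]"] by simp
    moreover have "contract_edge\<^sup>*\<^sup>* (Node [u, t]) (Node [Node [Node [], Node []], t])"
      using contracts_subtree[OF contracts_to_cherry[OF u(2)], of "[]" "[t]"] by simp
    moreover have "contract_edge\<^sup>*\<^sup>* (Node [Node [Node [], Node []], t]) Y_tree"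
      using contracts_subtree[OF contracts_to_leaf, of "[Node [Node [], Node []]]" t "[]"]
      by (simp add: Y_tree_def)
    ultimately show ?thesis by simp
  qed
qed

text \<open>One induction treats both properties, because a contraction in a comb may take place
  inside one of its hanging paths. If the contracted child is the last one and has no children, the
  path before it becomes the end of the spine.\<close>

lemma contract_edge_preserves:
  "contract_edge t t' \<Longrightarrow> (path_tree t \<longrightarrow> path_tree t') \<and> (comb_tree t \<longrightarrow> comb_tree t')"
proof (induction rule: contract_edge.induct)
  case (at_root us vs ws)
  have "path_tree (Node (us @ vs @ ws))" if "path_tree (Node (us @ Node vs # ws))"
    using that by (auto simp: path_tree_Node append_eq_Cons_conv Cons_eq_append_conv)
  moreover have "comb_tree (Node (us @ vs @ ws))" if comb: "comb_tree (Node (us @ Node vs # ws))"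
  proof (cases ws rule: rev_cases)
    case Nil
    then have us: "\<forall>u\<in>set us. path_tree u" and v: "comb_tree (Node vs)"
      using comb comb_tree_snoc[of us "Node vs"] by auto
    show ?thesis
    proof (cases vs rule: rev_cases)
      case (snoc vs' v')
      then show ?thesis using us v Nil comb_tree_snoc[of "us @ vs'" v'] by (auto simp: comb_tree_snoc)
    qed (use us Nil paths_imp_comb in simp)
  next
    case (snoc ws' w)
    then have "(\<forall>u\<in>set (us @ Node vs # ws'). path_tree u) \<and> comb_tree w"
      using comb comb_tree_snoc[of "us @ Node vs # ws'" w] by simp
    then show ?thesis using snoc comb_tree_snoc[of "us @ vs @ ws'" w] by (auto simp: path_tree_Node)
  qed
  ultimately show ?case by blast
next
  case (in_subtree t t' us ws)
  have "path_tree (Node (us @ t' # ws))" if "path_tree (Node (us @ t # ws))"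
    using that in_subtree(2) by (auto simp: path_tree_Node append_eq_Cons_conv Cons_eq_append_conv)
  moreover have "comb_tree (Node (us @ t' # ws))" if comb: "comb_tree (Node (us @ t # ws))"
  proof (cases ws rule: rev_cases)
    case Nil
    then show ?thesis using comb in_subtree(2) by (auto simp: comb_tree_snoc)
  next
    case (snoc ws' w)
    then show ?thesis
      using comb in_subtree(2) comb_tree_snoc[of "us @ t # ws'" w] comb_tree_snoc[of "us @ t' # ws'" w]
      by auto
  qed
  ultimately show ?case by blast
qed

lemma not_comb_Y: "\<not> comb_tree Y_tree"
  using comb_tree_snoc[of "[Node [Node [], Node []]]" "Node []"] by (simp add: Y_tree_def path_tree_Node)

lemma contains_Y_iff: "contains_tree T Y_tree \<longleftrightarrow> \<not> comb_tree T"
proof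
  assume "contains_tree T Y_tree"
  then have *: "contract_edge\<^sup>*\<^sup>* T Y_tree" by (simp add: contains_tree_def)
  show "\<not> comb_tree T"
  proof
    assume "comb_tree T"
    with * have "comb_tree Y_tree"
      by (induction rule: rtranclp_induct) (use contract_edge_preserves in auto)
    then show False using not_comb_Y by simp
  qed
qed (simp add: contains_tree_def contracts_to_Y)

section \<open>Transfer from plane trees to preorder labels\<close>

definition parent :: "plane_tree \<Rightarrow> nat \<Rightarrow> nat" where
  "parent T w = (THE v. (v, w) \<in> child_pairs T)"

lemma parent_iff:
  assumes "1 \<le> w" "w \<le> num_vertices T - 1" shows "(v, w) \<in> child_pairs T \<longleftrightarrow> v = parent T w"
proof -
  have "w < num_vertices T" using assms by linarith
  then obtain u where u: "(u, w) \<in> child_pairs T"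
    using exists_parent(1)[of 0 w T] assms(1) by (auto simp: child_pairs_def)
  then have "parent T w = u"
    unfolding parent_def child_pairs_def using unique_parent(1) by (intro the_equality) blast+
  with u show ?thesis using unique_parent(1) by (auto simp: child_pairs_def)
qed

lemma child_pairs_bounds: "(v, w) \<in> child_pairs T \<Longrightarrow> v < w \<and> w \<le> num_vertices T - 1"
  using child_pairs_range(1)[of v w 0 T] by (auto simp: child_pairs_def)

lemma preorder_tree_parent: "preorder_tree (num_vertices T - 1) (parent T)"
proof
  fix k assume k: "1 \<le> k" "k \<le> num_vertices T - 1"
  have pk: "(parent T k, k) \<in> child_pairs T" using parent_iff[OF k] by simp
  then show less: "parent T k < k" using child_pairs_bounds by blast
  show "parent T k \<le> parent T j" if "parent T k < j" "j < k" for j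
  proof -
    have "(parent T j, j) \<in> child_pairs T" using parent_iff[of j T] that k by auto
    then show ?thesis using noncrossing(1) pk that unfolding child_pairs_def by blast
  qed
qed

lemma plane_preorder_tree_parent: "plane_preorder_tree (num_vertices T - 1) (parent T) T"
proof -
  interpret preorder_tree "num_vertices T - 1" "parent T" by (rule preorder_tree_parent)
  show ?thesis
  proof
    show "vertices T = {..num_vertices T - 1}"
      by (cases T) (auto simp: vertices_def less_Suc_eq_le)
    show "child_pairs T = {(parent T k, k) |k. k \<in> E}"
    proof -
      have "(v, w) \<in> child_pairs T \<longleftrightarrow> w \<in> E \<and> v = parent T w" for v w
        unfolding E_def atLeastAtMost_iff
        using parent_iff[of w T v] child_pairs_bounds[of v w T]
        by (cases "1 \<le> w \<and> w \<le> num_vertices T - 1") auto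
      then show ?thesis by auto
    qed
  qed
qed

context plane_preorder_tree
begin

lemma child_pairs_iff: "(v, w) \<in> child_pairs T \<longleftrightarrow> w \<in> E \<and> v = par w"
  by (auto simp: child_pairs_eq)

lemma last_vertex: "num_vertices T - 1 = n"
proof -
  have "{..<num_vertices T} = {..<Suc n}"
    using vertices_eq unfolding vertices_def lessThan_Suc_atMost .
  then show ?thesis by (simp only: lessThan_eq_iff diff_Suc_1)
qed

text \<open>The rightmost branch contains the last preorder vertex, is closed under parents, and
  continues to a child from each of its other vertices.\<close>

lemma rightmost_iff: "v \<in> rightmost_branch T \<longleftrightarrow> anc v n \<and> v \<le> n"
proof
  have "u \<in> rightmost_branch T" if "anc u w" "w \<in> rightmost_branch T" for u w
    using that
  proof (induction rule: anc.induct)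
    case (anc_step u w)
    then have "(par w, w) \<in> child_pairs T" by (simp add: child_pairs_iff E_def)
    then show ?case
      using anc_step parent_in_rightmost by (auto simp: child_pairs_def rightmost_branch_def)
  qed
  moreover have "n \<in> rightmost_branch T"
    using last_in_rightmost[of 0 T] last_vertex by (simp add: rightmost_branch_def)
  ultimately show "anc v n \<and> v \<le> n \<Longrightarrow> v \<in> rightmost_branch T" by blast
next
  assume "v \<in> rightmost_branch T"
  then show "anc v n \<and> v \<le> n"
  proof (induction "n - v" arbitrary: v rule: less_induct)
    case less
    show ?case
    proof (cases "v = n")
      case False
      then obtain w where w: "w \<in> rightmost_branch T" "(v, w) \<in> child_pairs T"
        using child_in_rightmost[of v 0 T] less.prems last_vertex
        by (auto simp: child_pairs_def rightmost_branch_def)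
      then have "w \<in> E" "v = par w" "v < w" "w \<le> n" using par_less'[of w] by (auto simp: child_pairs_iff E_def)
      moreover then have "anc w n" using less.hyps[of w] w(1) by auto
      ultimately show ?thesis using anc_par_iff[of w v] anc_trans[of w n v] anc_par[of w v] by auto
    qed simp
  qed
qed

lemma narrow_iff: "narrow \<longleftrightarrow> spine_from 0 T"
proof -
  have "par w \<le> n" if "w \<in> E" for w using that par_less'[OF that] by (simp add: E_def)
  then show ?thesis
    unfolding narrow_def spine_from_def child_pairs_def[symmetric] rightmost_branch_def[symmetric]
      rightmost_iff child_pairs_iff by blast
qed

text \<open>A branching vertex off the rightmost branch is not the root, so it labels an edge and
  can serve as \<open>a\<close>. The last vertex \<open>n\<close> is not its descendant, hence
  exceeds both children and serves as \<open>d\<close>.\<close>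

lemma broad:
  assumes "\<not> narrow"
  obtains a b c where "broad_preorder_tree n par T a b c n"
proof -
  obtain x y where xy: "x \<in> E" "y \<in> E" "par x = par y" "x \<noteq> y" "\<not> anc (par x) n"
    using assms unfolding narrow_def by blast
  define b c where "b = min x y" and "c = max x y"
  have bc: "b \<in> E" "c \<in> E" "par b = par x" "par c = par x" "b < c"
    using xy by (auto simp: b_def c_def min_def max_def)
  have "par x \<noteq> 0" using xy(5) anc_zero[OF order_refl] by metis
  then have a: "par x \<in> E" "par x < b" using par_less'[OF bc(1)] bc(1,3) by (auto simp: E_def)
  have "anc (par x) c" using anc_par[OF bc(2)] bc(4) by auto
  then have "c \<noteq> n" using xy(5) by auto
  then have "c < n" using bc(2) by (simp add: E_def)
  then have "broad_preorder_tree n par T (par x) b c n"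
    using a bc xy(5) by unfold_locales auto
  then show ?thesis by (rule that)
qed

lemma MN_semidistributive_iff:
  "meet_semidistributive_lattice (MN T) \<longleftrightarrow> narrow" "join_semidistributive_lattice (MN T) \<longleftrightarrow> narrow"
  using meet_semidistributive join_semidistributive broad
    broad_preorder_tree.meet_not_semidistributive broad_preorder_tree.join_not_semidistributive by metis+

end

theorem theorem1p3:
  fixes T :: plane_tree
  shows
    "(semidistributive_lattice (MN T) \<longleftrightarrow> meet_semidistributive_lattice (MN T)) \<and>
     (meet_semidistributive_lattice (MN T) \<longleftrightarrow> join_semidistributive_lattice (MN T)) \<and>
     (join_semidistributive_lattice (MN T) \<longleftrightarrow> \<not> contains_tree T Y_tree) \<and>
     (\<not> contains_tree T Y_tree \<longleftrightarrow>
        (\<forall>v \<in> vertices T - rightmost_branch T. card {w. (v, w) \<in> child_pairs T} \<le> 1))"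
proof -
  interpret plane_preorder_tree "num_vertices T - 1" "parent T" T by (rule plane_preorder_tree_parent)
  show ?thesis
    unfolding semidistributive_lattice_def MN_semidistributive_iff card_children_iff narrow_iff
      contains_Y_iff spine_from_iff by blast
qed

end
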